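(* Let $X=\Gamma\backslash\mathbb{B}_n$ be an arithmetic ball quotient with toroidal compactification $(\overline{X},D)$, let $(E_1,\theta)$ be its uniformizing Higgs bundle, and let $k\ge 1$. Then the $L^2$-Higgs complex of the symmetric power $(S^kE_1,\theta)$ is quasi-isomorphic to a complex $$0\to T^0(k)\xrightarrow{\,0\,}T^1(k)\xrightarrow{\,0\,}\cdots\xrightarrow{\,0\,}T^n(k)\to 0$$ with trivial differentials, where $T^0(k)=L^{-k}$ and, for $i=1,\dots,n$, $T^i(k)$ is the sheaf of $L^2$-sections of $$\mathrm{Ker}\Big(S^k\Omega^1_{\overline{X}}(\log D)\otimes L^{-k}\otimes\Omega^i_{\overline{X}}(\log D)\to S^{k-1}\Omega^1_{\overline{X}}(\log D)\otimes L^{-k}\otimes\Omega^{i+1}_{\overline{X}}(\log D)\Big).$$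
   Context: $\mathbb{B}_n=SU(n,1)/U(n)$ is the complex $n$-ball and $\Gamma\subset SU(n,1)$ is an arithmetic subgroup with $X=\Gamma\backslash\mathbb{B}_n$ non-compact. $\overline{X}$ denotes the toroidal compactification of $X$, whose boundary divisor $D=\overline{X}\setminus X$ is smooth (a disjoint union of abelian varieties). Standing assumptions: $\Gamma$ is torsion-free (so $X$ is smooth) and the local system $\mathbb{V}_1$ on $X$ given by the standard representation $\Gamma\subset SU(n,1)\to GL(n+1,\mathbb{C})$ has unipotent monodromy around every component of $D$. $L$ is a line bundle with $L^{n+1}=\mathcal{O}_{\overline{X}}(K_{\overline{X}}+D)$. The uniformizing Higgs bundle (corresponding to $\mathbb{V}_1$) is $E_1=(\Omega^1_{\overline{X}}(\log D)\otimes L^{-1})\oplus L^{-1}$ with Higgs field $\theta:E_1\to E_1\otimes\Omega^1_{\overline{X}}(\log D)$ equal to the identity $\Omega^1_{\overline{X}}(\log D)\otimes L^{-1}\to L^{-1}\otimes\Omega^1_{\overline{X}}(\log D)$ on the first summand and $0$ on $L^{-1}$. Hence $S^kE_1=\bigoplus_{j=0}^kS^j\Omega^1_{\overline{X}}(\log D)\otimes L^{-k}$, with the induced Higgs field (derivation extension), again denoted $\theta$, mapping $S^j\Omega^1_{\overline{X}}(\log D)\otimes L^{-k}$ to $S^{j-1}\Omega^1_{\overline{X}}(\log D)\otimes L^{-k}\otimes\Omega^1_{\overline{X}}(\log D)$. The map in the claim is the corresponding component of $\wedge\theta$. For a logarithmic Higgs bundle $(E,\theta)$ on $(\overline{X},D)$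 coming from a complex variation of Hodge structure with unipotent monodromy, the Higgs complex is $(E\otimes\Omega^\bullet_{\overline{X}}(\log D),\wedge\theta)$, and the $L^2$-Higgs complex is the algebraic subcomplex $\Omega^\bullet_{(2)}(E)\subset E\otimes\Omega^\bullet_{\overline{X}}(\log D)$ of Zucker and Jost–Yang–Zuo, whose hypercohomology is isomorphic to the $L^2$-cohomology (= intersection cohomology on $\overline{X}$) of the local system. For smooth $D$, in local coordinates $z_1,\dots,z_n$ with $D=\{z_1=0\}$, it is $$\Omega^p_{(2)}(E)=\frac{dz_1}{z_1}\wedge\Lambda^{p-1}\langle dz_2,\dots,dz_n\rangle\otimes\widetilde{W}_{-2}E+\Lambda^p\langle dz_2,\dots,dz_n\rangle\otimes\widetilde{W}_0E,$$ where $W_\bullet$ is the monodromy weight filtration (centered at $0$) of the nilpotent endomorphism $N=\mathrm{Res}(\theta)$ of $E|_D$ and $\widetilde{W}_mE$ is the preimage of $W_m$ under $E\to E|_D$. The sheaf of $L^2$-sections of a subsheaf of $E\otimes\Omega^i_{\overline{X}}(\log D)$ means its intersection with $\Omega^i_{(2)}(E)$ (here $E=S^kE_1$). *)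

theory Defs
  imports "HOL-Analysis.Analysis" "HOL-Algebra.Module" "HOL-Algebra.Coset"
begin

section \<open>The group SU(n,1), arithmetic subgroups, and the ball\<close>

text \<open>Throughout, \<open>n = CARD('n)\<close>. Vectors of \<open>\<complex>\<^sup>n\<^sup>+\<^sup>1\<close> are indexed by \<open>'n option\<close>;
  the index \<open>None\<close> carries the negative sign of the Hermitian form.\<close>

definition herm :: "complex^('n::finite option) \<Rightarrow> complex^('n option) \<Rightarrow> complex" where
  "herm u v = (\<Sum>i\<in>UNIV. u $ Some i * cnj (v $ Some i)) - u $ None * cnj (v $ None)"

definition GL :: "(complex^'m::finite^'m) monoid" where
  "GL = \<lparr>carrier = {a. invertible a}, monoid.mult = (**), one = mat 1\<rparr>"

definition SU :: "(complex^('n::finite option)^('n option)) monoid" where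
  "SU = GL\<lparr>carrier := {a. (\<forall>u v. herm (a *v u) (a *v v) = herm u v) \<and> det a = 1}\<rparr>"

text \<open>Polynomials with rational coefficients in the matrix entries.\<close>

inductive_set rat_polys :: "(complex^'m::finite^'m \<Rightarrow> complex) set" where
  "(\<lambda>a. of_rat r) \<in> rat_polys"
| "(\<lambda>a. a $ i $ j) \<in> rat_polys"
| "p \<in> rat_polys \<Longrightarrow> q \<in> rat_polys \<Longrightarrow> (\<lambda>a. p a + q a) \<in> rat_polys"
| "p \<in> rat_polys \<Longrightarrow> q \<in> rat_polys \<Longrightarrow> (\<lambda>a. p a * q a) \<in> rat_polys"

text \<open>The complex points of an algebraic subgroup of \<open>GL\<close> defined over the rationals, its real
  points and its integral points.\<close>

definition alg_group_Q :: "(complex^'m::finite^'m) set \<Rightarrow> bool" where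
  "alg_group_Q G \<longleftrightarrow> subgroup G GL \<and>
     (\<exists>P\<subseteq>rat_polys. G = {a. invertible a \<and> (\<forall>p\<in>P. p a = 0)})"

definition real_points :: "(complex^'m::finite^'m) set \<Rightarrow> (complex^'m^'m) set" where
  "real_points G = {a\<in>G. \<forall>i j. a $ i $ j \<in> \<real>}"

definition int_points :: "(complex^'m::finite^'m) set \<Rightarrow> (complex^'m^'m) set" where
  "int_points G = {a\<in>G. \<forall>i j. a $ i $ j \<in> \<int> \<and> matrix_inv a $ i $ j \<in> \<int>}"

definition commensurable :: "('g, 'b) monoid_scheme \<Rightarrow> 'g set \<Rightarrow> 'g set \<Rightarrow> bool" where
  "commensurable G H K \<longleftrightarrow>
     finite ((\<lambda>a. a <#\<^bsub>G\<^esub> (H \<inter> K)) ` H) \<and> finite ((\<lambda>a. a <#\<^bsub>G\<^esub> (H \<inter> K)) ` K)"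

text \<open>\<open>\<Gamma>\<close> is arithmetic if it is commensurable with the image of the integral points of a
  rational algebraic group \<open>G\<close> under a continuous surjection from the real points of \<open>G\<close> onto
  \<open>SU(n,1)\<close> with compact kernel. The size of the matrices in \<open>G\<close> is a type parameter; as
  arithmeticity only occurs as a hypothesis, a theorem that is polymorphic in \<open>'m\<close> covers all
  sizes.\<close>

definition arithmetic_subgroup ::
    "'m::finite itself \<Rightarrow> (complex^('n::finite option)^('n option)) set \<Rightarrow> bool" where
  "arithmetic_subgroup _ \<Gamma> \<longleftrightarrow> subgroup \<Gamma> SU \<and>
     (\<exists>(G :: (complex^'m^'m) set) \<phi>.
        alg_group_Q G \<and>
        \<phi> \<in> hom (GL\<lparr>carrier := real_points G\<rparr>) SU \<and>
        \<phi> ` real_points G = carrier SU \<and>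
        continuous_on (real_points G) \<phi> \<and>
        compact {a\<in>real_points G. \<phi> a = mat 1} \<and>
        commensurable SU \<Gamma> (\<phi> ` int_points G))"

definition torsion_free :: "(complex^('n::finite option)^('n option)) set \<Rightarrow> bool" where
  "torsion_free \<Gamma> \<longleftrightarrow> (\<forall>a\<in>\<Gamma>. \<forall>m::nat. m > 0 \<longrightarrow> a [^]\<^bsub>SU\<^esub> m = \<one>\<^bsub>SU\<^esub> \<longrightarrow> a = \<one>\<^bsub>SU\<^esub>)"

definition unipotent :: "complex^'m::finite^'m \<Rightarrow> bool" where
  "unipotent a \<longleftrightarrow> (\<exists>m. (((**) (a - mat 1)) ^^ m) (mat 1) = 0)"

text \<open>The complex ball is \<open>ball 0 1\<close>, embedded in projective space by \<open>z \<mapsto> [z : 1]\<close>.\<close>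

definition ball_lift :: "complex^'n::finite \<Rightarrow> complex^('n option)" where
  "ball_lift z = (\<chi> j. case j of None \<Rightarrow> 1 | Some i \<Rightarrow> z $ i)"

definition act :: "complex^('n::finite option)^('n option) \<Rightarrow> complex^'n \<Rightarrow> complex^'n" where
  "act a z = (\<chi> i. (a *v ball_lift z) $ Some i / (a *v ball_lift z) $ None)"


section \<open>Complex manifolds\<close>

definition holo_on :: "(complex^'n::finite) set \<Rightarrow> (complex^'n \<Rightarrow> complex) \<Rightarrow> bool" where
  "holo_on S f \<longleftrightarrow> (\<forall>z\<in>S. \<exists>f'. (f has_derivative f') (at z) \<and> (\<forall>a v. f' (a *s v) = a * f' v))"

text \<open>A chart is a domain together with a coordinate map, whose values outside of the domain
  are irrelevant.\<close>

type_synonym ('x, 'n) chart = "'x set \<times> ('x \<Rightarrow> complex^'n)"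

abbreviation dom_of :: "('x, 'n::finite) chart \<Rightarrow> 'x set" where
  "dom_of c \<equiv> fst c"

abbreviation crd :: "('x, 'n::finite) chart \<Rightarrow> 'x \<Rightarrow> complex^'n" where
  "crd c \<equiv> snd c"

definition crd_inv :: "('x, 'n::finite) chart \<Rightarrow> complex^'n \<Rightarrow> 'x" where
  "crd_inv c = inv_into (dom_of c) (crd c)"

definition is_chart :: "('x::t2_space, 'n::finite) chart \<Rightarrow> bool" where
  "is_chart c \<longleftrightarrow> open (dom_of c) \<and> open (crd c ` dom_of c) \<and>
     homeomorphism (dom_of c) (crd c ` dom_of c) (crd c) (crd_inv c)"

definition transition :: "('x, 'n::finite) chart \<Rightarrow> ('x, 'n) chart \<Rightarrow> complex^'n \<Rightarrow> complex^'n" where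
  "transition c c' z = crd c' (crd_inv c z)"

definition holo_compatible :: "('x, 'n::finite) chart \<Rightarrow> ('x, 'n) chart \<Rightarrow> bool" where
  "holo_compatible c c' \<longleftrightarrow>
     (\<forall>i. holo_on (crd c ` (dom_of c \<inter> dom_of c')) (\<lambda>z. transition c c' z $ i)) \<and>
     (\<forall>i. holo_on (crd c' ` (dom_of c \<inter> dom_of c')) (\<lambda>z. transition c' c z $ i))"

definition complex_atlas :: "('x::t2_space, 'n::finite) chart set \<Rightarrow> bool" where
  "complex_atlas \<A> \<longleftrightarrow> (\<forall>c\<in>\<A>. is_chart c) \<and> (\<forall>c\<in>\<A>. \<forall>c'\<in>\<A>. holo_compatible c c') \<and>
     \<Union>(dom_of ` \<A>) = UNIV"

definition holo_charts :: "('x::t2_space, 'n::finite) chart set \<Rightarrow> ('x, 'n) chart set" where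
  "holo_charts \<A> = {c. is_chart c \<and> (\<forall>c'\<in>\<A>. holo_compatible c c')}"

text \<open>Local biholomorphisms from an open subset of \<open>\<complex>\<^sup>n\<close> to a complex manifold: the local
  inverses are holomorphic charts.\<close>

definition local_biholo ::
    "('x::t2_space, 'n::finite) chart set \<Rightarrow> (complex^'n) set \<Rightarrow> (complex^'n \<Rightarrow> 'x) \<Rightarrow> bool" where
  "local_biholo \<A> S f \<longleftrightarrow> (\<forall>z\<in>S. \<exists>V. open V \<and> z \<in> V \<and> V \<subseteq> S \<and> inj_on f V \<and>
     (f ` V, inv_into V f) \<in> holo_charts \<A>)"

text \<open>The "first" coordinate.\<close>

definition i\<^sub>1 :: "'n::finite" where
  "i\<^sub>1 = (SOME i. True)"

text \<open>Holomorphic charts in which \<open>D\<close> is the zero set of the first coordinate. (Charts disjoint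
  from \<open>D\<close> are adapted if their first coordinate has no zeros.)\<close>

definition log_charts ::
    "('x::t2_space, 'n::finite) chart set \<Rightarrow> 'x set \<Rightarrow> ('x, 'n) chart set" where
  "log_charts \<A> D = {c\<in>holo_charts \<A>. D \<inter> dom_of c = {x\<in>dom_of c. crd c x $ i\<^sub>1 = 0}}"


section \<open>Toroidal compactification of a ball quotient\<close>

text \<open>A point \<open>y\<close> of \<open>\<complex>\<^sup>n\<close> is viewed as a pair \<open>(z', w)\<close> with \<open>w = y $ i\<^sub>1\<close>. The Cayley transform
  maps the Siegel domain \<open>Im w > |z'|\<^sup>2\<close> onto the ball, and the point \<open>w = \<infinity>\<close> to the cusp with
  homogeneous coordinates \<open>axis (Some i\<^sub>1) 1 + axis None 1\<close>.\<close>

definition rest_sq :: "complex^'n::finite \<Rightarrow> real" where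
  "rest_sq y = (\<Sum>j\<in>UNIV - {i\<^sub>1}. (cmod (y $ j))\<^sup>2)"

definition cayley :: "complex^'n::finite \<Rightarrow> complex^'n" where
  "cayley y = (\<chi> j. if j = i\<^sub>1 then (y $ i\<^sub>1 - \<i>) / (y $ i\<^sub>1 + \<i>) else 2 * y $ j / (y $ i\<^sub>1 + \<i>))"

text \<open>The centre of the unipotent radical of the stabilizer of that cusp; \<open>cusp_translation s\<close>
  acts as \<open>(z', w) \<mapsto> (z', w + s)\<close>. Since \<open>SU(n,1)\<close> is transitive on cusps, an arbitrary
  cusp is given by an element \<open>g\<close> of \<open>SU(n,1)\<close>, moving the above one to it.\<close>

definition cusp_translation :: "real \<Rightarrow> complex^('n::finite option)^('n option)" where
  "cusp_translation s = matrix (\<lambda>u. \<chi> j.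
     if j = None \<or> j = Some i\<^sub>1
     then u $ j + of_real s * (u $ None - u $ Some i\<^sub>1) / (2 * \<i>) else u $ j)"

text \<open>The translations in the image of \<open>\<Gamma>\<close> in the automorphism group of the ball form the
  infinite cyclic group generated by \<open>\<tau>\<close>.\<close>

definition cusp_width ::
    "(complex^('n::finite option)^('n option)) set \<Rightarrow> complex^('n option)^('n option) \<Rightarrow> real \<Rightarrow> bool" where
  "cusp_width \<Gamma> g \<tau> \<longleftrightarrow> g \<in> carrier SU \<and> \<tau> > 0 \<and>
     {s. \<exists>\<gamma>\<in>\<Gamma>. \<forall>z\<in>ball 0 1. act \<gamma> z = act (g ** cusp_translation s ** matrix_inv g) z}
       = range (\<lambda>m::int. of_int m * \<tau>)"

text \<open>The quotient of the horoball \<open>Im w > |z'|\<^sup>2 + b\<close> by \<open>w \<mapsto> w + \<tau>\<close>, in the coordinates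
  \<open>(z', q)\<close> with \<open>q = exp (2 \<pi> i w / \<tau>)\<close>, and with the divisor \<open>q = 0\<close> added.\<close>

definition cusp_nbhd :: "real \<Rightarrow> real \<Rightarrow> (complex^'n::finite) set" where
  "cusp_nbhd \<tau> b = {y. cmod (y $ i\<^sub>1) < exp (- 2 * pi / \<tau> * (rest_sq y + b))}"

definition exp_coord :: "real \<Rightarrow> complex^'n::finite \<Rightarrow> complex^'n" where
  "exp_coord \<tau> y = (\<chi> j. if j = i\<^sub>1 then exp (2 * of_real pi * \<i> * y $ i\<^sub>1 / of_real \<tau>) else y $ j)"

definition toroidal_chart ::
    "('x::t2_space, 'n::finite) chart set \<Rightarrow> 'x set \<Rightarrow> (complex^'n \<Rightarrow> 'x) \<Rightarrow>
     complex^('n option)^('n option) \<Rightarrow> real \<Rightarrow> real \<Rightarrow> (complex^'n \<Rightarrow> 'x) \<Rightarrow> bool" where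
  "toroidal_chart \<A> D \<pi> g \<tau> b \<Phi> \<longleftrightarrow> b \<ge> 0 \<and> local_biholo \<A> (cusp_nbhd \<tau> b) \<Phi> \<and>
     (\<forall>y. Im (y $ i\<^sub>1) > rest_sq y + b \<longrightarrow> \<Phi> (exp_coord \<tau> y) = \<pi> (act g (cayley y))) \<and>
     (\<forall>y\<in>cusp_nbhd \<tau> b. y $ i\<^sub>1 = 0 \<longrightarrow> \<Phi> y \<in> D)"

text \<open>Lattices \<open>\<Lambda>\<close> in \<open>\<complex>\<^sup>n\<^sup>-\<^sup>1 = {y. y $ i\<^sub>1 = 0}\<close> whose quotient torus is an abelian variety, i.e.
  that admit a Riemann form (a positive definite Hermitian form with imaginary part integral on
  \<open>\<Lambda>\<close>).\<close>

definition abelian_lattice :: "(complex^'n::finite) set \<Rightarrow> bool" where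
  "abelian_lattice \<Lambda> \<longleftrightarrow>
     0 \<in> \<Lambda> \<and> (\<forall>l\<in>\<Lambda>. \<forall>l'\<in>\<Lambda>. l - l' \<in> \<Lambda>) \<and>
     (\<exists>e>0. \<forall>l\<in>\<Lambda>. l \<noteq> 0 \<longrightarrow> norm l \<ge> e) \<and>
     span \<Lambda> = {y. y $ i\<^sub>1 = 0} \<and>
     (\<exists>H :: complex^'n \<Rightarrow> complex^'n \<Rightarrow> complex.
        (\<forall>a v b w u. H (a *s v + b *s w) u = a * H v u + b * H w u) \<and>
        (\<forall>v u. H u v = cnj (H v u)) \<and>
        (\<forall>v. v $ i\<^sub>1 = 0 \<longrightarrow> v \<noteq> 0 \<longrightarrow> Re (H v v) > 0) \<and>
        (\<forall>l\<in>\<Lambda>. \<forall>l'\<in>\<Lambda>. Im (H l l') \<in> \<int>))"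

text \<open>The type \<open>'x\<close> with the atlas \<open>\<A>\<close> is the toroidal compactification of the quotient \<open>X\<close> of
  the ball by \<open>\<Gamma>\<close>, with boundary \<open>D\<close>: the map \<open>\<pi>\<close> identifies \<open>X\<close> with the complement of \<open>D\<close>, and
  \<open>D\<close> is obtained by adding the divisor \<open>q = 0\<close> at each cusp. It is compact, so all ends of \<open>X\<close> are
  covered. The condition on \<open>\<Lambda>\<close> says that the components of \<open>D\<close> are abelian varieties.\<close>

definition toroidal_compactification ::
    "(complex^('n::finite option)^('n option)) set \<Rightarrow> ('x::t2_space, 'n) chart set \<Rightarrow>
     (complex^'n \<Rightarrow> 'x) \<Rightarrow> 'x set \<Rightarrow> bool" where
  "toroidal_compactification \<Gamma> \<A> \<pi> D \<longleftrightarrow>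
     complex_atlas \<A> \<and> compact (UNIV :: 'x set) \<and>
     local_biholo \<A> (ball 0 1) \<pi> \<and>
     (\<forall>z\<in>ball 0 1. \<forall>z'\<in>ball 0 1. \<pi> z = \<pi> z' \<longleftrightarrow> (\<exists>\<gamma>\<in>\<Gamma>. z' = act \<gamma> z)) \<and>
     D = - \<pi> ` ball 0 1 \<and>
     (\<forall>g \<tau>. cusp_width \<Gamma> g \<tau> \<longrightarrow>
        (\<exists>b \<Phi>. toroidal_chart \<A> D \<pi> g \<tau> b \<Phi> \<and>
           (\<exists>\<Lambda>. abelian_lattice \<Lambda> \<and>
              (\<forall>y y'. y $ i\<^sub>1 = 0 \<longrightarrow> y' $ i\<^sub>1 = 0 \<longrightarrow> \<Phi> y = \<Phi> y' \<longleftrightarrow> y - y' \<in> \<Lambda>)))) \<and>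
     (\<forall>p\<in>D. \<exists>g \<tau> b \<Phi>. cusp_width \<Gamma> g \<tau> \<and> toroidal_chart \<A> D \<pi> g \<tau> b \<Phi> \<and>
        (\<exists>y. y $ i\<^sub>1 = 0 \<and> p = \<Phi> y))"

text \<open>A loop \<open>q \<mapsto> exp (2 \<pi> i t) q\<close> around the boundary component at the cusp \<open>g\<close> lifts to a path in
  the ball whose endpoints differ by the translation by the width \<open>\<tau>\<close>; the monodromy of the local
  system of the standard representation is the element of \<open>\<Gamma>\<close> inducing this translation.\<close>

definition unipotent_monodromy :: "(complex^('n::finite option)^('n option)) set \<Rightarrow> bool" where
  "unipotent_monodromy \<Gamma> \<longleftrightarrow> (\<forall>g \<tau>. \<forall>\<gamma>\<in>\<Gamma>. cusp_width \<Gamma> g \<tau> \<longrightarrow>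
     (\<forall>z\<in>ball 0 1. act \<gamma> z = act (g ** cusp_translation \<tau> ** matrix_inv g) z) \<longrightarrow> unipotent \<gamma>)"


section \<open>Line bundles and logarithmic frames\<close>

text \<open>A holomorphic line bundle, trivialized over each chart of a covering \<open>\<C>\<close> by charts: the
  element with fibre coordinate \<open>t\<close> over \<open>c\<close> has fibre coordinate \<open>g c c' x * t\<close> over \<open>c'\<close>.\<close>

definition holo_at_chart ::
    "('x, 'n::finite) chart \<Rightarrow> 'x set \<Rightarrow> ('x \<Rightarrow> complex) \<Rightarrow> bool" where
  "holo_at_chart c S f \<longleftrightarrow> holo_on (crd c ` S) (\<lambda>z. f (crd_inv c z))"

definition line_bundle ::
    "('x::t2_space, 'n::finite) chart set \<Rightarrow> (('x, 'n) chart \<Rightarrow> ('x, 'n) chart \<Rightarrow> 'x \<Rightarrow> complex) \<Rightarrow> bool" where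
  "line_bundle \<C> g \<longleftrightarrow> \<Union>(dom_of ` \<C>) = UNIV \<and>
     (\<forall>c\<in>\<C>. \<forall>c'\<in>\<C>. holo_at_chart c (dom_of c \<inter> dom_of c') (g c c') \<and>
        (\<forall>x\<in>dom_of c \<inter> dom_of c'. g c c' x \<noteq> 0)) \<and>
     (\<forall>c\<in>\<C>. \<forall>x\<in>dom_of c. g c c x = 1) \<and>
     (\<forall>c\<in>\<C>. \<forall>c'\<in>\<C>. \<forall>c''\<in>\<C>. \<forall>x\<in>dom_of c \<inter> dom_of c' \<inter> dom_of c''.
        g c c'' x = g c' c'' x * g c c' x)"

text \<open>For a chart adapted to \<open>D\<close>, the logarithmic tangent bundle \<open>T(-log D)\<close> has the frame
  \<open>z\<^sub>1 \<partial>/\<partial>z\<^sub>1, \<partial>/\<partial>z\<^sub>2, \<dots>, \<partial>/\<partial>z\<^sub>n\<close>, dual to the frame \<open>dz\<^sub>1/z\<^sub>1, dz\<^sub>2, \<dots>, dz\<^sub>n\<close> of \<open>\<Omega>\<^sup>1(log D)\<close>.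
  At a point outside of \<open>D\<close>, \<open>log_transition c c' x\<close> turns the coordinates of a vector in the frame
  of \<open>c\<close> into those in the frame of \<open>c'\<close>.\<close>

definition log_scale :: "complex \<Rightarrow> complex^'n::finite \<Rightarrow> complex^'n" where
  "log_scale a v = (\<chi> j. if j = i\<^sub>1 then a * v $ j else v $ j)"

definition log_transition ::
    "('x, 'n::finite) chart \<Rightarrow> ('x, 'n) chart \<Rightarrow> 'x \<Rightarrow> complex^'n \<Rightarrow> complex^'n" where
  "log_transition c c' x v = log_scale (1 / crd c' x $ i\<^sub>1)
     (frechet_derivative (transition c c') (at (crd c x)) (log_scale (crd c x $ i\<^sub>1) v))"

text \<open>\<open>O(K + D) = \<Omega>\<^sup>n(log D)\<close> is trivialized by \<open>dz\<^sub>1/z\<^sub>1 \<and> dz\<^sub>2 \<and> \<dots> \<and> dz\<^sub>n\<close>, so its fibre coordinates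
  transform by the inverse of \<open>det (matrix (log_transition c c' x))\<close>. The functions \<open>h\<close> define the
  isomorphism \<open>t\<^sup>n\<^sup>+\<^sup>1 \<mapsto> h c * t\<^sup>n\<^sup>+\<^sup>1\<close> of the \<open>(n+1)\<close>-st power with \<open>O(K + D)\<close>. It is enough
  to compare outside of the nowhere dense set \<open>D\<close>.\<close>

definition root_of_log_canonical ::
    "'x::t2_space set \<Rightarrow> ('x, 'n::finite) chart set \<Rightarrow>
     (('x, 'n) chart \<Rightarrow> ('x, 'n) chart \<Rightarrow> 'x \<Rightarrow> complex) \<Rightarrow> bool" where
  "root_of_log_canonical D \<C> g \<longleftrightarrow> (\<exists>h :: ('x, 'n) chart \<Rightarrow> 'x \<Rightarrow> complex.
     (\<forall>c\<in>\<C>. holo_at_chart c (dom_of c) (h c) \<and> (\<forall>x\<in>dom_of c. h c x \<noteq> 0)) \<and>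
     (\<forall>c\<in>\<C>. \<forall>c'\<in>\<C>. \<forall>x\<in>dom_of c \<inter> dom_of c' - D.
        h c' x * g c c' x ^ (CARD('n) + 1) = h c x / det (matrix (log_transition c c' x))))"


section \<open>Complexes of sheaves of modules\<close>

record ('x, 's) omodule =
  Sec :: "'x set \<Rightarrow> ('x \<Rightarrow> complex, 's) module"
  Res :: "'x set \<Rightarrow> 'x set \<Rightarrow> 's \<Rightarrow> 's"

definition cut :: "'x set \<Rightarrow> ('x \<Rightarrow> 'a::zero) \<Rightarrow> 'x \<Rightarrow> 'a" where
  "cut U f = (\<lambda>x. if x \<in> U then f x else 0)"

text \<open>The structure sheaf; functions on \<open>U\<close> are extended by zero.\<close>

definition holo_ring :: "('x::t2_space, 'n::finite) chart set \<Rightarrow> 'x set \<Rightarrow> ('x \<Rightarrow> complex) ring" where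
  "holo_ring \<A> U =
     \<lparr>carrier = {f. cut U f = f \<and> (\<forall>c\<in>\<A>. holo_at_chart c (U \<inter> dom_of c) f)},
      monoid.mult = (\<lambda>f g x. f x * g x), one = cut U (\<lambda>_. 1),
      zero = (\<lambda>_. 0), add = (\<lambda>f g x. f x + g x)\<rparr>"

definition is_omodule :: "('x::t2_space, 'n::finite) chart set \<Rightarrow> ('x, 's) omodule \<Rightarrow> bool" where
  "is_omodule \<A> F \<longleftrightarrow>
     (\<forall>U. open U \<longrightarrow> Module.module (holo_ring \<A> U) (Sec F U)) \<and>
     (\<forall>U V. open U \<longrightarrow> open V \<longrightarrow> V \<subseteq> U \<longrightarrow>
        Res F U V \<in> carrier (Sec F U) \<rightarrow> carrier (Sec F V) \<and>
        (\<forall>s\<in>carrier (Sec F U). \<forall>t\<in>carrier (Sec F U).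
           Res F U V (s \<oplus>\<^bsub>Sec F U\<^esub> t) = Res F U V s \<oplus>\<^bsub>Sec F V\<^esub> Res F U V t) \<and>
        (\<forall>f\<in>carrier (holo_ring \<A> U). \<forall>s\<in>carrier (Sec F U).
           Res F U V (f \<odot>\<^bsub>Sec F U\<^esub> s) = cut V f \<odot>\<^bsub>Sec F V\<^esub> Res F U V s)) \<and>
     (\<forall>U. open U \<longrightarrow> (\<forall>s\<in>carrier (Sec F U). Res F U U s = s)) \<and>
     (\<forall>U V W. open U \<longrightarrow> open V \<longrightarrow> open W \<longrightarrow> W \<subseteq> V \<longrightarrow> V \<subseteq> U \<longrightarrow>
        (\<forall>s\<in>carrier (Sec F U). Res F V W (Res F U V s) = Res F U W s)) \<and>
     (\<forall>\<U> s. (\<forall>U\<in>\<U>. open U \<and> s U \<in> carrier (Sec F U)) \<longrightarrow>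
        (\<forall>U\<in>\<U>. \<forall>V\<in>\<U>. Res F U (U \<inter> V) (s U) = Res F V (U \<inter> V) (s V)) \<longrightarrow>
        (\<exists>!t. t \<in> carrier (Sec F (\<Union>\<U>)) \<and> (\<forall>U\<in>\<U>. Res F (\<Union>\<U>) U t = s U)))"

definition omodule_hom ::
    "('x::t2_space, 'n::finite) chart set \<Rightarrow> ('x, 's) omodule \<Rightarrow> ('x, 's) omodule \<Rightarrow>
     ('x set \<Rightarrow> 's \<Rightarrow> 's) \<Rightarrow> bool" where
  "omodule_hom \<A> F G \<phi> \<longleftrightarrow>
     (\<forall>U. open U \<longrightarrow> \<phi> U \<in> carrier (Sec F U) \<rightarrow> carrier (Sec G U) \<and>
        (\<forall>s\<in>carrier (Sec F U). \<forall>t\<in>carrier (Sec F U).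
           \<phi> U (s \<oplus>\<^bsub>Sec F U\<^esub> t) = \<phi> U s \<oplus>\<^bsub>Sec G U\<^esub> \<phi> U t) \<and>
        (\<forall>f\<in>carrier (holo_ring \<A> U). \<forall>s\<in>carrier (Sec F U).
           \<phi> U (f \<odot>\<^bsub>Sec F U\<^esub> s) = f \<odot>\<^bsub>Sec G U\<^esub> \<phi> U s)) \<and>
     (\<forall>U V. open U \<longrightarrow> open V \<longrightarrow> V \<subseteq> U \<longrightarrow>
        (\<forall>s\<in>carrier (Sec F U). \<phi> V (Res F U V s) = Res G U V (\<phi> U s)))"

text \<open>Complexes in degrees \<open>0, 1, 2, \<dots>\<close>; \<open>Diff A i\<close> maps degree \<open>i\<close> to degree \<open>i + 1\<close>.\<close>

record ('x, 's) ocomplex =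
  Obj :: "nat \<Rightarrow> ('x, 's) omodule"
  Diff :: "nat \<Rightarrow> 'x set \<Rightarrow> 's \<Rightarrow> 's"

definition is_ocomplex :: "('x::t2_space, 'n::finite) chart set \<Rightarrow> ('x, 's) ocomplex \<Rightarrow> bool" where
  "is_ocomplex \<A> A \<longleftrightarrow>
     (\<forall>i. is_omodule \<A> (Obj A i) \<and> omodule_hom \<A> (Obj A i) (Obj A (Suc i)) (Diff A i) \<and>
        (\<forall>U. open U \<longrightarrow> (\<forall>s\<in>carrier (Sec (Obj A i) U).
           Diff A (Suc i) U (Diff A i U s) = \<zero>\<^bsub>Sec (Obj A (Suc (Suc i))) U\<^esub>)))"

definition cocycles :: "('x, 's) ocomplex \<Rightarrow> nat \<Rightarrow> 'x set \<Rightarrow> 's set" where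
  "cocycles A i U =
     {s\<in>carrier (Sec (Obj A i) U). Diff A i U s = \<zero>\<^bsub>Sec (Obj A (Suc i)) U\<^esub>}"

fun coboundaries :: "('x, 's) ocomplex \<Rightarrow> nat \<Rightarrow> 'x set \<Rightarrow> 's set" where
  "coboundaries A 0 U = {\<zero>\<^bsub>Sec (Obj A 0) U\<^esub>}"
| "coboundaries A (Suc i) U = Diff A i U ` carrier (Sec (Obj A i) U)"

text \<open>A morphism of complexes inducing an isomorphism of cohomology sheaves. The two conditions
  express that the map on the stalk at \<open>x\<close> of the \<open>i\<close>-th cohomology sheaf is injective and
  surjective.\<close>

definition quasi_isomorphism ::
    "('x::t2_space, 'n::finite) chart set \<Rightarrow> ('x, 's) ocomplex \<Rightarrow> ('x, 's) ocomplex \<Rightarrow>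
     (nat \<Rightarrow> 'x set \<Rightarrow> 's \<Rightarrow> 's) \<Rightarrow> bool" where
  "quasi_isomorphism \<A> A B \<phi> \<longleftrightarrow>
     (\<forall>i. omodule_hom \<A> (Obj A i) (Obj B i) (\<phi> i)) \<and>
     (\<forall>i U. open U \<longrightarrow> (\<forall>s\<in>carrier (Sec (Obj A i) U).
        \<phi> (Suc i) U (Diff A i U s) = Diff B i U (\<phi> i U s))) \<and>
     (\<forall>i U x. open U \<longrightarrow> x \<in> U \<longrightarrow>
        (\<forall>s\<in>cocycles A i U.
           (\<exists>V. open V \<and> x \<in> V \<and> V \<subseteq> U \<and> Res (Obj B i) U V (\<phi> i U s) \<in> coboundaries B i V) \<longrightarrow>
           (\<exists>V. open V \<and> x \<in> V \<and> V \<subseteq> U \<and> Res (Obj A i) U V s \<in> coboundaries A i V)) \<and>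
        (\<forall>t\<in>cocycles B i U.
           \<exists>V. open V \<and> x \<in> V \<and> V \<subseteq> U \<and>
             (\<exists>s\<in>cocycles A i V. \<exists>b\<in>coboundaries B i V.
                Res (Obj B i) U V t = \<phi> i V s \<oplus>\<^bsub>Sec (Obj B i) V\<^esub> b)))"

text \<open>Isomorphic in the derived category: connected by a zigzag of quasi-isomorphisms.\<close>

definition quasi_isomorphic ::
    "('x::t2_space, 'n::finite) chart set \<Rightarrow> ('x, 's) ocomplex \<Rightarrow> ('x, 's) ocomplex \<Rightarrow> bool" where
  "quasi_isomorphic \<A> A B \<longleftrightarrow> is_ocomplex \<A> A \<and> is_ocomplex \<A> B \<and>
     equivclp (\<lambda>K K'. is_ocomplex \<A> K \<and> is_ocomplex \<A> K' \<and> (\<exists>\<phi>. quasi_isomorphism \<A> K K' \<phi>)) A B"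


section \<open>The uniformizing Higgs bundle and its symmetric powers, fibrewise\<close>

text \<open>In the frames above, a fibre of \<open>E\<^sub>1 = \<Omega>\<^sup>1(log D) \<otimes> L\<^sup>-\<^sup>1 \<oplus> L\<^sup>-\<^sup>1\<close> has the dual
  \<open>T(-log D) \<otimes> L \<oplus> L = \<complex>\<^sup>n \<oplus> \<complex>\<close>, whose elements \<open>u\<close> have the \<open>T(-log D) \<otimes> L\<close>-coordinates \<open>u $ Some j\<close>
  and the \<open>L\<close>-coordinate \<open>u $ None\<close>. The \<open>k\<close>-th symmetric power of \<open>E\<^sub>1\<close> is the space of homogeneous
  polynomials of degree \<open>k\<close> on this dual.\<close>

definition sym_power :: "nat \<Rightarrow> (complex^'m::finite \<Rightarrow> complex) set" where
  "sym_power k = {p. \<exists>a. p = (\<lambda>u. \<Sum>\<alpha>\<in>{\<alpha>. sum \<alpha> UNIV = k}. a \<alpha> * (\<Prod>j\<in>UNIV. u $ j ^ \<alpha> j))}"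

definition bi_scale :: "complex \<Rightarrow> complex \<Rightarrow> complex^('n::finite option) \<Rightarrow> complex^('n option)" where
  "bi_scale a b u = (\<chi> j. case j of None \<Rightarrow> b * u $ None | Some i \<Rightarrow> a * u $ Some i)"

text \<open>The summand \<open>S\<^sup>j \<Omega>\<^sup>1(log D) \<otimes> L\<^sup>-\<^sup>k\<close> of \<open>S\<^sup>k E\<^sub>1\<close>.\<close>

definition sym_summand :: "nat \<Rightarrow> nat \<Rightarrow> (complex^('n::finite option) \<Rightarrow> complex) set" where
  "sym_summand k j = (if j \<le> k
     then {p\<in>sym_power k. \<forall>a b u. p (bi_scale a b u) = a ^ j * b ^ (k - j) * p u} else {\<lambda>_. 0})"

text \<open>Contracted with \<open>w \<in> T(-log D)\<close>, the Higgs field of \<open>E\<^sub>1\<close> maps \<open>\<omega> \<otimes> l\<^sup>-\<^sup>1\<close> to \<open>\<omega>(w) l\<^sup>-\<^sup>1\<close> and \<open>l\<^sup>-\<^sup>1\<close>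
  to \<open>0\<close>. This is its transpose on the dual of \<open>E\<^sub>1\<close>, mapping \<open>l\<close> to \<open>w \<otimes> l\<close>.\<close>

definition higgs1_dual :: "complex^'n::finite \<Rightarrow> complex^('n option) \<Rightarrow> complex^('n option)" where
  "higgs1_dual w u = (\<chi> j. case j of None \<Rightarrow> 0 | Some i \<Rightarrow> u $ None * w $ i)"

text \<open>The unique derivation of the algebra of polynomials that maps a linear form \<open>e\<close> to \<open>e \<circ> T\<close>.\<close>

definition derivation_ext ::
    "(complex^'m::finite \<Rightarrow> complex^'m) \<Rightarrow> (complex^'m \<Rightarrow> complex) \<Rightarrow> complex^'m \<Rightarrow> complex" where
  "derivation_ext T p u = deriv (\<lambda>s. p (u + s *s T u)) 0"

definition higgs ::
    "complex^'n::finite \<Rightarrow> (complex^('n option) \<Rightarrow> complex) \<Rightarrow> complex^('n option) \<Rightarrow> complex" where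
  "higgs w = derivation_ext (higgs1_dual w)"

text \<open>Elements of \<open>E \<otimes> \<Omega>\<^sup>i(log D)\<close> are alternating \<open>i\<close>-linear forms on \<open>T(-log D)\<close> with values in
  \<open>E\<close>, here given as functions on lists that vanish on lists of length different from \<open>i\<close>.\<close>

type_synonym 'n form = "(complex^'n) list \<Rightarrow> complex^('n option) \<Rightarrow> complex"

definition alt_forms ::
    "nat \<Rightarrow> (complex^('n::finite option) \<Rightarrow> complex) set \<Rightarrow> 'n form set" where
  "alt_forms i V = {f.
     (\<forall>ws. length ws \<noteq> i \<longrightarrow> f ws = (\<lambda>_. 0)) \<and>
     (\<forall>ws. length ws = i \<longrightarrow> f ws \<in> V) \<and>
     (\<forall>ws l a v b w u. length ws = i \<longrightarrow> l < i \<longrightarrow>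
        f (ws[l := a *s v + b *s w]) u = a * f (ws[l := v]) u + b * f (ws[l := w]) u) \<and>
     (\<forall>ws. \<not> distinct ws \<longrightarrow> f ws = (\<lambda>_. 0))}"

definition drop_nth :: "nat \<Rightarrow> 'a list \<Rightarrow> 'a list" where
  "drop_nth l ws = take l ws @ drop (Suc l) ws"

text \<open>The map \<open>\<and>\<theta>\<close>, sending \<open>e \<otimes> \<omega>\<close> to \<open>\<theta>(e) \<and> \<omega>\<close>.\<close>

definition wedge_higgs :: "'n::finite form \<Rightarrow> 'n form" where
  "wedge_higgs f ws u = (\<Sum>l<length ws. (-1) ^ l * higgs (ws ! l) (f (drop_nth l ws)) u)"


section \<open>The square-integrability condition\<close>

definition csubspace :: "('a \<Rightarrow> complex) set \<Rightarrow> bool" where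
  "csubspace V \<longleftrightarrow> (\<lambda>_. 0) \<in> V \<and> (\<forall>p\<in>V. \<forall>q\<in>V. \<forall>a b. (\<lambda>x. a * p x + b * q x) \<in> V)"

text \<open>The monodromy weight filtration of the nilpotent endomorphism \<open>N\<close> of \<open>V\<close>, centred at \<open>0\<close>. The
  last two conditions say that \<open>N ^^ m\<close> induces an isomorphism of the graded pieces of weight \<open>m\<close>
  and \<open>-m\<close>. These conditions determine the filtration.\<close>

definition is_weight_filtration ::
    "('a \<Rightarrow> complex) set \<Rightarrow> (('a \<Rightarrow> complex) \<Rightarrow> 'a \<Rightarrow> complex) \<Rightarrow> (int \<Rightarrow> ('a \<Rightarrow> complex) set) \<Rightarrow> bool" where
  "is_weight_filtration V N W \<longleftrightarrow>
     (\<forall>m. csubspace (W m) \<and> W m \<subseteq> V) \<and> mono W \<and>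
     (\<exists>m. W m = {\<lambda>_. 0}) \<and> (\<exists>m. W m = V) \<and>
     (\<forall>m. N ` W m \<subseteq> W (m - 2)) \<and>
     (\<forall>m. \<forall>p\<in>W (int m). (N ^^ m) p \<in> W (- int m - 1) \<longrightarrow> p \<in> W (int m - 1)) \<and>
     (\<forall>m. \<forall>q\<in>W (- int m). \<exists>p\<in>W (int m). (\<lambda>x. q x - (N ^^ m) p x) \<in> W (- int m - 1))"

text \<open>The residue of \<open>\<theta>\<close> along \<open>D\<close> is the coefficient of \<open>dz\<^sub>1/z\<^sub>1\<close>, i.e. the contraction with the
  first vector of the frame. In the frames used here it is constant along \<open>D\<close>.\<close>

definition res_higgs ::
    "(complex^('n::finite option) \<Rightarrow> complex) \<Rightarrow> complex^('n option) \<Rightarrow> complex" where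
  "res_higgs = higgs (axis i\<^sub>1 1)"

definition weight_filtration :: "nat \<Rightarrow> int \<Rightarrow> (complex^('n::finite option) \<Rightarrow> complex) set" where
  "weight_filtration k = (THE W. is_weight_filtration (sym_power k) res_higgs W)"

text \<open>Forms in \<open>\<Lambda>\<^sup>i\<langle>dz\<^sub>2, \<dots>, dz\<^sub>n\<rangle> \<otimes> V\<close>.\<close>

definition tangential_forms ::
    "nat \<Rightarrow> (complex^('n::finite option) \<Rightarrow> complex) set \<Rightarrow> 'n form set" where
  "tangential_forms i V = {f\<in>alt_forms i V. \<forall>ws. axis i\<^sub>1 1 \<in> set ws \<longrightarrow> f ws = (\<lambda>_. 0)}"

definition wedge_dlog :: "'n::finite form \<Rightarrow> 'n form" where
  "wedge_dlog f ws u = (\<Sum>l<length ws. (-1) ^ l * (ws ! l $ i\<^sub>1) * f (drop_nth l ws) u)"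

text \<open>The condition on the value at a point of \<open>D\<close> of a section of \<open>S\<^sup>k E\<^sub>1 \<otimes> \<Omega>\<^sup>i(log D)\<close>, in an adapted
  chart, to lie in \<open>\<Omega>\<^sup>i\<^sub>(\<^sub>2\<^sub>)\<close>: a section of \<open>S\<^sup>k E\<^sub>1\<close> lies in the preimage of \<open>W\<^sub>m\<close> iff its values at the
  points of \<open>D\<close> lie in \<open>W\<^sub>m\<close>.\<close>

fun l2_forms :: "nat \<Rightarrow> nat \<Rightarrow> 'n::finite form set" where
  "l2_forms k 0 = tangential_forms 0 (weight_filtration k 0)"
| "l2_forms k (Suc p) =
     {\<lambda>ws u. wedge_dlog \<beta> ws u + \<gamma> ws u | \<beta> \<gamma>.
        \<beta> \<in> tangential_forms p (weight_filtration k (-2)) \<and>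
        \<gamma> \<in> tangential_forms (Suc p) (weight_filtration k 0)}"


section \<open>The sheaves and complexes\<close>

text \<open>A section of \<open>S\<^sup>k E\<^sub>1 \<otimes> \<Omega>\<^sup>i(log D)\<close> over \<open>U\<close> is a family \<open>s\<close>, where \<open>s c x\<close> is the value at \<open>x\<close> in the
  frames over the chart \<open>c \<in> \<C>\<close>; it is holomorphic across \<open>D\<close> in these frames, and transforms
  correctly (outside of the nowhere dense set \<open>D\<close>, hence everywhere).\<close>

type_synonym ('x, 'n) form_field = "('x, 'n) chart \<Rightarrow> 'x \<Rightarrow> 'n form"

definition dual_transition ::
    "(('x, 'n::finite) chart \<Rightarrow> ('x, 'n) chart \<Rightarrow> 'x \<Rightarrow> complex) \<Rightarrow>
     ('x, 'n) chart \<Rightarrow> ('x, 'n) chart \<Rightarrow> 'x \<Rightarrow> complex^('n option) \<Rightarrow> complex^('n option)" where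
  "dual_transition g c c' x u = (\<chi> j. case j of None \<Rightarrow> g c c' x * u $ None
     | Some i \<Rightarrow> g c c' x * log_transition c c' x (\<chi> l. u $ Some l) $ i)"

definition higgs_sections ::
    "'x::t2_space set \<Rightarrow> ('x, 'n::finite) chart set \<Rightarrow>
     (('x, 'n) chart \<Rightarrow> ('x, 'n) chart \<Rightarrow> 'x \<Rightarrow> complex) \<Rightarrow> nat \<Rightarrow> nat \<Rightarrow> 'x set \<Rightarrow> ('x, 'n) form_field set" where
  "higgs_sections D \<C> g k i U = {s.
     (\<forall>c x. c \<notin> \<C> \<or> x \<notin> U \<inter> dom_of c \<longrightarrow> s c x = (\<lambda>_ _. 0)) \<and>
     (\<forall>c\<in>\<C>. \<forall>x\<in>U \<inter> dom_of c. s c x \<in> alt_forms i (sym_power k)) \<and>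
     (\<forall>c\<in>\<C>. \<forall>ws u. holo_at_chart c (U \<inter> dom_of c) (\<lambda>x. s c x ws u)) \<and>
     (\<forall>c\<in>\<C>. \<forall>c'\<in>\<C>. \<forall>x\<in>U \<inter> dom_of c \<inter> dom_of c' - D. \<forall>ws u.
        s c x ws u = s c' x (map (log_transition c c' x) ws) (dual_transition g c c' x u))}"

text \<open>The sheaf of those sections of \<open>S\<^sup>k E\<^sub>1 \<otimes> \<Omega>\<^sup>i(log D)\<close> whose values at each point \<open>x\<close> lie in \<open>Q x\<close>.\<close>

definition section_sheaf ::
    "'x::t2_space set \<Rightarrow> ('x, 'n::finite) chart set \<Rightarrow>
     (('x, 'n) chart \<Rightarrow> ('x, 'n) chart \<Rightarrow> 'x \<Rightarrow> complex) \<Rightarrow> nat \<Rightarrow> nat \<Rightarrow> ('x \<Rightarrow> 'n form set) \<Rightarrow>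
     ('x, ('x, 'n) form_field) omodule" where
  "section_sheaf D \<C> g k i Q =
     \<lparr>Sec = (\<lambda>U. \<lparr>carrier =
            {s\<in>higgs_sections D \<C> g k i U. \<forall>c\<in>\<C>. \<forall>x\<in>U \<inter> dom_of c. s c x \<in> Q x},
          monoid.mult = undefined, one = undefined,
          zero = (\<lambda>c x ws u. 0), add = (\<lambda>s t c x ws u. s c x ws u + t c x ws u),
          smult = (\<lambda>f s c x ws u. f x * s c x ws u)\<rparr>),
      Res = (\<lambda>U V s c x ws u. if x \<in> V then s c x ws u else 0)\<rparr>"

definition l2_condition :: "'x set \<Rightarrow> nat \<Rightarrow> nat \<Rightarrow> 'x \<Rightarrow> 'n::finite form set" where
  "l2_condition D k i x = (if x \<in> D then l2_forms k i else UNIV)"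

text \<open>The complex \<open>(\<Omega>\<^sup>\<bullet>\<^sub>(\<^sub>2\<^sub>)(S\<^sup>k E\<^sub>1), \<and>\<theta>)\<close>.\<close>

definition l2_higgs_complex ::
    "'x::t2_space set \<Rightarrow> ('x, 'n::finite) chart set \<Rightarrow>
     (('x, 'n) chart \<Rightarrow> ('x, 'n) chart \<Rightarrow> 'x \<Rightarrow> complex) \<Rightarrow> nat \<Rightarrow> ('x, ('x, 'n) form_field) ocomplex" where
  "l2_higgs_complex D \<C> g k =
     \<lparr>Obj = (\<lambda>i. section_sheaf D \<C> g k i (l2_condition D k i)),
      Diff = (\<lambda>i U s c x. wedge_higgs (s c x))\<rparr>"

text \<open>\<open>T\<^sup>0(k) = L\<^sup>-\<^sup>k\<close> is the summand \<open>S\<^sup>0 \<Omega>\<^sup>1(log D) \<otimes> L\<^sup>-\<^sup>k\<close> of \<open>S\<^sup>k E\<^sub>1\<close>. For \<open>i > n\<close> the sheaves vanish, as there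
  are no alternating forms.\<close>

definition T_sheaf ::
    "'x::t2_space set \<Rightarrow> ('x, 'n::finite) chart set \<Rightarrow>
     (('x, 'n) chart \<Rightarrow> ('x, 'n) chart \<Rightarrow> 'x \<Rightarrow> complex) \<Rightarrow> nat \<Rightarrow> nat \<Rightarrow> ('x, ('x, 'n) form_field) omodule" where
  "T_sheaf D \<C> g k i =
     (if i = 0 then section_sheaf D \<C> g k 0 (\<lambda>x. alt_forms 0 (sym_summand k 0))
      else section_sheaf D \<C> g k i (\<lambda>x. {f\<in>alt_forms i (sym_summand k k).
             wedge_higgs f = (\<lambda>_ _. 0)} \<inter> l2_condition D k i x))"

definition T_complex ::
    "'x::t2_space set \<Rightarrow> ('x, 'n::finite) chart set \<Rightarrow>
     (('x, 'n) chart \<Rightarrow> ('x, 'n) chart \<Rightarrow> 'x \<Rightarrow> complex) \<Rightarrow> nat \<Rightarrow> ('x, ('x, 'n) form_field) ocomplex" where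
  "T_complex D \<C> g k =
     \<lparr>Obj = T_sheaf D \<C> g k, Diff = (\<lambda>i U s c x ws u. 0)\<rparr>"

end

theory Submission
  imports Defs "HOL-Complex_Analysis.Cauchy_Integral_Formula"
begin

text \<open>
  In the frames over an adapted chart, put \<open>x\<^sub>j = u $ Some j\<close> and \<open>t = u $ None\<close>, and let \<open>e\<^sub>1\<close> be
  the first vector \<open>axis i\<^sub>1 1\<close> of the frame of \<open>T(-log D)\<close>. An element of \<open>S\<^sup>k E\<^sub>1\<close> is a homogeneous
  polynomial of degree \<open>k\<close> in \<open>(x, t)\<close>, and \<open>\<and>\<theta>\<close> is \<open>t d\<close>, where \<open>d\<close> is the exterior derivative in \<open>x\<close>
  of polynomial differential forms. Without the square-integrability condition, the theorem is
  the Poincare lemma: a closed form of positive degree is \<open>f = f\<^sub>0 + t q\<close> with \<open>f\<^sub>0\<close> free of \<open>t\<close>, both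
  parts are closed, and \<open>q = d \<eta>\<close>, hence \<open>f = f\<^sub>0 + \<and>\<theta> \<eta>\<close>. The part \<open>f\<^sub>0\<close> is a section of \<open>T\<^sup>i\<close>, and it
  is determined by the class of \<open>f\<close> because coboundaries are divisible by \<open>t\<close>. In degree \<open>0\<close>, the
  closed elements are the multiples of \<open>t\<^sup>k\<close>.

  The residue of \<open>\<theta>\<close> is \<open>N = t \<partial>/\<partial>x\<^sub>1\<close>. Therefore \<open>W\<^sub>m\<close> is spanned by the monomials in which the
  exponent of \<open>x\<^sub>1\<close> exceeds that of \<open>t\<close> by at most \<open>m\<close> (lemma \<open>weight_filtration_wpoly\<close>), and a form is
  square-integrable iff it takes values in \<open>W\<^sub>0\<close>, and in \<open>W\<^sub>-\<^sub>2\<close> when \<open>e\<^sub>1\<close> is among its arguments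
  (lemma \<open>l2_forms_iff\<close>). The usual primitive \<open>\<eta>\<close>, obtained by contraction with the Euler vector
  field, violates this: for \<open>j \<noteq> i\<^sub>1\<close>, passing from \<open>f\<close> to \<open>x\<^sub>j f / t\<close> raises the weight by one. The
  remedy is to integrate in two steps. Contraction with \<open>x\<^sub>1 \<partial>/\<partial>x\<^sub>1\<close> alone raises the weight by two,
  but it starts from a component in \<open>W\<^sub>-\<^sub>2\<close> and ends in one in \<open>W\<^sub>0\<close>; it reduces the problem to the
  restriction of \<open>q\<close> to \<open>x\<^sub>1 = 0\<close>. There the Euler vector field can be used, since polynomials not
  involving \<open>x\<^sub>1\<close> have weight at most \<open>0\<close>. Both steps are instances of the homotopy formula
  \<open>wedge_higgs_homotopy\<close>; the results are \<open>wedge_higgs_primitive\<close> and \<open>primitive_l2\<close>.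

  This primitive has constant coefficients in the frame over one chart, so it applies to
  holomorphic families of forms on any open subset of the chart, whether or not it meets \<open>D\<close>. A
  section, however, consists of compatible families over all charts, so the primitive must be
  transported to the other charts, also along \<open>D\<close>. This is possible because the transition matrices
  of \<open>T(-log D)\<close> extend holomorphically across \<open>D\<close> and fix \<open>e\<^sub>1\<close> there (theorem
  \<open>log_transition_extends\<close>), which preserves square-integrability. The extension rests on two facts
  about holomorphic functions of several variables: their derivatives are holomorphic, and they are
  divisible by a coordinate on whose zero set they vanish. Lemma \<open>local_primitive\<close> combines all this;
  the remaining work is to see that both complexes consist of sheaves of modules.
\<close>

section \<open>Polynomials with a weighted grading\<close>

definition mpow :: "('m::finite \<Rightarrow> nat) \<Rightarrow> complex^'m \<Rightarrow> complex" where
  "mpow \<alpha> u = (\<Prod>j\<in>UNIV. u $ j ^ \<alpha> j)"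

text \<open>Exponents of the monomials of degree \<open>k\<close> whose weight is at most \<open>m\<close>, where the \<open>j\<close>-th variable has
  weight \<open>\<omega> j\<close>. With weights \<open>0\<close> and \<open>m = 0\<close> there is no condition on the weight, so that one theory
  of spans of monomials covers both the symmetric powers and the steps of their weight filtrations.\<close>

definition degs :: "('m::finite \<Rightarrow> int) \<Rightarrow> nat \<Rightarrow> int \<Rightarrow> ('m \<Rightarrow> nat) set" where
  "degs \<omega> k m = {\<alpha>. sum \<alpha> UNIV = k \<and> (\<Sum>j\<in>UNIV. \<omega> j * int (\<alpha> j)) \<le> m}"

definition wpoly :: "('m::finite \<Rightarrow> int) \<Rightarrow> nat \<Rightarrow> int \<Rightarrow> (complex^'m \<Rightarrow> complex) set" where
  "wpoly \<omega> k m = {p. \<exists>a. p = (\<lambda>u. \<Sum>\<alpha>\<in>degs \<omega> k m. a \<alpha> * mpow \<alpha> u)}"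

abbreviation hpoly :: "nat \<Rightarrow> (complex^'m::finite \<Rightarrow> complex) set" where
  "hpoly k \<equiv> wpoly (\<lambda>_. 0) k 0"

lemma sym_power_wpoly: "sym_power k = hpoly k"
  by (simp add: sym_power_def wpoly_def degs_def mpow_def)

lemma le_degree: "sum \<alpha> UNIV = k \<Longrightarrow> \<alpha> (j::'m::finite) \<le> (k::nat)"
  by (metis finite iso_tuple_UNIV_I member_le_sum zero_le)

lemma finite_degs [simp]: "finite (degs \<omega> k m)"
proof (rule finite_subset)
  show "degs \<omega> k m \<subseteq> PiE UNIV (\<lambda>_. {..k})"
    using le_degree by (fastforce simp: degs_def)
  show "finite (PiE UNIV (\<lambda>_::'a. {..k}))"
    by (intro finite_PiE) auto
qed

lemma wpoly_zero [simp]: "(\<lambda>_. 0) \<in> wpoly \<omega> k m"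
  unfolding wpoly_def by (rule CollectI, rule exI[of _ "\<lambda>_. 0"]) simp

lemma wpoly_lincomb:
  assumes "p \<in> wpoly \<omega> k m" "q \<in> wpoly \<omega> k m"
  shows "(\<lambda>u. a * p u + b * q u) \<in> wpoly \<omega> k m"
proof -
  obtain c d where "p = (\<lambda>u. \<Sum>\<alpha>\<in>degs \<omega> k m. c \<alpha> * mpow \<alpha> u)" "q = (\<lambda>u. \<Sum>\<alpha>\<in>degs \<omega> k m. d \<alpha> * mpow \<alpha> u)"
    using assms unfolding wpoly_def by blast
  then have "(\<lambda>u. a * p u + b * q u) = (\<lambda>u. \<Sum>\<alpha>\<in>degs \<omega> k m. (a * c \<alpha> + b * d \<alpha>) * mpow \<alpha> u)"
    by (simp add: sum_distrib_left sum.distrib algebra_simps)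
  then show ?thesis unfolding wpoly_def by (intro CollectI exI)
qed

lemma wpoly_add: "p \<in> wpoly \<omega> k m \<Longrightarrow> q \<in> wpoly \<omega> k m \<Longrightarrow> (\<lambda>u. p u + q u) \<in> wpoly \<omega> k m"
  using wpoly_lincomb[of p \<omega> k m q 1 1] by simp

lemma wpoly_scale: "p \<in> wpoly \<omega> k m \<Longrightarrow> (\<lambda>u. a * p u) \<in> wpoly \<omega> k m"
  using wpoly_lincomb[of p \<omega> k m p a 0] by simp

lemma wpoly_sum:
  assumes "\<And>i. i \<in> I \<Longrightarrow> p i \<in> wpoly \<omega> k m"
  shows "(\<lambda>u. \<Sum>i\<in>I. p i u) \<in> wpoly \<omega> k m"
  using assms by (induction I rule: infinite_finite_induct) (auto intro: wpoly_add)

lemma mpow_wpoly: "\<alpha> \<in> degs \<omega> k m \<Longrightarrow> mpow \<alpha> \<in> wpoly \<omega> k m"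
  unfolding wpoly_def
  by (rule CollectI, rule exI[of _ "\<lambda>\<beta>. if \<beta> = \<alpha> then 1 else 0"])
     (simp add: if_distrib[of "\<lambda>x. x * _"] sum.delta cong: if_cong)

text \<open>Linear operators and the spaces that they preserve are studied on monomials first; this rule
  extends the result to their span.\<close>

lemma wpoly_induct [consumes 1, case_names zero mpow add]:
  assumes "p \<in> wpoly \<omega> k m"
    and "P (\<lambda>_. 0)"
    and "\<And>\<alpha>. \<alpha> \<in> degs \<omega> k m \<Longrightarrow> P (mpow \<alpha>)"
    and "\<And>p q a. p \<in> wpoly \<omega> k m \<Longrightarrow> q \<in> wpoly \<omega> k m \<Longrightarrow> P p \<Longrightarrow> P q \<Longrightarrow> P (\<lambda>u. p u + a * q u)"
  shows "P p"
proof -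
  have *: "(\<lambda>u. \<Sum>\<alpha>\<in>F. a \<alpha> * mpow \<alpha> u) \<in> wpoly \<omega> k m \<and> P (\<lambda>u. \<Sum>\<alpha>\<in>F. a \<alpha> * mpow \<alpha> u)"
    if "finite F" "F \<subseteq> degs \<omega> k m" for a F
    using that
  proof (induction F rule: finite_induct)
    case empty
    then show ?case by (simp add: assms(2))
  next
    case (insert \<beta> F)
    have "P (\<lambda>u. (\<Sum>\<alpha>\<in>F. a \<alpha> * mpow \<alpha> u) + a \<beta> * mpow \<beta> u)"
      using insert by (intro assms(4) mpow_wpoly assms(3)) auto
    moreover have "(\<lambda>u. (\<Sum>\<alpha>\<in>F. a \<alpha> * mpow \<alpha> u) + a \<beta> * mpow \<beta> u) \<in> wpoly \<omega> k m"
      using insert by (intro wpoly_add wpoly_scale mpow_wpoly) auto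
    ultimately show ?case using insert.hyps by (simp add: add.commute)
  qed
  show ?thesis using assms(1) * unfolding wpoly_def by auto
qed

lemma wpoly_subset: "degs \<omega> k m \<subseteq> degs \<omega>' k' m' \<Longrightarrow> p \<in> wpoly \<omega> k m \<Longrightarrow> p \<in> wpoly \<omega>' k' m'"
  by (rotate_tac, induction rule: wpoly_induct) (auto intro: mpow_wpoly wpoly_add wpoly_scale)

lemma wpoly_le: "m \<le> m' \<Longrightarrow> p \<in> wpoly \<omega> k m \<Longrightarrow> p \<in> wpoly \<omega> k m'"
  by (rule wpoly_subset) (auto simp: degs_def)

lemma wpoly_sym_power: "p \<in> wpoly \<omega> k m \<Longrightarrow> p \<in> hpoly k"
  by (rule wpoly_subset) (auto simp: degs_def)

lemma mpow_add: "mpow \<alpha> u * mpow \<beta> u = mpow (\<lambda>j. \<alpha> j + \<beta> j) u"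
  by (simp add: mpow_def power_add prod.distrib)

lemma wpoly_mult:
  assumes "p \<in> wpoly \<omega> k m" "q \<in> wpoly \<omega> k' m'"
  shows "(\<lambda>u. p u * q u) \<in> wpoly \<omega> (k + k') (m + m')"
  using assms(1)
proof (induction rule: wpoly_induct)
  case zero
  then show ?case by simp
next
  case (mpow \<alpha>)
  show ?case using assms(2)
  proof (induction rule: wpoly_induct)
    case zero
    then show ?case by simp
  next
    case (mpow \<beta>)
    then have "(\<lambda>j. \<alpha> j + \<beta> j) \<in> degs \<omega> (k + k') (m + m')"
      using \<open>\<alpha> \<in> degs \<omega> k m\<close> by (auto simp: degs_def sum.distrib algebra_simps)
    from mpow_wpoly[OF this] show ?case by (simp add: mpow_add)
  next
    case (add p q a)
    from wpoly_add[OF add(3) wpoly_scale[OF add(4), of a]] show ?case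
      by (simp add: algebra_simps)
  qed
next
  case (add p q a)
  from wpoly_add[OF add(3) wpoly_scale[OF add(4), of a]] show ?case
    by (simp add: algebra_simps)
qed

lemma wpoly_one: "(\<lambda>_. 1) \<in> wpoly \<omega> 0 0"
  using mpow_wpoly[of "\<lambda>_. 0" \<omega> 0 0] by (simp add: degs_def mpow_def[abs_def])

lemma wpoly_prod:
  assumes "finite I" "\<And>i. i \<in> I \<Longrightarrow> p i \<in> wpoly \<omega> (k i) (m i)"
  shows "(\<lambda>u. \<Prod>i\<in>I. p i u) \<in> wpoly \<omega> (sum k I) (sum m I)"
  using assms by (induction I rule: finite_induct) (auto intro: wpoly_one wpoly_mult)

lemma wpoly_power: "p \<in> wpoly \<omega> k m \<Longrightarrow> (\<lambda>u. p u ^ n) \<in> wpoly \<omega> (n * k) (int n * m)"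
proof (induction n)
  case 0
  then show ?case by (simp add: wpoly_one)
next
  case (Suc n)
  from wpoly_mult[OF Suc.prems Suc.IH[OF Suc.prems]] show ?case by (simp add: algebra_simps)
qed

lemma wpoly_var: "\<omega> j \<le> m \<Longrightarrow> (\<lambda>u. u $ j) \<in> wpoly \<omega> 1 m"
proof -
  assume "\<omega> j \<le> m"
  then have "(\<lambda>i. if i = j then 1 else 0) \<in> degs \<omega> 1 m"
    by (simp add: degs_def if_distrib[of "\<lambda>x. _ * x"] if_distrib[of int] sum.delta cong: if_cong)
  from mpow_wpoly[OF this] show ?thesis
    by (simp add: mpow_def[abs_def] if_distrib[of "\<lambda>x. _ ^ x"] prod.delta cong: if_cong)
qed

text \<open>A substitution replacing each variable by a linear form of at most the same weight does not
  raise weights. Transition maps, dilations, and setting variables to zero are of this kind.\<close>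

lemma wpoly_subst:
  assumes "p \<in> wpoly \<omega> k m" and "\<And>j. (\<lambda>u. \<Phi> u $ j) \<in> wpoly \<omega>' 1 (\<omega> j)"
  shows "(\<lambda>u. p (\<Phi> u)) \<in> wpoly \<omega>' k m"
  using assms(1)
proof (induction rule: wpoly_induct)
  case zero
  then show ?case by simp
next
  case (mpow \<alpha>)
  have "(\<lambda>u. \<Prod>j\<in>UNIV. (\<Phi> u $ j) ^ \<alpha> j) \<in> wpoly \<omega>' (\<Sum>j\<in>UNIV. \<alpha> j * 1) (\<Sum>j\<in>UNIV. int (\<alpha> j) * \<omega> j)"
    by (intro wpoly_prod wpoly_power assms) auto
  then show ?case using mpow by (auto simp: mpow_def degs_def mult.commute intro: wpoly_le)
next
  case (add p q a)
  then show ?case by (intro wpoly_add wpoly_scale)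
qed

section \<open>Coefficients of a polynomial as combinations of its values\<close>

definition unity_root :: "nat \<Rightarrow> complex" where
  "unity_root M = exp (2 * of_real pi * \<i> / of_nat M)"

lemma unity_root_nonzero [simp]: "unity_root M \<noteq> 0"
  by (simp add: unity_root_def)

lemma unity_root_power: "unity_root M ^ a = exp (2 * of_real pi * \<i> * of_nat a / of_nat M)"
  by (simp add: unity_root_def exp_of_nat_mult[symmetric] mult_ac)

lemma unity_root_power_eq_1: "M \<ge> 1 \<Longrightarrow> unity_root M ^ a = 1 \<longleftrightarrow> M dvd a"
  unfolding unity_root_power by (rule complex_root_unity_eq_1)

text \<open>For \<open>a \<noteq> b\<close> this is a geometric sum with ratio different from \<open>1\<close>.\<close>

lemma unity_root_orthogonal:
  assumes "a < M" "b < M"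
  shows "(\<Sum>r<M. (unity_root M ^ r) ^ a / (unity_root M ^ r) ^ b) = (if a = b then of_nat M else 0)"
proof (cases "a = b")
  case True
  then show ?thesis by simp
next
  case False
  let ?z = "unity_root M"
  let ?y = "?z ^ a / ?z ^ b"
  have M: "M \<ge> 1" using assms by simp
  have "?y \<noteq> 1"
  proof
    assume "?y = 1"
    then have "?z ^ a = ?z ^ b" by simp
    then show False
      using False assms M complex_root_unity_eq[of M a b] by (simp add: unity_root_power)
  qed
  moreover have "?z ^ M = 1" using M unity_root_power_eq_1[of M M] by simp
  then have "?y ^ M = 1"
    by (metis (no_types) div_by_1 mult.commute power_divide power_mult power_one)
  moreover have "(?z ^ r) ^ a / (?z ^ r) ^ b = ?y ^ r" for r
    by (simp add: power_divide power_mult[symmetric] mult.commute)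
  ultimately show ?thesis using False by (simp add: geometric_sum)
qed

text \<open>The discrete Fourier transform of the values of \<open>p\<close> on the points whose coordinates are
  \<open>(k+1)\<close>-st roots of unity; it is the coefficient of \<open>mpow \<alpha>\<close> in a polynomial of degree at most \<open>k\<close>.
  As a finite linear combination of values of \<open>p\<close>, it depends holomorphically on every parameter on
  which these values do.\<close>

definition coef :: "nat \<Rightarrow> ('m::finite \<Rightarrow> nat) \<Rightarrow> (complex^'m \<Rightarrow> complex) \<Rightarrow> complex" where
  "coef k \<alpha> p = (\<Sum>l\<in>PiE UNIV (\<lambda>_. {..<Suc k}).
     (\<Prod>j\<in>UNIV. 1 / (of_nat (Suc k) * (unity_root (Suc k) ^ l j) ^ \<alpha> j)) *
     p (\<chi> j. unity_root (Suc k) ^ l j))"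

lemma coef_lincomb: "coef k \<alpha> (\<lambda>u. a * p u + b * q u) = a * coef k \<alpha> p + b * coef k \<alpha> q"
  by (simp add: coef_def sum_distrib_left sum.distrib algebra_simps)

lemma coef_zero [simp]: "coef k \<alpha> (\<lambda>_. 0) = 0"
  by (simp add: coef_def)

lemma coef_add: "coef k \<alpha> (\<lambda>u. p u + q u) = coef k \<alpha> p + coef k \<alpha> q"
  using coef_lincomb[of k \<alpha> 1 p 1 q] by simp

lemma coef_scale: "coef k \<alpha> (\<lambda>u. a * p u) = a * coef k \<alpha> p"
  using coef_lincomb[of k \<alpha> a p 0 p] by simp

text \<open>The sum over all points factors into a product over the variables.\<close>

lemma coef_mpow:
  assumes "\<And>j. \<alpha> j \<le> k" "\<And>j. \<beta> j \<le> k"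
  shows "coef k \<alpha> (mpow \<beta>) = (if \<alpha> = \<beta> then 1 else 0)"
proof -
  let ?z = "unity_root (Suc k)"
  have *: "(\<Sum>r<Suc k. 1 / (of_nat (Suc k) * (?z ^ r) ^ a) * (?z ^ r) ^ b) = (if a = b then 1 else 0)"
    if "a \<le> k" "b \<le> k" for a b
  proof -
    have "(\<Sum>r<Suc k. 1 / (of_nat (Suc k) * (?z ^ r) ^ a) * (?z ^ r) ^ b)
        = (\<Sum>r<Suc k. (?z ^ r) ^ b / (?z ^ r) ^ a) / of_nat (Suc k)"
      by (simp only: sum_divide_distrib) (intro sum.cong; simp add: field_simps)
    also have "\<dots> = (if a = b then 1 else 0)"
      using that unity_root_orthogonal[of b "Suc k" a] by (auto simp del: of_nat_Suc)
    finally show ?thesis .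
  qed
  have "coef k \<alpha> (mpow \<beta>) = (\<Sum>l\<in>PiE UNIV (\<lambda>_. {..<Suc k}).
     (\<Prod>j\<in>UNIV. 1 / (of_nat (Suc k) * (?z ^ l j) ^ \<alpha> j) * (?z ^ l j) ^ \<beta> j))"
    by (simp add: coef_def mpow_def prod.distrib[symmetric])
  also have "\<dots> = (\<Prod>j\<in>UNIV. \<Sum>r<Suc k. 1 / (of_nat (Suc k) * (?z ^ r) ^ \<alpha> j) * (?z ^ r) ^ \<beta> j)"
    by (rule prod_sum_PiE[symmetric]) auto
  also have "\<dots> = (\<Prod>j\<in>UNIV. if \<alpha> j = \<beta> j then 1 else 0)"
    by (intro prod.cong refl * assms)
  also have "\<dots> = (if \<alpha> = \<beta> then 1 else 0)"
    by (auto simp: fun_eq_iff prod_zero_iff)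
  finally show ?thesis .
qed

abbreviation degrees :: "nat \<Rightarrow> ('m::finite \<Rightarrow> nat) set" where
  "degrees k \<equiv> {\<alpha>. sum \<alpha> UNIV = k}"

lemma degs_0: "degs (\<lambda>_. 0) k 0 = degrees k"
  by (simp add: degs_def)

lemma finite_degrees [simp]: "finite (degrees k)"
  using finite_degs[of "\<lambda>_. 0" k 0] by (simp only: degs_0)

lemma coef_mpow_degrees:
  "\<alpha> \<in> degrees k \<Longrightarrow> \<beta> \<in> degrees k \<Longrightarrow> coef k \<alpha> (mpow \<beta>) = (if \<alpha> = \<beta> then 1 else 0)"
  by (rule coef_mpow) (auto intro: le_degree)

lemma coef_eq_0:
  assumes "p \<in> wpoly \<omega> k m" "\<alpha> \<in> degrees k" "(\<Sum>j\<in>UNIV. \<omega> j * int (\<alpha> j)) > m"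
  shows "coef k \<alpha> p = 0"
  using assms(1)
proof (induction rule: wpoly_induct)
  case (mpow \<beta>)
  then have "\<beta> \<in> degrees k" "\<beta> \<noteq> \<alpha>" using assms by (auto simp: degs_def)
  then show ?case using coef_mpow_degrees[OF assms(2), of \<beta>] by auto
qed (simp_all add: coef_add coef_scale)

lemma coef_expand:
  assumes "p \<in> hpoly k"
  shows "p u = (\<Sum>\<alpha>\<in>degrees k. coef k \<alpha> p * mpow \<alpha> u)"
  using assms
proof (induction rule: wpoly_induct)
  case (mpow \<beta>)
  then have "\<beta> \<in> degrees k" by (simp add: degs_def)
  then have "(\<Sum>\<alpha>\<in>degrees k. coef k \<alpha> (mpow \<beta>) * mpow \<alpha> u) = (\<Sum>\<alpha>\<in>degrees k. if \<alpha> = \<beta> then mpow \<alpha> u else 0)"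
    by (intro sum.cong refl) (simp add: coef_mpow_degrees)
  then show ?case using \<open>\<beta> \<in> degrees k\<close> by (simp add: sum.delta)
next
  case (add p q a)
  then show ?case
    by (simp add: coef_add coef_scale sum.distrib sum_distrib_left algebra_simps)
qed simp

lemma wpolyI_coef:
  assumes "p \<in> hpoly k"
    and "\<And>\<alpha>. \<alpha> \<in> degrees k \<Longrightarrow> (\<Sum>j\<in>UNIV. \<omega> j * int (\<alpha> j)) > m \<Longrightarrow> coef k \<alpha> p = 0"
  shows "p \<in> wpoly \<omega> k m"
proof -
  have "(\<lambda>u. \<Sum>\<alpha>\<in>degrees k. coef k \<alpha> p * mpow \<alpha> u) \<in> wpoly \<omega> k m"
  proof (rule wpoly_sum)
    fix \<alpha> :: "'a \<Rightarrow> nat" assume a: "\<alpha> \<in> degrees k"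
    show "(\<lambda>u. coef k \<alpha> p * mpow \<alpha> u) \<in> wpoly \<omega> k m"
    proof (cases "\<alpha> \<in> degs \<omega> k m")
      case True
      then show ?thesis by (intro wpoly_scale mpow_wpoly)
    next
      case False
      with a assms(2)[OF a] show ?thesis by (simp add: degs_def)
    qed
  qed
  moreover have "(\<lambda>u. \<Sum>\<alpha>\<in>degrees k. coef k \<alpha> p * mpow \<alpha> u) = p"
    by (rule ext) (rule coef_expand[OF assms(1), symmetric])
  ultimately show ?thesis by simp
qed

section \<open>Partial derivatives of polynomials\<close>

definition partial :: "'m::finite \<Rightarrow> (complex^'m \<Rightarrow> complex) \<Rightarrow> complex^'m \<Rightarrow> complex" where
  "partial j p u = deriv (\<lambda>s. p (u + s *s axis j 1)) 0"

lemma mpow_curve: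
  assumes "\<And>j. ((\<lambda>s. \<phi> s $ j) has_field_derivative \<phi>' j) (at s)"
  shows "((\<lambda>s. mpow \<alpha> (\<phi> s)) has_field_derivative
     (\<Sum>j\<in>UNIV. \<phi>' j * (of_nat (\<alpha> j) * mpow (\<alpha>(j := \<alpha> j - 1)) (\<phi> s)))) (at s)"
proof -
  have "((\<lambda>s. \<Prod>j\<in>UNIV. (\<phi> s $ j) ^ \<alpha> j) has_field_derivative
     (\<Sum>j\<in>UNIV. (of_nat (\<alpha> j) * (\<phi>' j * \<phi> s $ j ^ (\<alpha> j - 1))) *
        (\<Prod>i\<in>UNIV - {j}. (\<phi> s $ i) ^ \<alpha> i))) (at s)"
    by (intro has_field_derivative_prod) (rule derivative_eq_intros assms refl | simp)+
  moreover have "mpow (\<alpha>(j := \<alpha> j - 1)) u = u $ j ^ (\<alpha> j - 1) * (\<Prod>i\<in>UNIV - {j}. u $ i ^ \<alpha> i)" for j u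
    unfolding mpow_def by (subst prod.remove[of _ j]) (auto intro: prod.cong)
  ultimately show ?thesis by (simp add: mpow_def[of \<alpha>] mult_ac)
qed

lemma partial_mpow: "partial j (mpow \<alpha>) u = of_nat (\<alpha> j) * mpow (\<alpha>(j := \<alpha> j - 1)) u"
proof -
  have "((\<lambda>s. (u + s *s axis j 1) $ i) has_field_derivative (if i = j then 1 else 0)) (at 0)" for i
    by (auto simp: axis_def intro!: derivative_eq_intros)
  from mpow_curve[of "\<lambda>s. u + s *s axis j 1", OF this, of \<alpha>] show ?thesis
    unfolding partial_def
    by (intro DERIV_imp_deriv) (simp add: if_distrib[of "\<lambda>x. x * _"] sum.delta cong: if_cong)
qed

lemma poly_curve_aux:
  assumes "p \<in> wpoly \<omega> k m"
  shows "(\<forall>\<phi> \<phi>' s. (\<forall>j. ((\<lambda>s. \<phi> s $ j) has_field_derivative \<phi>' j) (at s)) \<longrightarrow>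
     ((\<lambda>s. p (\<phi> s)) has_field_derivative (\<Sum>j\<in>UNIV. \<phi>' j * partial j p (\<phi> s))) (at s))"
  using assms
proof (induction rule: wpoly_induct)
  case zero
  show ?case by (simp add: partial_def)
next
  case (mpow \<alpha>)
  then show ?case using mpow_curve by (auto simp: partial_mpow)
next
  case (add p q a)
  have partial: "partial j (\<lambda>u. p u + a * q u) u = partial j p u + a * partial j q u" for j u
  proof -
    have 1: "\<forall>i. ((\<lambda>s. (u + s *s axis j 1) $ i) has_field_derivative (if i = j then 1 else 0)) (at 0)"
      by (auto simp: axis_def intro!: derivative_eq_intros)
    have "((\<lambda>s. p (u + s *s axis j 1)) has_field_derivative partial j p u) (at 0)"
      "((\<lambda>s. q (u + s *s axis j 1)) has_field_derivative partial j q u) (at 0)"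
      using add.IH(1)[rule_format, OF 1[rule_format]] add.IH(2)[rule_format, OF 1[rule_format]]
      by (simp_all add: if_distrib[of "\<lambda>x. x * _"] sum.delta cong: if_cong)
    then show ?thesis
      unfolding partial_def[of j "\<lambda>u. p u + a * q u"]
      by (intro DERIV_imp_deriv) (auto intro!: derivative_eq_intros)
  qed
  show ?case
  proof (intro allI impI)
    fix \<phi> :: "complex \<Rightarrow> complex^'a" and \<phi>' and s :: complex
    assume "\<forall>j. ((\<lambda>s. \<phi> s $ j) has_field_derivative \<phi>' j) (at s)"
    then have "((\<lambda>s. p (\<phi> s)) has_field_derivative (\<Sum>j\<in>UNIV. \<phi>' j * partial j p (\<phi> s))) (at s)"
      "((\<lambda>s. q (\<phi> s)) has_field_derivative (\<Sum>j\<in>UNIV. \<phi>' j * partial j q (\<phi> s))) (at s)"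
      using add.IH by blast+
    then show "((\<lambda>s. p (\<phi> s) + a * q (\<phi> s)) has_field_derivative
       (\<Sum>j\<in>UNIV. \<phi>' j * partial j (\<lambda>u. p u + a * q u) (\<phi> s))) (at s)"
      by (auto simp: partial sum.distrib sum_distrib_left algebra_simps intro!: derivative_eq_intros)
  qed
qed

text \<open>Derivatives of polynomials are taken along curves throughout, so this form of the chain rule
  suffices.\<close>

lemma poly_curve:
  assumes "p \<in> wpoly \<omega> k m" "\<And>j. ((\<lambda>s. \<phi> s $ j) has_field_derivative \<phi>' j) (at s)"
  shows "((\<lambda>s. p (\<phi> s)) has_field_derivative (\<Sum>j\<in>UNIV. \<phi>' j * partial j p (\<phi> s))) (at s)"
  using poly_curve_aux[OF assms(1)] assms(2) by blast

lemma poly_line: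
  assumes "p \<in> wpoly \<omega> k m"
  shows "((\<lambda>s. p (u + s *s v)) has_field_derivative (\<Sum>j\<in>UNIV. v $ j * partial j p u)) (at 0)"
proof -
  have "((\<lambda>s. (u + s *s v) $ j) has_field_derivative v $ j) (at 0)" for j
    by (auto intro!: derivative_eq_intros)
  from poly_curve[OF assms this] show ?thesis by simp
qed

lemma partial_add_scale:
  assumes "p \<in> wpoly \<omega> k m" "q \<in> wpoly \<omega>' k' m'"
  shows "partial j (\<lambda>u. a * p u + b * q u) u = a * partial j p u + b * partial j q u"
proof -
  have 1: "((\<lambda>s. p (u + s *s axis j 1)) has_field_derivative partial j p u) (at 0)"
    "((\<lambda>s. q (u + s *s axis j 1)) has_field_derivative partial j q u) (at 0)"
    using poly_line[OF assms(1), of u "axis j 1"] poly_line[OF assms(2), of u "axis j 1"]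
    by (simp_all add: axis_def if_distrib[of "\<lambda>x. x * _"] sum.delta cong: if_cong)
  then show ?thesis
    unfolding partial_def[of j "\<lambda>u. a * p u + b * q u"]
    by (intro DERIV_imp_deriv) (auto intro!: derivative_eq_intros)
qed

lemma partial_zero [simp]: "partial j (\<lambda>_. 0) u = 0"
  by (simp add: partial_def)

lemma degs_shift:
  assumes "\<alpha> \<in> degs \<omega> k m" "\<alpha> j \<noteq> 0"
  shows "(\<lambda>l. (\<alpha>(j := \<alpha> j - 1)) l + (if l = i then 1 else 0)) \<in> degs \<omega> k (m - \<omega> j + \<omega> i)"
proof -
  have sum_if: "(\<Sum>l\<in>UNIV. f l * (if l = i then 1 else 0)) = f i" for f :: "'a \<Rightarrow> 'b::semiring_1" and i
    by (simp add: if_distrib[of "\<lambda>x. _ * x"] sum.delta cong: if_cong)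
  have a: "\<alpha> l = (\<alpha>(j := \<alpha> j - 1)) l + (if l = j then 1 else 0)" for l
    using assms(2) by simp
  have "sum \<alpha> UNIV = (\<Sum>l\<in>UNIV. (\<alpha>(j := \<alpha> j - 1)) l + (if l = j then 1 else 0))"
    by (rule sum.cong[OF refl a])
  then have b: "sum \<alpha> UNIV = sum (\<alpha>(j := \<alpha> j - 1)) UNIV + 1"
    using sum_if[of "\<lambda>_. 1::nat" j] by (simp add: sum.distrib del: fun_upd_apply)
  have "(\<Sum>l\<in>UNIV. \<omega> l * int (\<alpha> l)) = (\<Sum>l\<in>UNIV. \<omega> l * int ((\<alpha>(j := \<alpha> j - 1)) l) + \<omega> l * (if l = j then 1 else 0))"
    using assms(2) by (intro sum.cong refl) (auto simp: algebra_simps of_nat_diff)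
  then have c: "(\<Sum>l\<in>UNIV. \<omega> l * int (\<alpha> l)) = (\<Sum>l\<in>UNIV. \<omega> l * int ((\<alpha>(j := \<alpha> j - 1)) l)) + \<omega> j"
    by (simp only: sum.distrib sum_if)
  show ?thesis
    using assms(1) b c sum_if[of "\<lambda>_. 1::nat" i]
    by (simp add: degs_def ring_distribs sum.distrib if_distrib[of int] sum_if del: fun_upd_apply cong: if_cong)
qed

lemma var_mult_mpow: "u $ i * mpow \<alpha> u = mpow (\<lambda>l. \<alpha> l + (if l = i then 1 else 0)) u"
proof -
  have "mpow (\<lambda>l. if l = i then 1 else 0) u = u $ i"
    by (simp add: mpow_def if_distrib[of "\<lambda>x. _ ^ x"] prod.delta cong: if_cong)
  then show ?thesis by (metis mpow_add mult.commute)
qed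

text \<open>Unlike the derivative itself, its product with a variable keeps the degree, which avoids
  degree \<open>k - 1\<close> for \<open>k = 0\<close>.\<close>

lemma wpoly_var_partial:
  assumes "p \<in> wpoly \<omega> k m"
  shows "(\<lambda>u. u $ i * partial j p u) \<in> wpoly \<omega> k (m - \<omega> j + \<omega> i)"
  using assms
proof (induction rule: wpoly_induct)
  case zero
  then show ?case by simp
next
  case (mpow \<alpha>)
  show ?case
  proof (cases "\<alpha> j = 0")
    case True
    then show ?thesis by (simp add: partial_mpow)
  next
    case False
    have "(\<lambda>u. of_nat (\<alpha> j) * mpow (\<lambda>l. (\<alpha>(j := \<alpha> j - 1)) l + (if l = i then 1 else 0)) u) \<in> wpoly \<omega> k (m - \<omega> j + \<omega> i)"
      by (intro wpoly_scale mpow_wpoly degs_shift mpow False)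
    then show ?thesis
      by (simp only: partial_mpow mult.left_commute[of "_ $ i"] var_mult_mpow)
  qed
next
  case (add p q a)
  have "(\<lambda>u. u $ i * partial j p u + a * (u $ i * partial j q u)) \<in> wpoly \<omega> k (m - \<omega> j + \<omega> i)"
    by (intro wpoly_add wpoly_scale add)
  moreover have "u $ i * partial j (\<lambda>u. p u + a * q u) u = u $ i * partial j p u + a * (u $ i * partial j q u)" for u
    using partial_add_scale[OF add(1,2), of j 1 a] by (simp add: algebra_simps)
  ultimately show ?case by simp
qed

section \<open>The Higgs field on polynomials\<close>

lemma sum_option: "(\<Sum>j\<in>(UNIV::'n::finite option set). f j) = f None + (\<Sum>i\<in>UNIV. f (Some i))"
  by (simp add: UNIV_option_conv sum.reindex)

text \<open>The extension of a linear map to a derivation differentiates along the vector field given by the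
  map, which here is \<open>t w\<close> with \<open>t = u $ None\<close>.\<close>

lemma higgs_eq:
  assumes "p \<in> wpoly \<omega> k m"
  shows "higgs w p u = u $ None * (\<Sum>i\<in>UNIV. w $ i * partial (Some i) p u)"
proof -
  have "higgs w p u = (\<Sum>j\<in>UNIV. higgs1_dual w u $ j * partial j p u)"
    unfolding higgs_def derivation_ext_def by (rule DERIV_imp_deriv[OF poly_line[OF assms]])
  then show ?thesis
    by (simp add: sum_option higgs1_dual_def sum_distrib_left mult_ac)
qed

lemma higgs_wpoly:
  assumes "p \<in> wpoly \<omega> k m" and "\<And>i. w $ i \<noteq> 0 \<Longrightarrow> m - \<omega> (Some i) + \<omega> None \<le> m'"
  shows "higgs w p \<in> wpoly \<omega> k m'"
proof -
  have "(\<lambda>u. \<Sum>i\<in>UNIV. w $ i * (u $ None * partial (Some i) p u)) \<in> wpoly \<omega> k m'"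
  proof (rule wpoly_sum)
    fix i :: 'a
    show "(\<lambda>u. w $ i * (u $ None * partial (Some i) p u)) \<in> wpoly \<omega> k m'"
    proof (cases "w $ i = 0")
      case False
      then show ?thesis
        by (intro wpoly_scale wpoly_le[OF _ wpoly_var_partial[OF assms(1)]] assms(2))
    qed simp
  qed
  moreover have "(\<lambda>u. \<Sum>i\<in>UNIV. w $ i * (u $ None * partial (Some i) p u)) = higgs w p"
    by (rule ext) (simp add: higgs_eq[OF assms(1)] sum_distrib_left mult_ac)
  ultimately show ?thesis by simp
qed

lemma higgs_zero [simp]: "higgs w (\<lambda>_. 0) = (\<lambda>_. 0)"
  by (simp add: higgs_def derivation_ext_def fun_eq_iff)

lemma higgs_lincomb:
  assumes "p \<in> wpoly \<omega> k m" "q \<in> wpoly \<omega> k m"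
  shows "higgs w (\<lambda>u. a * p u + b * q u) u = a * higgs w p u + b * higgs w q u"
  by (simp add: higgs_eq[OF wpoly_lincomb[OF assms]] higgs_eq[OF assms(1)] higgs_eq[OF assms(2)]
      partial_add_scale[OF assms] sum.distrib sum_distrib_left algebra_simps)

lemma higgs_linear:
  assumes "p \<in> wpoly \<omega> k m"
  shows "higgs (a *s v + b *s w) p u = a * higgs v p u + b * higgs w p u"
  by (simp add: higgs_eq[OF assms] sum.distrib sum_distrib_left algebra_simps)

section \<open>The monodromy weight filtration\<close>

lemma weight_filtration_power:
  assumes "is_weight_filtration V N W"
  shows "p \<in> W m \<Longrightarrow> (N ^^ j) p \<in> W (m - 2 * int j)"
proof (induction j)
  case (Suc j)
  have "N ` W (m - 2 * int j) \<subseteq> W (m - 2 * int j - 2)"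
    using assms unfolding is_weight_filtration_def by blast
  with Suc show ?case by (auto simp: algebra_simps)
qed simp

text \<open>An element of \<open>W\<^sub>-\<^sub>m\<close> is the image under \<open>N ^^ m\<close> of an element of \<open>W\<^sub>m\<close>, up to an error in
  \<open>W\<^sub>-\<^sub>m\<^sub>-\<^sub>1\<close>. The error is treated in the same way, until the filtration vanishes.\<close>

lemma weight_filtration_neg:
  assumes W: "is_weight_filtration V N W"
    and lin: "\<And>p q. p \<in> V \<Longrightarrow> q \<in> V \<Longrightarrow> N (\<lambda>x. p x + q x) = (\<lambda>x. N p x + N q x)"
  shows "W (- int m) = (N ^^ m) ` W (int m)"
proof
  have sub: "csubspace (W m)" "W m \<subseteq> V" and le: "mono W"
    and N: "N ` W m \<subseteq> W (m - 2)" for m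
    using W unfolding is_weight_filtration_def by blast+
  have surj: "\<exists>p\<in>W (int m). (\<lambda>x. q x - (N ^^ m) p x) \<in> W (- int m - 1)" if "q \<in> W (- int m)" for m q
    using W that unfolding is_weight_filtration_def by blast
  obtain M where M: "W M = {\<lambda>_. 0}"
    using W unfolding is_weight_filtration_def by blast
  obtain T where T: "W T = V"
    using W unfolding is_weight_filtration_def by blast
  have NV: "(N ^^ j) p \<in> V" if "p \<in> V" for p j
    using weight_filtration_power[OF W, of p T j] that T sub by auto
  have V0: "(\<lambda>_. 0) \<in> V" using sub(1)[of T] T by (simp add: csubspace_def)
  have N0: "N (\<lambda>_. 0) = (\<lambda>_. 0)"
    using lin[OF V0 V0] by (simp add: fun_eq_iff)
  have Nm0: "(N ^^ j) (\<lambda>_. 0) = (\<lambda>_. 0)" for j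
    by (induction j) (simp_all add: N0)
  have linm: "(N ^^ j) (\<lambda>x. p x + q x) = (\<lambda>x. (N ^^ j) p x + (N ^^ j) q x)" if "p \<in> V" "q \<in> V" for p q j
    by (induction j) (simp_all add: lin NV that)
  \<comment> \<open>By induction on the distance to a weight in which the filtration vanishes.\<close>
  have *: "q \<in> (N ^^ m) ` W (int m)" if "q \<in> W (- int m)" "W (- int (m + d)) \<subseteq> {\<lambda>_. 0}" for d m q
    using that
  proof (induction d arbitrary: m q)
    case 0
    then have "q = (\<lambda>_. 0)" by auto
    then have "q = (N ^^ m) (\<lambda>_. 0)" by (simp add: Nm0)
    moreover have "(\<lambda>_. 0) \<in> W (int m)" using sub(1) by (simp add: csubspace_def)
    ultimately show ?case by blast
  next
    case (Suc d)
    obtain p where p: "p \<in> W (int m)" "(\<lambda>x. q x - (N ^^ m) p x) \<in> W (- int m - 1)"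
      using surj[OF Suc.prems(1)] by blast
    have "(\<lambda>x. q x - (N ^^ m) p x) \<in> (N ^^ Suc m) ` W (int (Suc m))"
    proof (rule Suc.IH)
      have "- int m - 1 = - int (Suc m)" by simp
      then show "(\<lambda>x. q x - (N ^^ m) p x) \<in> W (- int (Suc m))" using p(2) by (simp only:)
      show "W (- int (Suc m + d)) \<subseteq> {\<lambda>_. 0}" using Suc.prems(2) by simp
    qed
    then obtain p' where p': "p' \<in> W (int (Suc m))" "(\<lambda>x. q x - (N ^^ m) p x) = (N ^^ Suc m) p'"
      by blast
    have Np': "N p' \<in> W (int m)"
      using N[of "int (Suc m)"] p'(1) monoD[OF le, of "int (Suc m) - 2" "int m"] by auto
    have "(\<lambda>x. 1 * p x + 1 * N p' x) \<in> W (int m)"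
      using sub(1)[of "int m"] p(1) Np' unfolding csubspace_def by blast
    moreover have "(N ^^ m) (\<lambda>x. p x + N p' x) = q"
    proof -
      have "(N ^^ m) (\<lambda>x. p x + N p' x) = (\<lambda>x. (N ^^ m) p x + (N ^^ Suc m) p' x)"
        using p(1) Np' sub(2) by (subst linm) (auto simp: funpow_swap1)
      also have "\<dots> = q" unfolding p'(2)[symmetric] by simp
      finally show ?thesis .
    qed
    ultimately show ?case by force
  qed
  show "W (- int m) \<subseteq> (N ^^ m) ` W (int m)"
  proof
    fix q assume "q \<in> W (- int m)"
    moreover have "W (- int (m + nat (- M))) \<subseteq> {\<lambda>_. 0}"
      using monoD[OF le, of "- int (m + nat (- M))" M] M by simp
    ultimately show "q \<in> (N ^^ m) ` W (int m)" by (rule *)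
  qed
  show "(N ^^ m) ` W (int m) \<subseteq> W (- int m)"
    using weight_filtration_power[OF W, of _ "int m" m] by auto
qed

text \<open>An element whose image under \<open>N ^^ (m + 1)\<close> has weight at most \<open>-m - 2\<close> can be moved down from any
  weight above \<open>m\<close>, because \<open>N ^^ M\<close> is injective on the graded piece of weight \<open>M\<close>.\<close>

lemma weight_filtration_nonneg:
  assumes W: "is_weight_filtration V N W"
  shows "W (int m) = {p\<in>V. (N ^^ Suc m) p \<in> W (- int (m + 2))}"
proof
  have le: "mono W" using W unfolding is_weight_filtration_def by blast
  have inj: "p \<in> W (int m - 1)" if "p \<in> W (int m)" "(N ^^ m) p \<in> W (- int m - 1)" for m p
    using W that unfolding is_weight_filtration_def by blast
  obtain T where T: "W T = V"
    using W unfolding is_weight_filtration_def by blast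
  have *: "p \<in> W (int m)" if "p \<in> W (int (m + d))" "(N ^^ Suc m) p \<in> W (- int (m + 2))" for d p
    using that(1)
  proof (induction d)
    case (Suc d)
    have "(N ^^ d) ((N ^^ Suc m) p) \<in> W (- int (m + 2) - 2 * int d)"
      by (rule weight_filtration_power[OF W that(2)])
    then have "(N ^^ (m + Suc d)) p \<in> W (- int (m + 2) - 2 * int d)"
      by (simp add: funpow_add[symmetric, THEN fun_cong, simplified] add.commute flip: funpow.simps(2) del: funpow.simps)
    then have "(N ^^ (m + Suc d)) p \<in> W (- int (m + Suc d) - 1)"
      using monoD[OF le, of "- int (m + 2) - 2 * int d" "- int (m + Suc d) - 1"] by auto
    from inj[OF Suc.prems this] show ?case by (intro Suc.IH) simp
  qed simp
  show "{p\<in>V. (N ^^ Suc m) p \<in> W (- int (m + 2))} \<subseteq> W (int m)"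
  proof clarify
    fix p assume "p \<in> V" "(N ^^ Suc m) p \<in> W (- int (m + 2))"
    moreover have "p \<in> W (int (m + nat T))"
      using monoD[OF le, of T "int (m + nat T)"] T \<open>p \<in> V\<close> by auto
    ultimately show "p \<in> W (int m)" by (intro *)
  qed
  show "W (int m) \<subseteq> {p\<in>V. (N ^^ Suc m) p \<in> W (- int (m + 2))}"
  proof
    fix p assume p: "p \<in> W (int m)"
    have "p \<in> V" using W p unfolding is_weight_filtration_def by blast
    moreover have "(N ^^ Suc m) p \<in> W (- int (m + 2))"
      using weight_filtration_power[OF W p, of "Suc m"] by (simp add: algebra_simps)
    ultimately show "p \<in> {p\<in>V. (N ^^ Suc m) p \<in> W (- int (m + 2))}" by simp
  qed
qed

text \<open>The preceding two lemmas express \<open>W\<^sub>m\<close> for \<open>m \<ge> 0\<close> through \<open>W\<^sub>-\<^sub>m\<^sub>-\<^sub>2\<close>, hence through \<open>W\<^sub>m\<^sub>+\<^sub>2\<close>. So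
  filtrations that agree in high weights agree in all weights.\<close>

lemma weight_filtration_unique:
  assumes W: "is_weight_filtration V N W" and W': "is_weight_filtration V N W'"
    and lin: "\<And>p q. p \<in> V \<Longrightarrow> q \<in> V \<Longrightarrow> N (\<lambda>x. p x + q x) = (\<lambda>x. N p x + N q x)"
  shows "W = W'"
proof -
  have top: "\<exists>T. \<forall>m\<ge>T. W m = V" if W: "is_weight_filtration V N W" for W
  proof -
    obtain T where "W T = V" using W unfolding is_weight_filtration_def by blast
    moreover have "mono W" "\<And>m. W m \<subseteq> V" using W unfolding is_weight_filtration_def by blast+
    ultimately have "\<forall>m\<ge>T. W m = V" by (metis monoD subset_antisym)
    then show ?thesis by blast
  qed
  obtain T T' where T: "\<forall>m\<ge>T. W m = V" "\<forall>m\<ge>T'. W' m = V"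
    using top[OF W] top[OF W'] by blast
  have nonneg: "W (int m) = W' (int m)" for m
  proof (induction "nat (max T T') - m" arbitrary: m rule: less_induct)
    case less
    show ?case
    proof (cases "int m \<ge> max T T'")
      case True
      then show ?thesis using T by simp
    next
      case False
      then have "W (int (m + 2)) = W' (int (m + 2))" by (intro less) auto
      then have "W (- int (m + 2)) = W' (- int (m + 2))"
        by (simp only: weight_filtration_neg[OF W lin] weight_filtration_neg[OF W' lin])
      then show ?thesis
        by (simp only: weight_filtration_nonneg[OF W] weight_filtration_nonneg[OF W'])
    qed
  qed
  show ?thesis
  proof
    fix m :: int
    show "W m = W' m"
    proof (cases m rule: int_cases2)
      case (nonneg n)
      then show ?thesis using \<open>\<And>m. W (int m) = W' (int m)\<close> by simp
    next
      case (nonpos n)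
      then show ?thesis using \<open>\<And>m. W (int m) = W' (int m)\<close>
        by (simp add: weight_filtration_neg[OF W lin] weight_filtration_neg[OF W' lin])
    qed
  qed
qed

text \<open>On \<open>(x, t)\<close>, the residue \<open>N = t \<partial>/\<partial>x\<^sub>1\<close> lowers this weight by two.\<close>

definition cusp_wt :: "'n::finite option \<Rightarrow> int" where
  "cusp_wt j = (case j of None \<Rightarrow> -1 | Some i \<Rightarrow> if i = i\<^sub>1 then 1 else 0)"

lemma cusp_wt_simps [simp]:
  "cusp_wt None = -1" "cusp_wt (Some i\<^sub>1) = 1" "i \<noteq> i\<^sub>1 \<Longrightarrow> cusp_wt (Some i) = 0"
  by (simp_all add: cusp_wt_def)

lemma cusp_wt_sum: "(\<Sum>j\<in>UNIV. cusp_wt j * int (\<alpha> j)) = int (\<alpha> (Some i\<^sub>1)) - int (\<alpha> None)"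
  by (simp add: sum_option cusp_wt_def if_distrib[of "\<lambda>x. x * _"] sum.delta cong: if_cong)

text \<open>The effect of \<open>N ^^ m\<close> on exponents. Where \<open>\<alpha> (Some i\<^sub>1) < m\<close> it is meaningless, but then \<open>N ^^ m\<close>
  annihilates the monomial.\<close>

definition cusp_shift :: "nat \<Rightarrow> ('n::finite option \<Rightarrow> nat) \<Rightarrow> 'n option \<Rightarrow> nat" where
  "cusp_shift m \<alpha> = \<alpha>(Some i\<^sub>1 := \<alpha> (Some i\<^sub>1) - m, None := \<alpha> None + m)"

lemma mpow_cusp_shift:
  "u $ None * mpow (\<alpha>(Some i\<^sub>1 := \<alpha> (Some i\<^sub>1) - 1)) u = mpow (cusp_shift 1 \<alpha>) u"
  unfolding var_mult_mpow cusp_shift_def by (rule arg_cong[of _ _ "\<lambda>\<alpha>. mpow \<alpha> u"]) auto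

lemma res_higgs_mpow:
  "res_higgs (mpow \<alpha>) = (\<lambda>u. of_nat (\<alpha> (Some i\<^sub>1)) * mpow (cusp_shift 1 \<alpha>) u)"
proof
  fix u :: "complex^('a option)"
  have "mpow \<alpha> \<in> wpoly (\<lambda>_. 0) (sum \<alpha> UNIV) 0"
    by (intro mpow_wpoly) (simp add: degs_def)
  from higgs_eq[OF this]
  show "res_higgs (mpow \<alpha>) u = of_nat (\<alpha> (Some i\<^sub>1)) * mpow (cusp_shift 1 \<alpha>) u"
    by (simp add: res_higgs_def partial_mpow axis_def if_distrib[of "\<lambda>x. x * _"] sum.delta
        mpow_cusp_shift[symmetric, simplified] cong: if_cong)
qed

lemma res_higgs_sym_power: "p \<in> hpoly k \<Longrightarrow> (res_higgs ^^ m) p \<in> hpoly k"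
  by (induction m) (auto simp: res_higgs_def intro: higgs_wpoly)

lemma res_higgs_add:
  assumes "p \<in> hpoly k" "q \<in> hpoly k"
  shows "(res_higgs ^^ m) (\<lambda>u. p u + a * q u) = (\<lambda>u. (res_higgs ^^ m) p u + a * (res_higgs ^^ m) q u)"
proof (induction m)
  case (Suc m)
  show ?case
    using higgs_lincomb[OF res_higgs_sym_power[OF assms(1), of m] res_higgs_sym_power[OF assms(2), of m], of _ 1 a]
    by (simp add: Suc fun_eq_iff) (simp add: res_higgs_def)
qed simp

lemma res_higgs_0 [simp]: "(res_higgs ^^ m) (\<lambda>_. 0) = (\<lambda>_. 0)"
  by (induction m) (auto simp: res_higgs_def)

lemma res_higgs_power_mpow:
  "(res_higgs ^^ m) (mpow \<alpha>) = (\<lambda>u. of_nat (\<Prod>r<m. \<alpha> (Some i\<^sub>1) - r) * mpow (cusp_shift m \<alpha>) u)"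
proof (induction m)
  case 0
  then show ?case by (simp add: cusp_shift_def)
next
  case (Suc m)
  let ?c = "of_nat (\<Prod>r<m. \<alpha> (Some i\<^sub>1) - r) :: complex"
  have w: "mpow (cusp_shift m \<alpha>) \<in> wpoly (\<lambda>_. 0) (sum (cusp_shift m \<alpha>) UNIV) 0"
    by (intro mpow_wpoly) (simp add: degs_def)
  have "(res_higgs ^^ Suc m) (mpow \<alpha>) = res_higgs (\<lambda>u. ?c * mpow (cusp_shift m \<alpha>) u)"
    by (simp only: funpow.simps o_apply Suc)
  also have "\<dots> = (\<lambda>u. ?c * res_higgs (mpow (cusp_shift m \<alpha>)) u)"
    using higgs_lincomb[OF w w, of _ ?c 0] by (simp add: res_higgs_def fun_eq_iff)
  also have "\<dots> = (\<lambda>u. of_nat (\<Prod>r<Suc m. \<alpha> (Some i\<^sub>1) - r) * mpow (cusp_shift (Suc m) \<alpha>) u)"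
    unfolding res_higgs_mpow by (simp add: cusp_shift_def mult_ac)
  finally show ?case .
qed

lemma sum_cusp_shift: "m \<le> \<alpha> (Some i\<^sub>1) \<Longrightarrow> sum (cusp_shift m \<alpha>) UNIV = sum \<alpha> UNIV"
proof -
  assume m: "m \<le> \<alpha> (Some i\<^sub>1)"
  have "(\<Sum>i\<in>UNIV. cusp_shift m \<alpha> (Some i)) + m = (\<Sum>i\<in>UNIV. \<alpha> (Some i))"
    using m by (simp add: cusp_shift_def sum.remove[of UNIV i\<^sub>1])
  then show ?thesis by (simp add: sum_option) (simp add: cusp_shift_def)
qed

text \<open>\<open>N ^^ m\<close> maps the monomials of weight \<open>m\<close> bijectively to those of weight \<open>-m\<close>, up to nonzero
  factors: in weight \<open>m\<close> the exponent of \<open>x\<^sub>1\<close> is at least \<open>m\<close>, and in weight \<open>-m\<close> that of \<open>t\<close> is.\<close>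

lemma cusp_weight_filtration:
  "is_weight_filtration (sym_power k) res_higgs (\<lambda>m. wpoly cusp_wt k m)"
  unfolding is_weight_filtration_def sym_power_wpoly
proof (intro conjI allI ballI impI)
  fix m
  show "csubspace (wpoly cusp_wt k m)"
    unfolding csubspace_def by (auto intro: wpoly_lincomb)
  show "wpoly cusp_wt k m \<subseteq> hpoly k"
    using wpoly_sym_power by blast
next
  show "mono (\<lambda>m. wpoly cusp_wt k m)"
    by (intro monoI subsetI) (rule wpoly_le)
next
  \<comment> \<open>All weights are at least \<open>-k\<close>.\<close>
  have "degs cusp_wt k (- int k - 1) = ({} :: ('a option \<Rightarrow> nat) set)"
  proof -
    have False if "\<alpha> \<in> degs cusp_wt k (- int k - 1)" for \<alpha> :: "'a option \<Rightarrow> nat"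
      using that le_degree[of \<alpha> k None] by (simp add: degs_def cusp_wt_sum)
    then show ?thesis by blast
  qed
  then show "\<exists>m. wpoly cusp_wt k m = {\<lambda>_ :: complex^('a option). 0}"
    by (intro exI[of _ "- int k - 1"]) (auto simp: wpoly_def)
next
  have "degs cusp_wt k (int k) = (degs (\<lambda>_. 0) k 0 :: ('a option \<Rightarrow> nat) set)"
  proof -
    have *: "int (\<alpha> (Some i\<^sub>1)) - int (\<alpha> None) \<le> int k" if "sum \<alpha> UNIV = k" for \<alpha> :: "'a option \<Rightarrow> nat"
      using le_degree[OF that, of "Some i\<^sub>1"] by simp
    show ?thesis
    proof (intro Set.set_eqI iffI)
      fix \<alpha> :: "'a option \<Rightarrow> nat"
      assume "\<alpha> \<in> degs (\<lambda>_. 0) k 0"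
      then show "\<alpha> \<in> degs cusp_wt k (int k)"
        unfolding degs_def cusp_wt_sum using *[of \<alpha>] by (simp only: mem_Collect_eq)
    qed (simp add: degs_def)
  qed
  then show "\<exists>m. wpoly cusp_wt k m = (hpoly k :: (complex^('a option) \<Rightarrow> complex) set)"
    by (intro exI[of _ "int k"]) (simp add: wpoly_def)
next
  fix m
  show "res_higgs ` wpoly cusp_wt k m \<subseteq> (wpoly cusp_wt k (m - 2) :: (complex^('a option) \<Rightarrow> complex) set)"
  proof clarify
    fix p :: "complex^('a option) \<Rightarrow> complex" assume p: "p \<in> wpoly cusp_wt k m"
    show "res_higgs p \<in> wpoly cusp_wt k (m - 2)"
      unfolding res_higgs_def by (rule higgs_wpoly[OF p]) (simp add: axis_def split: if_splits)
  qed
next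
  fix m :: nat and p :: "complex^('a option) \<Rightarrow> complex"
  assume p: "p \<in> wpoly cusp_wt k (int m)" and Np: "(res_higgs ^^ m) p \<in> wpoly cusp_wt k (- int m - 1)"
  show "p \<in> wpoly cusp_wt k (int m - 1)"
  proof (rule wpolyI_coef[OF wpoly_sym_power[OF p]])
    fix \<alpha> :: "'a option \<Rightarrow> nat"
    assume \<alpha>: "\<alpha> \<in> degrees k" "int m - 1 < (\<Sum>j\<in>UNIV. cusp_wt j * int (\<alpha> j))"
    show "coef k \<alpha> p = 0"
    proof (cases "int m < (\<Sum>j\<in>UNIV. cusp_wt j * int (\<alpha> j))")
      case True
      then show ?thesis using coef_eq_0[OF p \<alpha>(1)] by blast
    next
      case False
      then have w: "int (\<alpha> (Some i\<^sub>1)) - int (\<alpha> None) = int m" using \<alpha>(2) by (simp add: cusp_wt_sum)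
      then have m: "m \<le> \<alpha> (Some i\<^sub>1)" by linarith
      \<comment> \<open>In weight \<open>m\<close>, a coefficient of \<open>p\<close> is recovered from the one of \<open>(N ^^ m) p\<close> at the shifted exponent.\<close>
      have sh: "cusp_shift m \<alpha> \<in> degrees k" using \<alpha>(1) sum_cusp_shift[of m \<alpha>] m by simp
      have "coef k (cusp_shift m \<alpha>) ((res_higgs ^^ m) p) = of_nat (\<Prod>r<m. \<alpha> (Some i\<^sub>1) - r) * coef k \<alpha> p"
        using wpoly_sym_power[OF p]
      proof (induction rule: wpoly_induct)
        case zero
        then show ?case by simp
      next
        case (mpow \<beta>)
        then have \<beta>: "\<beta> \<in> degrees k" by (simp add: degs_def)
        show ?case
        proof (cases "m \<le> \<beta> (Some i\<^sub>1)")
          case True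
          have eq: "cusp_shift m \<alpha> = cusp_shift m \<beta> \<longleftrightarrow> \<alpha> = \<beta>"
          proof
            assume "cusp_shift m \<alpha> = cusp_shift m \<beta>"
            then have *: "cusp_shift m \<alpha> j = cusp_shift m \<beta> j" for j by simp
            show "\<alpha> = \<beta>"
            proof
              fix j show "\<alpha> j = \<beta> j"
                using *[of j] m True by (auto simp: cusp_shift_def split: if_splits)
            qed
          qed simp
          have "cusp_shift m \<beta> \<in> degrees k" using \<beta> sum_cusp_shift[of m \<beta>] True by simp
          then show ?thesis
            using sh \<alpha>(1) \<beta> by (auto simp: res_higgs_power_mpow coef_scale coef_mpow_degrees eq)
        next
          case False
          then have z: "(\<Prod>r<m. \<beta> (Some i\<^sub>1) - r) = 0"
            by (intro prod_zero) auto
          have "\<alpha> \<noteq> \<beta>" using False m by auto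
          then have "coef k \<alpha> (mpow \<beta>) = 0" using \<alpha>(1) \<beta> coef_mpow_degrees[of \<alpha> k \<beta>] by simp
          then show ?thesis
            by (simp only: res_higgs_power_mpow z of_nat_0 mult_zero_left mult_zero_right coef_zero)
        qed
      next
        case (add p q a)
        then show ?case
          by (simp add: res_higgs_add[OF add(1,2)] coef_add coef_scale algebra_simps)
      qed
      moreover have "coef k (cusp_shift m \<alpha>) ((res_higgs ^^ m) p) = 0"
        using w m by (intro coef_eq_0[OF Np sh]) (simp add: cusp_wt_sum, simp add: cusp_shift_def)
      moreover have "(\<Prod>r<m. \<alpha> (Some i\<^sub>1) - r) \<noteq> 0" using m by simp
      ultimately show ?thesis by (simp del: of_nat_prod)
    qed
  qed
next
  fix m :: nat and q :: "complex^('a option) \<Rightarrow> complex"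
  assume "q \<in> wpoly cusp_wt k (- int m)"
  then show "\<exists>p\<in>wpoly cusp_wt k (int m). (\<lambda>x. q x - (res_higgs ^^ m) p x) \<in> wpoly cusp_wt k (- int m - 1)"
  proof (induction rule: wpoly_induct)
    case zero
    then show ?case by (intro bexI[of _ "\<lambda>_. 0"]) auto
  next
    case (mpow \<alpha>)
    show ?case
    proof (cases "int (\<alpha> (Some i\<^sub>1)) - int (\<alpha> None) = - int m")
      case False
      then show ?thesis using mpow
        by (intro bexI[of _ "\<lambda>_. 0"]) (auto intro!: mpow_wpoly simp: degs_def cusp_wt_sum)
    next
      case True
      \<comment> \<open>The monomial that \<open>N ^^ m\<close> maps to a multiple of \<open>mpow \<alpha>\<close>.\<close>
      define \<beta> where "\<beta> = \<alpha>(Some i\<^sub>1 := \<alpha> (Some i\<^sub>1) + m, None := \<alpha> None - m)"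
      have sh: "cusp_shift m \<beta> = \<alpha>"
        using True by (auto simp: fun_eq_iff \<beta>_def cusp_shift_def)
      have "sum \<beta> UNIV = k"
        using sum_cusp_shift[of m \<beta>] mpow by (simp add: sh degs_def) (simp add: \<beta>_def)
      then have "\<beta> \<in> degs cusp_wt k (int m)"
        using True by (auto simp: degs_def cusp_wt_sum) (simp add: \<beta>_def)
      then have b: "mpow \<beta> \<in> wpoly cusp_wt k (int m)" by (rule mpow_wpoly)
      let ?c = "of_nat (\<Prod>r<m. \<beta> (Some i\<^sub>1) - r) :: complex"
      have c: "?c \<noteq> 0" unfolding of_nat_eq_0_iff by (simp add: \<beta>_def)
      have "(res_higgs ^^ m) (\<lambda>u. 1 / ?c * mpow \<beta> u) = (\<lambda>u. 1 / ?c * (res_higgs ^^ m) (mpow \<beta>) u)"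
        using res_higgs_add[OF _ wpoly_sym_power[OF b], of "\<lambda>_. 0" m "1 / ?c"] by simp
      also have "\<dots> = mpow \<alpha>"
        unfolding res_higgs_power_mpow sh using c by (simp add: fun_eq_iff)
      finally show ?thesis
        by (intro bexI[of _ "\<lambda>u. 1 / ?c * mpow \<beta> u"] wpoly_scale b) simp
    qed
  next
    case (add q q' a)
    obtain p where p: "p \<in> wpoly cusp_wt k (int m)" "(\<lambda>x. q x - (res_higgs ^^ m) p x) \<in> wpoly cusp_wt k (- int m - 1)"
      using add by blast
    obtain p' where p': "p' \<in> wpoly cusp_wt k (int m)" "(\<lambda>x. q' x - (res_higgs ^^ m) p' x) \<in> wpoly cusp_wt k (- int m - 1)"
      using add by blast
    show ?case
    proof (intro bexI[of _ "\<lambda>u. p u + a * p' u"])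
      show "(\<lambda>u. p u + a * p' u) \<in> wpoly cusp_wt k (int m)"
        by (intro wpoly_add wpoly_scale p p')
      have "(\<lambda>x. (q x - (res_higgs ^^ m) p x) + a * (q' x - (res_higgs ^^ m) p' x)) \<in> wpoly cusp_wt k (- int m - 1)"
        by (intro wpoly_add wpoly_scale p p')
      then show "(\<lambda>x. q x + a * q' x - (res_higgs ^^ m) (\<lambda>u. p u + a * p' u) x) \<in> wpoly cusp_wt k (- int m - 1)"
        by (simp add: res_higgs_add[OF wpoly_sym_power[OF p(1)] wpoly_sym_power[OF p'(1)]] algebra_simps)
    qed
  qed
qed

lemma weight_filtration_wpoly: "weight_filtration k m = wpoly cusp_wt k m"
proof -
  have lin: "res_higgs (\<lambda>u. p u + q u) = (\<lambda>u. res_higgs p u + res_higgs q u)"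
    if "p \<in> sym_power k" "q \<in> sym_power k" for p q :: "complex^('a option) \<Rightarrow> complex"
    using res_higgs_add[of p k q 1 1] that by (simp add: sym_power_wpoly)
  have "weight_filtration k = (\<lambda>m. wpoly cusp_wt k m :: (complex^('a option) \<Rightarrow> complex) set)"
    unfolding weight_filtration_def
  proof (rule the_equality)
    show "is_weight_filtration (sym_power k) res_higgs (\<lambda>m. wpoly cusp_wt k m)"
      by (rule cusp_weight_filtration)
    show "W = (\<lambda>m. wpoly cusp_wt k m)" if "is_weight_filtration (sym_power k) res_higgs W"
      for W :: "int \<Rightarrow> (complex^('a option) \<Rightarrow> complex) set"
      by (rule weight_filtration_unique[OF that cusp_weight_filtration lin])
  qed
  then show ?thesis by simp
qed

section \<open>Alternating forms\<close>

definition clinear_map :: "(complex^'n::finite \<Rightarrow> complex^'n) \<Rightarrow> bool" where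
  "clinear_map L \<longleftrightarrow> (\<forall>a v b w. L (a *s v + b *s w) = a *s L v + b *s L w)"

lemma csubspace_wpoly: "csubspace (wpoly \<omega> k m)"
  unfolding csubspace_def by (auto intro: wpoly_lincomb)

lemma csubspaceD:
  assumes "csubspace V"
  shows "(\<lambda>_. 0) \<in> V" "p \<in> V \<Longrightarrow> q \<in> V \<Longrightarrow> (\<lambda>x. a * p x + b * q x) \<in> V"
  using assms unfolding csubspace_def by auto

lemma alt_len: "f \<in> alt_forms i V \<Longrightarrow> length ws \<noteq> i \<Longrightarrow> f ws = (\<lambda>_. 0)"
  by (simp add: alt_forms_def)

lemma alt_nd: "f \<in> alt_forms i V \<Longrightarrow> \<not> distinct ws \<Longrightarrow> f ws = (\<lambda>_. 0)"
  by (simp add: alt_forms_def)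

lemma alt_val: "f \<in> alt_forms i V \<Longrightarrow> (\<lambda>_. 0) \<in> V \<Longrightarrow> f ws \<in> V"
  by (cases "length ws = i") (auto simp: alt_forms_def)

text \<open>Lists of the wrong length are harmless here: the form vanishes on them.\<close>

lemma alt_lin:
  assumes "f \<in> alt_forms i V"
  shows "f (xs @ (a *s v + b *s w) # ys) u = a * f (xs @ v # ys) u + b * f (xs @ w # ys) u"
proof (cases "length (xs @ v # ys) = i")
  case True
  then have "length (xs @ v # ys) = i" "length xs < i" by auto
  then have "f ((xs @ v # ys)[length xs := a *s v + b *s w]) u
     = a * f ((xs @ v # ys)[length xs := v]) u + b * f ((xs @ v # ys)[length xs := w]) u"
    using assms unfolding alt_forms_def by blast
  then show ?thesis by simp
next
  case False
  then show ?thesis using assms by (simp add: alt_len)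
qed

lemma alt_lin_Cons:
  "f \<in> alt_forms i V \<Longrightarrow> f ((a *s v + b *s w) # ys) u = a * f (v # ys) u + b * f (w # ys) u"
  using alt_lin[of f i V "[]"] by simp

lemma alt_formsI:
  assumes "\<And>ws. length ws \<noteq> i \<Longrightarrow> f ws = (\<lambda>_. 0)"
    and "\<And>ws. length ws = i \<Longrightarrow> f ws \<in> V"
    and "\<And>xs ys a v b w u. length xs + length ys + 1 = i \<Longrightarrow>
       f (xs @ (a *s v + b *s w) # ys) u = a * f (xs @ v # ys) u + b * f (xs @ w # ys) u"
    and "\<And>ws. length ws = i \<Longrightarrow> \<not> distinct ws \<Longrightarrow> f ws = (\<lambda>_. 0)"
  shows "f \<in> alt_forms i V"
  unfolding alt_forms_def
proof (intro CollectI conjI allI impI)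
  fix ws :: "(complex^'a) list" and l a v b w u
  assume "length ws = i" "l < i"
  then show "f (ws[l := a *s v + b *s w]) u = a * f (ws[l := v]) u + b * f (ws[l := w]) u"
    by (simp add: upd_conv_take_nth_drop assms(3))
next
  fix ws :: "(complex^'a) list"
  assume "\<not> distinct ws"
  then show "f ws = (\<lambda>_. 0)" using assms(1,4) by (cases "length ws = i") auto
qed (use assms in auto)

lemma alt_mono: "f \<in> alt_forms i V \<Longrightarrow> (\<And>ws. length ws = i \<Longrightarrow> f ws \<in> V') \<Longrightarrow> f \<in> alt_forms i V'"
  by (simp add: alt_forms_def)

text \<open>Expand the form on a list with the entry \<open>v + w\<close> in both places.\<close>

lemma alt_swap:
  assumes "f \<in> alt_forms i V"
  shows "f (xs @ v # w # ys) u = - f (xs @ w # v # ys) u"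
proof -
  have s: "f (xs @ (v + w) # z # ys) u = f (xs @ v # z # ys) u + f (xs @ w # z # ys) u" for z
    using alt_lin[OF assms, of xs 1 v 1 w "z # ys" u] by simp
  have t: "f (xs @ z # (v + w) # ys) u = f (xs @ z # v # ys) u + f (xs @ z # w # ys) u" for z
    using alt_lin[OF assms, of "xs @ [z]" 1 v 1 w ys u] by simp
  have nd: "f (xs @ z # z # ys) u = 0" for z
    using alt_nd[OF assms, of "xs @ z # z # ys"] by simp
  have "f (xs @ (v + w) # (v + w) # ys) u = f (xs @ v # w # ys) u + f (xs @ w # v # ys) u"
    unfolding s t by (simp add: nd)
  then show ?thesis by (metis nd eq_neg_iff_add_eq_0)
qed

lemma alt_move:
  assumes "f \<in> alt_forms i V"
  shows "f (xs @ v # ys @ zs) u = (-1) ^ length ys * f (xs @ ys @ v # zs) u"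
proof (induction ys arbitrary: xs)
  case (Cons y ys)
  have "f (xs @ v # (y # ys) @ zs) u = - f ((xs @ [y]) @ v # ys @ zs) u"
    using alt_swap[OF assms, of xs v y "ys @ zs" u] by simp
  also have "\<dots> = (-1) ^ length (y # ys) * f (xs @ (y # ys) @ v # zs) u"
    unfolding Cons by simp
  finally show ?case .
qed simp

lemma alt_contract:
  assumes "f \<in> alt_forms (Suc i) V"
  shows "(\<lambda>ws. f (w # ws)) \<in> alt_forms i V"
proof (rule alt_formsI)
  fix xs ys a v b w' u
  show "f (w # xs @ (a *s v + b *s w') # ys) u = a * f (w # xs @ v # ys) u + b * f (w # xs @ w' # ys) u"
    using alt_lin[OF assms, of "w # xs"] by simp
qed (use assms in \<open>auto simp: alt_forms_def\<close>)

lemma alt_forms_lincomb: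
  assumes "f \<in> alt_forms i V" "h \<in> alt_forms i V" "csubspace V"
  shows "(\<lambda>ws u. a * f ws u + b * h ws u) \<in> alt_forms i V"
proof (rule alt_formsI)
  fix ws :: "(complex^'a) list"
  show "length ws \<noteq> i \<Longrightarrow> (\<lambda>u. a * f ws u + b * h ws u) = (\<lambda>_. 0)"
    using assms by (simp add: alt_len)
  show "\<not> distinct ws \<Longrightarrow> (\<lambda>u. a * f ws u + b * h ws u) = (\<lambda>_. 0)"
    using assms by (simp add: alt_nd)
  show "(\<lambda>u. a * f ws u + b * h ws u) \<in> V"
    using assms by (intro csubspaceD(2) alt_val[OF assms(1)] alt_val[OF assms(2)]) (auto intro: csubspaceD)
next
  fix xs ys c v d w u
  show "a * f (xs @ (c *s v + d *s w) # ys) u + b * h (xs @ (c *s v + d *s w) # ys) u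
     = c * (a * f (xs @ v # ys) u + b * h (xs @ v # ys) u) + d * (a * f (xs @ w # ys) u + b * h (xs @ w # ys) u)"
    by (simp add: alt_lin[OF assms(1)] alt_lin[OF assms(2)] algebra_simps)
qed

lemma alt_forms_zero: "csubspace V \<Longrightarrow> (\<lambda>_ _. 0) \<in> alt_forms i V"
  by (rule alt_formsI) (auto intro: csubspaceD)

lemma alt_forms_map:
  assumes f: "f \<in> alt_forms i V" and V: "csubspace V"
    and T: "\<And>p. p \<in> V \<Longrightarrow> T p \<in> V'"
    and lin: "\<And>p q a b. p \<in> V \<Longrightarrow> q \<in> V \<Longrightarrow> T (\<lambda>u. a * p u + b * q u) = (\<lambda>u. a * T p u + b * T q u)"
  shows "(\<lambda>ws. T (f ws)) \<in> alt_forms i V'"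
proof (rule alt_formsI)
  have T0: "T (\<lambda>_. 0) = (\<lambda>_. 0)"
    using lin[OF csubspaceD(1)[OF V] csubspaceD(1)[OF V], of 0 0] by simp
  show "length ws \<noteq> i \<Longrightarrow> T (f ws) = (\<lambda>_. 0)" for ws using f T0 by (simp add: alt_len)
  show "\<not> distinct ws \<Longrightarrow> T (f ws) = (\<lambda>_. 0)" for ws using f T0 by (simp add: alt_nd)
  show "T (f ws) \<in> V'" for ws by (intro T alt_val[OF f] csubspaceD V)
  show "T (f (xs @ (a *s v + b *s w) # ys)) u = a * T (f (xs @ v # ys)) u + b * T (f (xs @ w # ys)) u"
    for xs ys a v b w u
  proof -
    have "f (xs @ (a *s v + b *s w) # ys) = (\<lambda>u. a * f (xs @ v # ys) u + b * f (xs @ w # ys) u)"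
      by (rule ext) (rule alt_lin[OF f])
    then show ?thesis using lin alt_val[OF f csubspaceD(1)[OF V]] by simp
  qed
qed

section \<open>Wedge operators\<close>

definition wedge_op :: "('v \<Rightarrow> ('u \<Rightarrow> complex) \<Rightarrow> 'u \<Rightarrow> complex) \<Rightarrow> ('v list \<Rightarrow> 'u \<Rightarrow> complex) \<Rightarrow> 'v list \<Rightarrow> 'u \<Rightarrow> complex" where
  "wedge_op \<Theta> f ws u = (\<Sum>l<length ws. (-1) ^ l * \<Theta> (ws ! l) (f (drop_nth l ws)) u)"

lemma wedge_higgs_op: "wedge_higgs = wedge_op higgs"
  by (intro ext) (simp add: wedge_higgs_def wedge_op_def)

lemma wedge_dlog_op: "wedge_dlog = wedge_op (\<lambda>w p u. w $ i\<^sub>1 * p u)"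
  by (intro ext) (simp add: wedge_dlog_def wedge_op_def mult.assoc)

text \<open>The properties of \<open>\<Theta>\<close> under which \<open>e \<otimes> \<omega> \<mapsto> \<Theta>(e) \<and> \<omega>\<close> is defined on alternating forms. Both the
  differential of the Higgs complex and multiplication by \<open>dz\<^sub>1/z\<^sub>1\<close> are of this form.\<close>

definition form_op :: "('u \<Rightarrow> complex) set \<Rightarrow> (complex^'n::finite \<Rightarrow> ('u \<Rightarrow> complex) \<Rightarrow> 'u \<Rightarrow> complex) \<Rightarrow> bool" where
  "form_op V \<Theta> \<longleftrightarrow> csubspace V \<and>
     (\<forall>w p q a b. p \<in> V \<longrightarrow> q \<in> V \<longrightarrow> \<Theta> w (\<lambda>u. a * p u + b * q u) = (\<lambda>u. a * \<Theta> w p u + b * \<Theta> w q u)) \<and>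
     (\<forall>p a v b w. p \<in> V \<longrightarrow> \<Theta> (a *s v + b *s w) p = (\<lambda>u. a * \<Theta> v p u + b * \<Theta> w p u))"

lemma form_op_higgs: "form_op (wpoly \<omega> k m) higgs"
  unfolding form_op_def
  by (auto simp: csubspace_wpoly fun_eq_iff higgs_lincomb higgs_linear)

lemma form_op_dlog: "csubspace V \<Longrightarrow> form_op V (\<lambda>w p u. w $ i\<^sub>1 * p u)"
  unfolding form_op_def by (auto simp: fun_eq_iff algebra_simps)

lemma drop_nth_Cons [simp]:
  "drop_nth 0 (w # ws) = ws" "drop_nth (Suc l) (w # ws) = w # drop_nth l ws"
  by (simp_all add: drop_nth_def)

lemma length_drop_nth: "l < length ws \<Longrightarrow> length (drop_nth l ws) = length ws - 1"
  by (simp add: drop_nth_def)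

lemma map_drop_nth: "map L (drop_nth l ws) = drop_nth l (map L ws)"
  by (simp add: drop_nth_def take_map drop_map)

lemma wedge_op_Nil [simp]: "wedge_op \<Theta> f [] = (\<lambda>_. 0)"
  by (simp add: wedge_op_def fun_eq_iff)

text \<open>The interior product by the first argument anticommutes with the wedge operator, up to the
  operator itself. This recursion reduces most properties of wedge operators to inductions on the
  list of arguments.\<close>

lemma wedge_op_Cons: "wedge_op \<Theta> f (w # ws) u = \<Theta> w (f ws) u - wedge_op \<Theta> (\<lambda>vs. f (w # vs)) ws u"
  by (simp add: wedge_op_def sum.lessThan_Suc_shift sum_negf del: sum.lessThan_Suc)

lemma form_opD:
  assumes "form_op V \<Theta>"
  shows "csubspace V"
    and "p \<in> V \<Longrightarrow> q \<in> V \<Longrightarrow> \<Theta> w (\<lambda>u. a * p u + b * q u) = (\<lambda>u. a * \<Theta> w p u + b * \<Theta> w q u)"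
    and "p \<in> V \<Longrightarrow> \<Theta> (a *s v + b *s w) p = (\<lambda>u. a * \<Theta> v p u + b * \<Theta> w p u)"
  using assms unfolding form_op_def by blast+

lemma form_op_zero:
  assumes "form_op V \<Theta>"
  shows "\<Theta> w (\<lambda>_. 0) = (\<lambda>_. 0)"
  using form_opD(2)[OF assms, of "\<lambda>_. 0" "\<lambda>_. 0" w 0 0] csubspaceD(1)[OF form_opD(1)[OF assms]] by simp

lemma wedge_op_lincomb:
  assumes "form_op V \<Theta>" "\<And>ws. f ws \<in> V" "\<And>ws. h ws \<in> V"
  shows "wedge_op \<Theta> (\<lambda>ws u. a * f ws u + b * h ws u) ws u = a * wedge_op \<Theta> f ws u + b * wedge_op \<Theta> h ws u"
proof -
  have "\<Theta> w (\<lambda>u. a * f ws u + b * h ws u) = (\<lambda>u. a * \<Theta> w (f ws) u + b * \<Theta> w (h ws) u)" for w ws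
    using form_opD(2)[OF assms] .
  then show ?thesis
    by (simp add: wedge_op_def sum.distrib sum_distrib_left algebra_simps)
qed

lemma wedge_op_zero: "form_op V \<Theta> \<Longrightarrow> wedge_op \<Theta> (\<lambda>_ _. 0) ws u = 0"
  by (simp add: wedge_op_def form_op_zero)

lemma wedge_op_value:
  assumes "csubspace V'" "\<And>w ws. \<Theta> w (f ws) \<in> V'"
  shows "wedge_op \<Theta> f ws \<in> V'"
  using assms(2)
proof (induction ws arbitrary: f)
  case Nil
  then show ?case using csubspaceD[OF assms(1)] by simp
next
  case (Cons w ws)
  have "(\<lambda>u. 1 * \<Theta> w (f ws) u + (-1) * wedge_op \<Theta> (\<lambda>vs. f (w # vs)) ws u) \<in> V'"
    by (intro csubspaceD(2) assms(1) Cons)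
  then show ?case by (simp add: wedge_op_Cons[abs_def])
qed

text \<open>If \<open>h\<close> vanishes as soon as \<open>v\<close> is among its arguments, only the term in which \<open>v\<close> is removed
  survives.\<close>

lemma wedge_op_insert:
  assumes "form_op V \<Theta>" "\<And>ws. v \<in> set ws \<Longrightarrow> h ws = (\<lambda>_. 0)"
  shows "wedge_op \<Theta> h (ys @ v # zs) u = (-1) ^ length ys * \<Theta> v (h (ys @ zs)) u"
  using assms(2)
proof (induction ys arbitrary: h)
  case Nil
  then have "(\<lambda>vs. h (v # vs)) = (\<lambda>_ _. 0)" by (simp add: fun_eq_iff)
  then show ?case using wedge_op_zero[OF assms(1)] by (simp add: wedge_op_Cons)
next
  case (Cons y ys)
  have "h (ys @ v # zs) = (\<lambda>_. 0)" by (rule Cons.prems) simp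
  moreover have "wedge_op \<Theta> (\<lambda>vs. h (y # vs)) (ys @ v # zs) u = (-1) ^ length ys * \<Theta> v (h (y # ys @ zs)) u"
    by (rule Cons.IH) (simp add: Cons.prems)
  ultimately show ?case by (simp add: wedge_op_Cons form_op_zero[OF assms(1)])
qed

lemma wedge_op_linear:
  assumes op: "form_op V \<Theta>" and val: "\<And>ws. f ws \<in> V"
    and lin: "\<And>xs ys a v b w. f (xs @ (a *s v + b *s w) # ys) = (\<lambda>u. a * f (xs @ v # ys) u + b * f (xs @ w # ys) u)"
  shows "wedge_op \<Theta> f (xs @ (a *s v + b *s w) # ys) u
     = a * wedge_op \<Theta> f (xs @ v # ys) u + b * wedge_op \<Theta> f (xs @ w # ys) u"
  using val lin
proof (induction xs arbitrary: f)
  case Nil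
  have "(\<lambda>vs. f ((a *s v + b *s w) # vs)) = (\<lambda>vs u. a * f (v # vs) u + b * f (w # vs) u)"
    using Nil(2)[of "[]"] by (auto simp: fun_eq_iff)
  moreover have "\<Theta> (a *s v + b *s w) (f ys) u = a * \<Theta> v (f ys) u + b * \<Theta> w (f ys) u"
    using form_opD(3)[OF op Nil(1)] by simp
  ultimately show ?case
    using wedge_op_lincomb[OF op, of "\<lambda>vs. f (v # vs)" "\<lambda>vs. f (w # vs)" a b ys u] Nil(1)
    by (simp add: wedge_op_Cons algebra_simps)
next
  case (Cons x xs)
  have "\<Theta> x (f (xs @ (a *s v + b *s w) # ys)) u = a * \<Theta> x (f (xs @ v # ys)) u + b * \<Theta> x (f (xs @ w # ys)) u"
    unfolding Cons.prems(2) using form_opD(2)[OF op Cons.prems(1) Cons.prems(1)] by simp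
  moreover have "wedge_op \<Theta> (\<lambda>vs. f (x # vs)) (xs @ (a *s v + b *s w) # ys) u
     = a * wedge_op \<Theta> (\<lambda>vs. f (x # vs)) (xs @ v # ys) u + b * wedge_op \<Theta> (\<lambda>vs. f (x # vs)) (xs @ w # ys) u"
    by (rule Cons.IH) (use Cons.prems(1) Cons.prems(2)[of "x # _"] in auto)
  ultimately show ?case by (simp add: wedge_op_Cons algebra_simps)
qed

text \<open>On a list with a repeated entry \<open>v\<close>, only the two terms in which an occurrence of \<open>v\<close> is removed
  survive, and these cancel.\<close>

lemma wedge_op_alternating:
  assumes op: "form_op V \<Theta>" and f: "f \<in> alt_forms i V" and nd: "\<not> distinct ws"
  shows "wedge_op \<Theta> f ws u = 0"
proof -
  obtain xs ys zs v where ws: "ws = xs @ [v] @ ys @ [v] @ zs"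
    using not_distinct_decomp[OF nd] by blast
  have V: "csubspace V" using op unfolding form_op_def by blast
  show ?thesis using f unfolding ws
  proof (induction xs arbitrary: f i)
    case Nil
    have "wedge_op \<Theta> (\<lambda>vs. f (v # vs)) (ys @ v # zs) u = (-1) ^ length ys * \<Theta> v (f (v # ys @ zs)) u"
      by (rule wedge_op_insert[OF op]) (rule alt_nd[OF Nil], simp)
    moreover have "\<Theta> v (f (ys @ v # zs)) u = (-1) ^ length ys * \<Theta> v (f (v # ys @ zs)) u"
    proof -
      have "f (ys @ v # zs) = (\<lambda>u. (-1) ^ length ys * f (v # ys @ zs) u + 0 * f (v # ys @ zs) u)"
        using alt_move[OF Nil, of "[]" v ys zs] by (simp add: fun_eq_iff mult.assoc[symmetric] power_mult_distrib[symmetric])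
      moreover have "f (v # ys @ zs) \<in> V" by (rule alt_val[OF Nil csubspaceD(1)[OF V]])
      ultimately show ?thesis using form_opD(2)[OF op, of "f (v # ys @ zs)" "f (v # ys @ zs)" v "(-1) ^ length ys" 0] by simp
    qed
    ultimately show ?case by (simp add: wedge_op_Cons)
  next
    case (Cons x xs)
    have "f (xs @ [v] @ ys @ [v] @ zs) = (\<lambda>_. 0)" by (rule alt_nd[OF Cons.prems]) simp
    moreover have "wedge_op \<Theta> (\<lambda>vs. f (x # vs)) (xs @ [v] @ ys @ [v] @ zs) u = 0"
    proof (cases i)
      case 0
      then have "(\<lambda>vs. f (x # vs)) = (\<lambda>_ _. 0)" using alt_len[OF Cons.prems] by (auto simp: fun_eq_iff)
      then show ?thesis using wedge_op_zero[OF op] by simp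
    next
      case (Suc i')
      show ?thesis by (rule Cons.IH, rule alt_contract) (use Cons.prems Suc in simp)
    qed
    ultimately show ?case by (simp add: wedge_op_Cons form_op_zero[OF op])
  qed
qed

lemma wedge_op_forms:
  assumes op: "form_op V \<Theta>" and f: "f \<in> alt_forms i V" and V': "csubspace V'"
    and val: "\<And>w p. p \<in> V \<Longrightarrow> \<Theta> w p \<in> V'"
  shows "wedge_op \<Theta> f \<in> alt_forms (Suc i) V'"
proof (rule alt_formsI)
  have V: "csubspace V" using op unfolding form_op_def by blast
  have fV: "f ws \<in> V" for ws by (rule alt_val[OF f csubspaceD(1)[OF V]])
  fix ws :: "(complex^'a) list"
  show "wedge_op \<Theta> f ws = (\<lambda>_. 0)" if "length ws \<noteq> Suc i"
  proof -
    have "f (drop_nth l ws) = (\<lambda>_. 0)" if "l < length ws" for l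
      using that \<open>length ws \<noteq> Suc i\<close> by (intro alt_len[OF f]) (simp add: length_drop_nth)
    then show ?thesis by (intro ext) (simp add: wedge_op_def form_op_zero[OF op])
  qed
  show "wedge_op \<Theta> f ws \<in> V'" by (intro wedge_op_value V' val fV)
  show "\<not> distinct ws \<Longrightarrow> wedge_op \<Theta> f ws = (\<lambda>_. 0)"
    using wedge_op_alternating[OF op f] by (simp add: fun_eq_iff)
  fix xs ys a v b w u
  show "wedge_op \<Theta> f (xs @ (a *s v + b *s w) # ys) u
     = a * wedge_op \<Theta> f (xs @ v # ys) u + b * wedge_op \<Theta> f (xs @ w # ys) u"
    by (rule wedge_op_linear[OF op fV]) (simp add: fun_eq_iff alt_lin[OF f])
qed

text \<open>By induction with the above recursion: interior products reduce the claim to the commutation of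
  the operators \<open>\<Theta> w\<close> among each other.\<close>

lemma wedge_op_square:
  assumes op: "form_op V \<Theta>" and val: "\<And>w p. p \<in> V \<Longrightarrow> \<Theta> w p \<in> V"
    and comm: "\<And>v w p. p \<in> V \<Longrightarrow> \<Theta> v (\<Theta> w p) = \<Theta> w (\<Theta> v p)"
    and f: "\<And>ws. f ws \<in> V"
  shows "wedge_op \<Theta> (wedge_op \<Theta> f) ws u = 0"
  using f
proof (induction ws arbitrary: f)
  case (Cons w ws)
  have V: "csubspace V" using op unfolding form_op_def by blast
  have W: "wedge_op \<Theta> f vs \<in> V" if "\<And>ws. f ws \<in> V" for f vs
    by (intro wedge_op_value V val that)
  have lin: "\<Theta> w (\<lambda>u. a * p u + b * q u) = (\<lambda>u. a * \<Theta> w p u + b * \<Theta> w q u)" if "p \<in> V" "q \<in> V" for w p q a b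
    using form_opD(2)[OF op that] .
  have 1: "\<Theta> w (wedge_op \<Theta> f ws) u = wedge_op \<Theta> (\<lambda>vs. \<Theta> w (f vs)) ws u" if "\<And>ws. f ws \<in> V" for f
    using that
  proof (induction ws arbitrary: f)
    case Nil
    then show ?case by (simp add: form_op_zero[OF op])
  next
    case (Cons x xs)
    have "wedge_op \<Theta> f (x # xs) = (\<lambda>u. 1 * \<Theta> x (f xs) u + (-1) * wedge_op \<Theta> (\<lambda>vs. f (x # vs)) xs u)"
      by (simp add: fun_eq_iff wedge_op_Cons)
    then have "\<Theta> w (wedge_op \<Theta> f (x # xs)) u = \<Theta> w (\<Theta> x (f xs)) u - \<Theta> w (wedge_op \<Theta> (\<lambda>vs. f (x # vs)) xs) u"
      using lin[of "\<Theta> x (f xs)" "wedge_op \<Theta> (\<lambda>vs. f (x # vs)) xs" w 1 "-1"] val W Cons.prems by simp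
    also have "\<dots> = \<Theta> x (\<Theta> w (f xs)) u - wedge_op \<Theta> (\<lambda>vs. \<Theta> w (f (x # vs))) xs u"
      using Cons.IH[of "\<lambda>vs. f (x # vs)"] comm Cons.prems by simp
    finally show ?case unfolding wedge_op_Cons[of \<Theta> "\<lambda>vs. \<Theta> w (f vs)"] .
  qed
  have "(\<lambda>vs. wedge_op \<Theta> f (w # vs)) = (\<lambda>vs u. 1 * \<Theta> w (f vs) u + (-1) * wedge_op \<Theta> (\<lambda>vs. f (w # vs)) vs u)"
    by (simp add: fun_eq_iff wedge_op_Cons)
  then have "wedge_op \<Theta> (\<lambda>vs. wedge_op \<Theta> f (w # vs)) ws u
     = wedge_op \<Theta> (\<lambda>vs. \<Theta> w (f vs)) ws u - wedge_op \<Theta> (wedge_op \<Theta> (\<lambda>vs. f (w # vs))) ws u"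
    using wedge_op_lincomb[OF op, of "\<lambda>vs. \<Theta> w (f vs)" "wedge_op \<Theta> (\<lambda>vs. f (w # vs))" 1 "-1" ws u]
      val W Cons.prems by simp
  moreover have "wedge_op \<Theta> (wedge_op \<Theta> (\<lambda>vs. f (w # vs))) ws u = 0"
    by (rule Cons.IH) (rule Cons.prems)
  ultimately show ?case using 1[OF Cons.prems] by (simp add: wedge_op_Cons)
qed simp

lemma higgs_scale: "p \<in> wpoly \<omega> k m \<Longrightarrow> higgs w (\<lambda>u. c * p u) = (\<lambda>u. c * higgs w p u)"
  using higgs_lincomb[of p \<omega> k m p w c 0] by (simp add: fun_eq_iff)

lemma higgs_sum:
  assumes "\<And>i. i \<in> I \<Longrightarrow> p i \<in> wpoly \<omega> k m"
  shows "higgs w (\<lambda>u. \<Sum>i\<in>I. c i * p i u) = (\<lambda>u. \<Sum>i\<in>I. c i * higgs w (p i) u)"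
  using assms
proof (induction I rule: infinite_finite_induct)
  case (insert i I)
  have "(\<lambda>u. \<Sum>i\<in>I. c i * p i u) \<in> wpoly \<omega> k m"
    by (intro wpoly_sum wpoly_scale insert) simp
  from higgs_lincomb[OF insert.prems[of i] this, of w "c i" 1] insert show ?case
    by (simp add: fun_eq_iff)
qed simp_all

lemma higgs_axis_partial:
  "p \<in> wpoly \<omega> k m \<Longrightarrow> higgs (axis i 1) p u = u $ None * partial (Some i) p u"
  by (simp add: higgs_eq axis_def if_distrib[of "\<lambda>x. x * _"] sum.delta cong: if_cong)

lemma higgs_axis:
  assumes "p \<in> wpoly \<omega> k m"
  shows "higgs w p = (\<lambda>u. \<Sum>i\<in>UNIV. w $ i * higgs (axis i 1) p u)"
  unfolding higgs_axis_partial[OF assms]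
  by (rule ext) (simp add: higgs_eq[OF assms] sum_distrib_left mult_ac)

text \<open>Partial derivatives commute, and \<open>t\<close> is a constant for them.\<close>

lemma higgs_commute:
  fixes p :: "complex^('n::finite option) \<Rightarrow> complex"
  assumes "p \<in> wpoly \<omega> k m"
  shows "higgs v (higgs w p) = higgs w (higgs v p)"
proof -
  define \<sigma> :: "('n option \<Rightarrow> nat) \<Rightarrow> 'n \<Rightarrow> 'n option \<Rightarrow> nat" where
    "\<sigma> \<alpha> i = (\<lambda>l. (\<alpha>(Some i := \<alpha> (Some i) - 1)) l + (if l = None then 1 else 0))" for \<alpha> i
  have sym: "mpow \<beta> \<in> wpoly (\<lambda>_. 0) (sum \<beta> UNIV) 0" for \<beta> :: "'n option \<Rightarrow> nat"
    by (intro mpow_wpoly) (simp add: degs_def)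
  have h: "higgs (axis i 1) (mpow \<beta>) = (\<lambda>u. of_nat (\<beta> (Some i)) * mpow (\<sigma> \<beta> i) u)" for i \<beta>
  proof
    fix u
    have "higgs (axis i 1) (mpow \<beta>) u = of_nat (\<beta> (Some i)) * (u $ None * mpow (\<beta>(Some i := \<beta> (Some i) - 1)) u)"
      by (simp add: higgs_axis_partial[OF sym] partial_mpow)
    then show "higgs (axis i 1) (mpow \<beta>) u = of_nat (\<beta> (Some i)) * mpow (\<sigma> \<beta> i) u"
      by (simp only: var_mult_mpow \<sigma>_def)
  qed
  have hh: "higgs (axis i 1) (higgs (axis j 1) (mpow \<beta>))
      = (\<lambda>u. of_nat (\<beta> (Some j)) * (of_nat (\<sigma> \<beta> j (Some i)) * mpow (\<sigma> (\<sigma> \<beta> j) i) u))" for i j \<beta>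
    unfolding h[of j] higgs_scale[OF sym] h ..
  have \<sigma>: "\<sigma> (\<sigma> \<beta> i) j = \<sigma> (\<sigma> \<beta> j) i" for \<beta> i j
    by (auto simp: \<sigma>_def fun_eq_iff)
  have \<sigma>': "\<sigma> \<beta> i (Some j) = \<beta> (Some j)" if "i \<noteq> j" for \<beta> i j
    using that by (simp add: \<sigma>_def)
  have mpow: "higgs (axis i 1) (higgs (axis j 1) (mpow \<beta>)) = higgs (axis j 1) (higgs (axis i 1) (mpow \<beta>))"
    for i j and \<beta> :: "'n option \<Rightarrow> nat"
  proof (cases "i = j")
    case False
    then show ?thesis
      unfolding hh \<sigma>[where \<beta>=\<beta> and i=j and j=i]
      using \<sigma>'[where \<beta>=\<beta> and i=j and j=i] \<sigma>'[where \<beta>=\<beta> and i=i and j=j] by (simp add: mult_ac)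
  qed simp
  have axis: "higgs (axis i 1) (higgs (axis j 1) p) = higgs (axis j 1) (higgs (axis i 1) p)" for i j
    using wpoly_sym_power[OF assms]
  proof (induction rule: wpoly_induct)
    case (add p q a)
    have hp: "higgs (axis i 1) p \<in> hpoly k" if "p \<in> hpoly k" for i p
      by (rule higgs_wpoly[OF that]) simp
    have *: "higgs (axis i 1) (\<lambda>u. p u + a * q u) = (\<lambda>u. higgs (axis i 1) p u + a * higgs (axis i 1) q u)"
      if "p \<in> hpoly k" "q \<in> hpoly k" for i p q
      using higgs_lincomb[OF that, of _ 1 a] by (simp add: fun_eq_iff)
    show ?case by (simp add: * add.hyps hp add.IH)
  qed (simp_all add: mpow)
  have hp: "higgs (axis i 1) p \<in> hpoly k" for i
    by (rule higgs_wpoly[OF wpoly_sym_power[OF assms]]) simp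
  have exp: "higgs v (higgs w p) = (\<lambda>u. \<Sum>j\<in>UNIV. \<Sum>i\<in>UNIV. v $ i * w $ j * higgs (axis i 1) (higgs (axis j 1) p) u)" for v w
  proof
    fix u
    have "higgs v (higgs w p) u = (\<Sum>j\<in>UNIV. w $ j * higgs v (higgs (axis j 1) p) u)"
      using higgs_axis[OF assms, of w] higgs_sum[of UNIV "\<lambda>j. higgs (axis j 1) p" "\<lambda>_. 0" k 0 v "\<lambda>j. w $ j"] hp
      by simp
    also have "\<dots> = (\<Sum>j\<in>UNIV. \<Sum>i\<in>UNIV. v $ i * w $ j * higgs (axis i 1) (higgs (axis j 1) p) u)"
      by (subst higgs_axis[OF hp]) (simp add: sum_distrib_left mult_ac)
    finally show "higgs v (higgs w p) u = (\<Sum>j\<in>UNIV. \<Sum>i\<in>UNIV. v $ i * w $ j * higgs (axis i 1) (higgs (axis j 1) p) u)" .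
  qed
  show ?thesis
  proof
    fix u
    have "(\<Sum>j\<in>UNIV. \<Sum>i\<in>UNIV. v $ i * w $ j * higgs (axis i 1) (higgs (axis j 1) p) u)
        = (\<Sum>i\<in>UNIV. \<Sum>j\<in>UNIV. v $ i * w $ j * higgs (axis i 1) (higgs (axis j 1) p) u)"
      by (rule sum.swap)
    also have "\<dots> = (\<Sum>i\<in>UNIV. \<Sum>j\<in>UNIV. w $ j * v $ i * higgs (axis j 1) (higgs (axis i 1) p) u)"
      by (intro sum.cong refl) (metis axis mult.commute)
    finally show "higgs v (higgs w p) u = higgs w (higgs v p) u"
      using fun_cong[OF exp[of v w], of u] fun_cong[OF exp[of w v], of u] by (simp only:)
  qed
qed

section \<open>Pullback along linear maps\<close>

definition dilate :: "'n set \<Rightarrow> complex \<Rightarrow> complex^'n::finite \<Rightarrow> complex^'n" where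
  "dilate B a w = (\<chi> i. if i \<in> B then a * w $ i else w $ i)"

definition restr :: "'n set \<Rightarrow> complex^'n::finite \<Rightarrow> complex^'n" where
  "restr B w = (\<chi> i. if i \<in> B then w $ i else 0)"

text \<open>The map on \<open>T(-log D) \<otimes> L \<oplus> L\<close> induced by a linear map \<open>L\<close> on \<open>T(-log D)\<close> and multiplication by \<open>c\<close>
  on the line bundle. Changes of charts and dilations are of this form.\<close>

definition dual_map :: "complex \<Rightarrow> (complex^'n::finite \<Rightarrow> complex^'n) \<Rightarrow> complex^('n option) \<Rightarrow> complex^('n option)" where
  "dual_map c L u = (\<chi> j. case j of None \<Rightarrow> c * u $ None | Some i \<Rightarrow> c * L (\<chi> l. u $ Some l) $ i)"

definition pullback :: "complex \<Rightarrow> (complex^'n::finite \<Rightarrow> complex^'n) \<Rightarrow> 'n form \<Rightarrow> 'n form" where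
  "pullback c L f ws u = f (map L ws) (dual_map c L u)"

lemma dual_map_nth [simp]:
  "dual_map c L u $ None = c * u $ None" "dual_map c L u $ Some i = c * L (\<chi> l. u $ Some l) $ i"
  by (simp_all add: dual_map_def)

lemma clinear_dilate: "clinear_map (dilate B a)"
  by (simp add: clinear_map_def dilate_def vec_eq_iff algebra_simps)

lemma clinear_sum:
  assumes "clinear_map L"
  shows "L (\<Sum>i\<in>I. c i *s v i) = (\<Sum>i\<in>I. c i *s L (v i))"
proof -
  have 0: "L 0 = 0" using assms[unfolded clinear_map_def, rule_format, of 0 0 0 0] by simp
  show ?thesis
  proof (induction I rule: infinite_finite_induct)
    case (insert i I)
    then show ?case
      using assms[unfolded clinear_map_def, rule_format, of "c i" "v i" 1 "\<Sum>i\<in>I. c i *s v i"] by simp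
  qed (simp_all add: 0)
qed

lemma clinear_nth:
  assumes "clinear_map L"
  shows "L v $ i = (\<Sum>l\<in>UNIV. v $ l * L (axis l 1) $ i)"
  using clinear_sum[OF assms, of "\<lambda>l. v $ l" "\<lambda>l. axis l 1" UNIV] by (simp add: basis_expansion)

lemma alt_pull:
  assumes "f \<in> alt_forms i V" "clinear_map L"
  shows "(\<lambda>ws. f (map L ws)) \<in> alt_forms i V"
proof (rule alt_formsI)
  fix xs ys a v b w u
  show "f (map L (xs @ (a *s v + b *s w) # ys)) u = a * f (map L (xs @ v # ys)) u + b * f (map L (xs @ w # ys)) u"
    using alt_lin[OF assms(1)] assms(2) by (simp add: clinear_map_def)
next
  fix ws :: "(complex^'a) list"
  assume "\<not> distinct ws"
  then have "\<not> distinct (map L ws)" by (simp add: distinct_map)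
  then show "f (map L ws) = (\<lambda>_. 0)" by (rule alt_nd[OF assms(1)])
qed (use assms(1) in \<open>auto simp: alt_forms_def\<close>)

lemma alt_pullback:
  assumes f: "f \<in> alt_forms i V" and L: "clinear_map L" and V: "csubspace V"
    and val: "\<And>p. p \<in> V \<Longrightarrow> (\<lambda>u. p (dual_map c L u)) \<in> V'"
  shows "pullback c L f \<in> alt_forms i V'"
proof -
  have "(\<lambda>ws. (\<lambda>p u. p (dual_map c L u)) (f (map L ws))) \<in> alt_forms i V'"
    by (rule alt_forms_map[OF alt_pull[OF f L] V]) (auto intro: val)
  then show ?thesis by (simp add: pullback_def[abs_def])
qed

text \<open>The condition says that \<open>L\<close> is triangular with respect to the weights.\<close>

lemma dual_map_wpoly:
  assumes L: "clinear_map L"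
    and w: "\<And>i l. L (axis l 1) $ i \<noteq> 0 \<Longrightarrow> \<omega> (Some l) \<le> \<omega> (Some i)"
    and p: "p \<in> wpoly \<omega> k m"
  shows "(\<lambda>u. p (dual_map c L u)) \<in> wpoly \<omega> k m"
proof (rule wpoly_subst[OF p])
  fix j
  show "(\<lambda>u. dual_map c L u $ j) \<in> wpoly \<omega> 1 (\<omega> j)"
  proof (cases j)
    case None
    then show ?thesis using wpoly_scale[OF wpoly_var[of \<omega> None "\<omega> None", OF order_refl], of c] by simp
  next
    case (Some i)
    have "(\<lambda>u. c * (\<Sum>l\<in>UNIV. L (axis l 1) $ i * u $ Some l)) \<in> wpoly \<omega> 1 (\<omega> (Some i))"
    proof (rule wpoly_scale, rule wpoly_sum)
      fix l :: 'a
      show "(\<lambda>u. L (axis l 1) $ i * u $ Some l) \<in> wpoly \<omega> 1 (\<omega> (Some i))"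
      proof (cases "L (axis l 1) $ i = 0")
        case False
        then show ?thesis by (intro wpoly_scale wpoly_var w)
      qed simp
    qed
    then show ?thesis by (simp add: Some clinear_nth[OF L, of "\<chi> l. _ $ Some l"] mult.commute)
  qed
qed

lemma alt_pullback_sym:
  assumes "f \<in> alt_forms i (hpoly k)" "clinear_map L"
  shows "pullback c L f \<in> alt_forms i (hpoly k)"
  using assms by (intro alt_pullback[OF assms] csubspace_wpoly dual_map_wpoly) auto

lemma higgs_pullback:
  assumes L: "clinear_map L"
  shows "higgs w (\<lambda>u. p (dual_map c L u)) u = higgs (L w) p (dual_map c L u)"
proof -
  have "dual_map c L (u + s *s higgs1_dual w u) = dual_map c L u + s *s higgs1_dual (L w) (dual_map c L u)" for s
  proof -
    have "(\<chi> l. (u + s *s higgs1_dual w u) $ Some l) = 1 *s (\<chi> l. u $ Some l) + (s * u $ None) *s w"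
      by (simp add: vec_eq_iff higgs1_dual_def)
    then have "L (\<chi> l. (u + s *s higgs1_dual w u) $ Some l) = 1 *s L (\<chi> l. u $ Some l) + (s * u $ None) *s L w"
      using L unfolding clinear_map_def by (simp only:)
    then show ?thesis
      by (simp add: vec_eq_iff dual_map_def higgs1_dual_def algebra_simps split: option.split)
  qed
  then show ?thesis by (simp add: higgs_def derivation_ext_def)
qed

lemma wedge_higgs_pullback:
  assumes "clinear_map L"
  shows "wedge_higgs (pullback c L f) = pullback c L (wedge_higgs f)"
  by (intro ext) (simp add: wedge_higgs_def pullback_def[abs_def] higgs_pullback[OF assms] map_drop_nth)

section \<open>Square-integrable forms\<close>

lemma alt_contract':
  assumes "f \<in> alt_forms i V" "csubspace V"
  shows "(\<lambda>ws. f (w # ws)) \<in> alt_forms (i - 1) V"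
proof (cases i)
  case 0
  then have "(\<lambda>ws. f (w # ws)) = (\<lambda>_ _. 0)"
    using alt_len[OF assms(1)] by (simp add: fun_eq_iff)
  then show ?thesis using alt_forms_zero[OF assms(2)] by simp
next
  case (Suc j)
  then show ?thesis using alt_contract assms(1) by simp
qed

lemma alt_scale_entry:
  assumes "f \<in> alt_forms i V"
  shows "f (xs @ (a *s v) # ys) u = a * f (xs @ v # ys) u"
  using alt_lin[OF assms, of xs a v 0 v ys u] by simp

lemma alt_zero_entry:
  assumes "f \<in> alt_forms i V" "0 \<in> set ws"
  shows "f ws = (\<lambda>_. 0)"
proof
  fix u
  obtain xs ys where "ws = xs @ 0 # ys" using assms(2) by (meson split_list)
  then show "f ws u = 0" using alt_scale_entry[OF assms(1), of xs 0 0 ys u] by simp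
qed

lemma alt_repeated_entry:
  assumes "f \<in> alt_forms i V" "v \<in> set ws" "L v = a *s v"
  shows "f (v # map L ws) = (\<lambda>_. 0)"
proof
  fix u
  obtain xs ys where "ws = xs @ v # ys" using assms(2) by (meson split_list)
  then have "f (v # map L ws) u = a * f (v # map L xs @ v # map L ys) u"
    using alt_scale_entry[OF assms(1), of "v # map L xs" a v "map L ys" u] assms(3) by simp
  also have "f (v # map L xs @ v # map L ys) = (\<lambda>_. 0)" by (rule alt_nd[OF assms(1)]) simp
  finally show "f (v # map L ws) u = 0" by simp
qed

lemma dilate_axis: "dilate B a (axis j 1) = (if j \<in> B then a *s axis j 1 else axis j 1)"
  by (auto simp: dilate_def vec_eq_iff axis_def)

text \<open>Writing each argument as a multiple of \<open>e\<^sub>1\<close> plus its projection \<open>dilate {i\<^sub>1} 0\<close> to the other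
  coordinates; terms with two entries \<open>e\<^sub>1\<close> vanish.\<close>

lemma alt_decompose:
  assumes "f \<in> alt_forms i V" "csubspace V"
  shows "f ws u = wedge_dlog (\<lambda>vs. f (axis i\<^sub>1 1 # map (dilate {i\<^sub>1} 0) vs)) ws u + f (map (dilate {i\<^sub>1} 0) ws) u"
  using assms(1)
proof (induction ws arbitrary: f i)
  case Nil
  then show ?case by (simp add: wedge_dlog_def)
next
  case (Cons w ws)
  let ?p = "dilate {i\<^sub>1} 0" and ?e = "axis i\<^sub>1 1"
  have dl: "wedge_dlog h (w # ws) u = w $ i\<^sub>1 * h ws u - wedge_dlog (\<lambda>vs. h (w # vs)) ws u" for h
    unfolding wedge_dlog_op wedge_op_Cons ..
  have "w = 1 *s ?p w + w $ i\<^sub>1 *s ?e" by (simp add: vec_eq_iff dilate_def axis_def)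
  then have 1: "f (w # ws) u = f (?p w # ws) u + w $ i\<^sub>1 * f (?e # ws) u"
    using alt_lin_Cons[OF Cons.prems, of 1 "?p w" "w $ i\<^sub>1" ?e ws u] by simp
  have 2: "f (?p w # ws) u = wedge_dlog (\<lambda>vs. f (?p w # ?e # map ?p vs)) ws u + f (?p w # map ?p ws) u"
    by (rule Cons.IH[OF alt_contract'[OF Cons.prems assms(2)]])
  have "f (?e # ws) u = wedge_dlog (\<lambda>vs. f (?e # ?e # map ?p vs)) ws u + f (?e # map ?p ws) u"
    by (rule Cons.IH[OF alt_contract'[OF Cons.prems assms(2)]])
  moreover have "f (?e # ?e # vs) = (\<lambda>_. 0)" for vs
    by (rule alt_nd[OF Cons.prems]) simp
  ultimately have 3: "f (?e # ws) u = f (?e # map ?p ws) u"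
    by (simp add: wedge_dlog_def)
  have "f (?p w # ?e # vs) v = - f (?e # ?p w # vs) v" for vs v
    using alt_swap[OF Cons.prems, of "[]" "?p w" ?e vs v] by simp
  then have 4: "wedge_dlog (\<lambda>vs. f (?p w # ?e # map ?p vs)) ws u = - wedge_dlog (\<lambda>vs. f (?e # ?p w # map ?p vs)) ws u"
    by (simp add: wedge_dlog_def sum_negf)
  show ?case unfolding dl 1 2 3 4 by simp
qed

text \<open>A description without reference to the complement \<open>\<langle>dz\<^sub>2, \<dots>, dz\<^sub>n\<rangle>\<close> of \<open>dz\<^sub>1/z\<^sub>1\<close>, from which it is
  clear that the condition is the same in all frames with the same \<open>e\<^sub>1\<close>.\<close>

lemma l2_forms_iff:
  "f \<in> l2_forms k i \<longleftrightarrow> f \<in> alt_forms i (wpoly cusp_wt k 0) \<and>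
     (\<forall>ws. axis i\<^sub>1 1 \<in> set ws \<longrightarrow> f ws \<in> wpoly cusp_wt k (-2))"
proof (cases i)
  case 0
  have "f ws \<in> wpoly cusp_wt k (-2)" if "f \<in> alt_forms 0 (wpoly cusp_wt k 0)" "axis i\<^sub>1 1 \<in> set ws" for ws
  proof -
    have "length ws \<noteq> 0" using that(2) by auto
    then show ?thesis using alt_len[OF that(1)] by simp
  qed
  moreover have "f ws = (\<lambda>_. 0)" if "f \<in> alt_forms 0 (wpoly cusp_wt k 0)" "axis i\<^sub>1 1 \<in> set ws" for ws
  proof -
    have "length ws \<noteq> 0" using that(2) by auto
    then show ?thesis using alt_len[OF that(1)] by simp
  qed
  ultimately show ?thesis by (auto simp: 0 tangential_forms_def weight_filtration_wpoly)
next
  case (Suc p)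
  let ?p = "dilate {i\<^sub>1} 0" and ?e = "axis i\<^sub>1 1 :: complex^'a"
  show ?thesis
  proof
    assume "f \<in> l2_forms k i"
    then obtain \<beta> \<gamma> where f: "f = (\<lambda>ws u. wedge_dlog \<beta> ws u + \<gamma> ws u)"
      and \<beta>: "\<beta> \<in> tangential_forms p (wpoly cusp_wt k (-2))"
      and \<gamma>: "\<gamma> \<in> tangential_forms (Suc p) (wpoly cusp_wt k 0)"
      by (auto simp: Suc weight_filtration_wpoly)
    have d: "wedge_dlog \<beta> \<in> alt_forms (Suc p) (wpoly cusp_wt k (-2))"
      unfolding wedge_dlog_op using \<beta>
      by (intro wedge_op_forms[OF form_op_dlog[OF csubspace_wpoly]] csubspace_wpoly wpoly_scale)
         (auto simp: tangential_forms_def)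
    have dv: "wedge_dlog \<beta> ws \<in> wpoly cusp_wt k (-2)" for ws
      by (rule alt_val[OF d]) simp
    have d0: "wedge_dlog \<beta> \<in> alt_forms (Suc p) (wpoly cusp_wt k 0)"
      by (rule alt_mono[OF d]) (rule wpoly_le[OF _ dv], simp)
    have "f \<in> alt_forms i (wpoly cusp_wt k 0)"
      using alt_forms_lincomb[OF d0, of \<gamma> 1 1] \<gamma> by (simp add: f Suc tangential_forms_def csubspace_wpoly)
    moreover have "f ws \<in> wpoly cusp_wt k (-2)" if "?e \<in> set ws" for ws
    proof -
      have "\<gamma> ws = (\<lambda>_. 0)" using \<gamma> that by (simp add: tangential_forms_def)
      then show ?thesis using dv by (simp add: f)
    qed
    ultimately show "f \<in> alt_forms i (wpoly cusp_wt k 0) \<and> (\<forall>ws. ?e \<in> set ws \<longrightarrow> f ws \<in> wpoly cusp_wt k (-2))"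
      by blast
  next
    assume A: "f \<in> alt_forms i (wpoly cusp_wt k 0) \<and> (\<forall>ws. ?e \<in> set ws \<longrightarrow> f ws \<in> wpoly cusp_wt k (-2))"
    then have f: "f \<in> alt_forms (Suc p) (wpoly cusp_wt k 0)" by (simp add: Suc)
    define \<beta> where "\<beta> = (\<lambda>vs. f (?e # map ?p vs))"
    define \<gamma> where "\<gamma> = (\<lambda>ws. f (map ?p ws))"
    have pe: "?p ?e = 0" by (simp add: dilate_axis)
    have "\<beta> \<in> alt_forms p (wpoly cusp_wt k 0)"
      unfolding \<beta>_def by (rule alt_pull[OF alt_contract[OF f] clinear_dilate])
    then have "\<beta> \<in> alt_forms p (wpoly cusp_wt k (-2))"
      by (rule alt_mono) (use A in \<open>simp add: \<beta>_def\<close>)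
    moreover have "\<beta> ws = (\<lambda>_. 0)" if "?e \<in> set ws" for ws
      unfolding \<beta>_def using that pe by (intro alt_zero_entry[OF f]) force
    moreover have "\<gamma> \<in> alt_forms (Suc p) (wpoly cusp_wt k 0)"
      unfolding \<gamma>_def by (rule alt_pull[OF f clinear_dilate])
    moreover have "\<gamma> ws = (\<lambda>_. 0)" if "?e \<in> set ws" for ws
      unfolding \<gamma>_def using that pe by (intro alt_zero_entry[OF f]) force
    moreover have "f = (\<lambda>ws u. wedge_dlog \<beta> ws u + \<gamma> ws u)"
      unfolding \<beta>_def \<gamma>_def by (intro ext) (rule alt_decompose[OF f csubspace_wpoly])
    ultimately show "f \<in> l2_forms k i"
      by (auto simp: Suc weight_filtration_wpoly tangential_forms_def)
  qed
qed

lemma l2_forms_alt: "f \<in> l2_forms k i \<Longrightarrow> f \<in> alt_forms i (hpoly k)"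
  unfolding l2_forms_iff using alt_mono alt_val[of f i "wpoly cusp_wt k 0"] wpoly_sym_power
  by (metis wpoly_zero)

lemma l2_forms_lincomb:
  assumes "f \<in> l2_forms k i" "h \<in> l2_forms k i"
  shows "(\<lambda>ws u. a * f ws u + b * h ws u) \<in> l2_forms k i"
  using assms unfolding l2_forms_iff
  by (auto intro: alt_forms_lincomb csubspace_wpoly wpoly_lincomb)

lemma l2_forms_zero: "(\<lambda>_ _. 0) \<in> l2_forms k i"
  unfolding l2_forms_iff by (auto intro: alt_forms_zero csubspace_wpoly)

text \<open>Contraction of \<open>\<theta>\<close> with any vector lowers weights by one, and contraction with \<open>e\<^sub>1\<close> lowers them
  by two.\<close>

lemma l2_forms_wedge:
  assumes "f \<in> l2_forms k i"
  shows "wedge_higgs f \<in> l2_forms k (Suc i)"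
  unfolding l2_forms_iff
proof (intro conjI allI impI)
  have f: "f \<in> alt_forms i (wpoly cusp_wt k 0)"
    and e: "\<And>ws. axis i\<^sub>1 1 \<in> set ws \<Longrightarrow> f ws \<in> wpoly cusp_wt k (-2)"
    using assms unfolding l2_forms_iff by auto
  have fv: "f ws \<in> wpoly cusp_wt k 0" for ws by (rule alt_val[OF f]) simp
  have h: "higgs w p \<in> wpoly cusp_wt k m" if "p \<in> wpoly cusp_wt k m" for w p m
    by (rule higgs_wpoly[OF that]) (simp add: cusp_wt_def)
  show "wedge_higgs f \<in> alt_forms (Suc i) (wpoly cusp_wt k 0)"
    unfolding wedge_higgs_op by (rule wedge_op_forms[OF form_op_higgs f csubspace_wpoly h])
  fix ws :: "(complex^'a) list" assume ws: "axis i\<^sub>1 1 \<in> set ws"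
  have "(\<lambda>u. \<Sum>l<length ws. (-1) ^ l * higgs (ws ! l) (f (drop_nth l ws)) u) \<in> wpoly cusp_wt k (-2)"
  proof (intro wpoly_sum wpoly_scale)
    fix l assume "l \<in> {..<length ws}"
    then have "ws = take l ws @ ws ! l # drop (Suc l) ws" by (simp add: id_take_nth_drop)
    then have "set ws = insert (ws ! l) (set (drop_nth l ws))"
      by (metis drop_nth_def list.simps(15) set_append Un_insert_right)
    then consider "ws ! l = axis i\<^sub>1 1" | "axis i\<^sub>1 1 \<in> set (drop_nth l ws)" using ws by auto
    then show "higgs (ws ! l) (f (drop_nth l ws)) \<in> wpoly cusp_wt k (-2)"
    proof cases
      case 1
      then show ?thesis by (intro higgs_wpoly[OF fv]) (simp add: axis_def split: if_splits)
    next
      case 2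
      then show ?thesis by (intro h e)
    qed
  qed
  then show "wedge_higgs f ws \<in> wpoly cusp_wt k (-2)" by (simp add: wedge_higgs_def[abs_def])
qed

lemma l2_forms_pullback:
  assumes f: "f \<in> l2_forms k i" and L: "clinear_map L" and e: "L (axis i\<^sub>1 1) = axis i\<^sub>1 1"
  shows "pullback c L f \<in> l2_forms k i"
  unfolding l2_forms_iff
proof (intro conjI allI impI)
  have w: "cusp_wt (Some l) \<le> cusp_wt (Some i)" if "L (axis l 1) $ i \<noteq> 0" for i l
    using that e by (cases "l = i\<^sub>1") (auto simp: cusp_wt_def axis_def split: if_splits)
  show "pullback c L f \<in> alt_forms i (wpoly cusp_wt k 0)"
    using f unfolding l2_forms_iff
    by (intro alt_pullback[OF _ L csubspace_wpoly] dual_map_wpoly[OF L] w) auto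
  fix ws :: "(complex^'a) list" assume "axis i\<^sub>1 1 \<in> set ws"
  then have "axis i\<^sub>1 1 \<in> set (map L ws)" using e by force
  then have v: "f (map L ws) \<in> wpoly cusp_wt k (-2)" using f unfolding l2_forms_iff by blast
  show "pullback c L f ws \<in> wpoly cusp_wt k (-2)"
    using dual_map_wpoly[OF L w v] by (simp add: pullback_def[abs_def])
qed

section \<open>A quadrature formula\<close>

definition quad_node :: "nat \<Rightarrow> nat \<Rightarrow> complex" where
  "quad_node d r = unity_root (Suc d) ^ r"

text \<open>With nodes at roots of unity, these weights integrate polynomials of degree at most \<open>d\<close> over
  the interval from \<open>0\<close> to \<open>1\<close>.\<close>

definition quad_weight :: "nat \<Rightarrow> nat \<Rightarrow> complex" where
  "quad_weight d r = (\<Sum>a\<le>d. 1 / (of_nat (Suc a) * quad_node d r ^ a)) / of_nat (Suc d)"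

lemma quadrature_power:
  assumes "b \<le> d"
  shows "(\<Sum>r\<le>d. quad_weight d r * quad_node d r ^ b) = 1 / of_nat (Suc b)"
proof -
  have *: "(\<Sum>r\<le>d. quad_node d r ^ b / quad_node d r ^ a) = (if b = a then of_nat (Suc d) else 0)" if "a \<le> d" for a
    using unity_root_orthogonal[of b "Suc d" a] assms that
    by (simp add: quad_node_def lessThan_Suc_atMost del: of_nat_Suc)
  have "(\<Sum>r\<le>d. quad_weight d r * quad_node d r ^ b)
      = (\<Sum>r\<le>d. \<Sum>a\<le>d. quad_node d r ^ b / quad_node d r ^ a / of_nat (Suc a) / of_nat (Suc d))"
    by (simp add: quad_weight_def sum_divide_distrib sum_distrib_right sum_distrib_left mult_ac del: of_nat_Suc)
  also have "\<dots> = (\<Sum>a\<le>d. (\<Sum>r\<le>d. quad_node d r ^ b / quad_node d r ^ a) / of_nat (Suc a) / of_nat (Suc d))"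
    by (subst sum.swap) (simp add: sum_divide_distrib del: of_nat_Suc)
  also have "\<dots> = (\<Sum>a\<le>d. if b = a then 1 / of_nat (Suc a) else 0)"
    by (intro sum.cong refl) (simp add: * del: of_nat_Suc)
  also have "\<dots> = 1 / of_nat (Suc b)" using assms by (simp add: sum.delta del: of_nat_Suc)
  finally show ?thesis .
qed

text \<open>The integral of the derivative, as a finite sum. Replacing integrals by finite sums makes it
  evident that the homotopy below preserves polynomials and holomorphic dependence on parameters.\<close>

lemma quadrature:
  assumes "degree P \<le> Suc d"
  shows "(\<Sum>r\<le>d. quad_weight d r * poly (pderiv P) (quad_node d r)) = poly P 1 - poly P 0"
proof -
  have d: "degree (pderiv P) \<le> d"
    using assms by (simp add: degree_pderiv)
  have pw: "poly Q x = (\<Sum>b\<le>e. coeff Q b * x ^ b)" if "degree Q \<le> e" for Q :: "complex poly" and x e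
    unfolding poly_altdef using that by (intro sum.mono_neutral_left) (auto simp: coeff_eq_0)
  have "(\<Sum>r\<le>d. quad_weight d r * poly (pderiv P) (quad_node d r))
      = (\<Sum>b\<le>d. coeff (pderiv P) b * (\<Sum>r\<le>d. quad_weight d r * quad_node d r ^ b))"
    unfolding pw[OF d] sum_distrib_left by (subst sum.swap) (simp add: mult_ac)
  also have "\<dots> = (\<Sum>b\<le>d. coeff P (Suc b))"
    by (intro sum.cong refl) (simp add: quadrature_power coeff_pderiv del: of_nat_Suc)
  also have "\<dots> = poly P 1 - poly P 0"
    unfolding pw[OF assms] by (simp add: sum.atMost_Suc_shift power_0_left del: sum.atMost_Suc)
  finally show ?thesis .
qed

section \<open>A homotopy for the Koszul differential\<close>

text \<open>This is \<open>1/a\<close> times the pullback along the dilation by \<open>a\<close> of the interior product of \<open>q\<close> with the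
  vector field \<open>\<Sum>\<^sub>j\<^sub>\<in>\<^sub>B x\<^sub>j \<partial>/\<partial>x\<^sub>j\<close>, written so that it makes sense for \<open>a = 0\<close> too.\<close>

definition contraction :: "'n set \<Rightarrow> complex \<Rightarrow> 'n::finite form \<Rightarrow> 'n form" where
  "contraction B a q ws u = (\<Sum>j\<in>B. u $ Some j * q (axis j 1 # map (dilate B a) ws) (dual_map 1 (dilate B a) u))"

text \<open>The integral of the contraction over \<open>a\<close> from \<open>0\<close> to \<open>1\<close>, the homotopy in the usual proof of the
  Poincare lemma for the variables with index in \<open>B\<close>.\<close>

definition homotopy :: "nat \<Rightarrow> 'n set \<Rightarrow> 'n::finite form \<Rightarrow> 'n form" where
  "homotopy d B q ws u = (\<Sum>r\<le>d. quad_weight d r * contraction B (quad_node d r) q ws u)"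

lemma restr_sum: "restr B w = (\<Sum>j\<in>B. w $ j *s axis j 1)"
  by (simp add: restr_def vec_eq_iff axis_def if_distrib[of "\<lambda>x. _ * x"] sum.delta cong: if_cong)

lemma dilate_restr: "dilate B a w = 1 *s dilate B 0 w + a *s restr B w"
  by (simp add: dilate_def restr_def vec_eq_iff)

lemma alt_sum_app:
  assumes "f \<in> alt_forms i V"
  shows "f (xs @ (\<Sum>j\<in>B. c j *s v j) # ys) u = (\<Sum>j\<in>B. c j * f (xs @ v j # ys) u)"
proof (induction B rule: infinite_finite_induct)
  case (insert j B)
  then show ?case
    using alt_lin[OF assms, of xs "c j" "v j" 1 "\<Sum>j\<in>B. c j *s v j" ys u] by simp
qed (simp_all add: alt_zero_entry[OF assms])

text \<open>The product rule for the multilinear function of the arguments and of the point at which the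
  coefficients are evaluated.\<close>

lemma pullback_dilate_derivative:
  fixes q :: "'n::finite form"
  assumes q: "q \<in> alt_forms i (hpoly k)"
  shows "((\<lambda>a. q (vs @ map (dilate B a) ws) (dual_map 1 (dilate B a) u)) has_field_derivative
     (\<Sum>j\<in>B. u $ Some j * partial (Some j) (q (vs @ map (dilate B a) ws)) (dual_map 1 (dilate B a) u)) +
     (\<Sum>l<length ws. q (vs @ (map (dilate B a) ws)[l := restr B (ws ! l)]) (dual_map 1 (dilate B a) u))) (at a)"
proof (induction ws arbitrary: vs)
  case Nil
  have "q vs \<in> hpoly k" by (rule alt_val[OF q]) simp
  moreover have "((\<lambda>a. dual_map 1 (dilate B a) u $ j) has_field_derivative
      (case j of None \<Rightarrow> 0 | Some i \<Rightarrow> if i \<in> B then u $ Some i else 0)) (at a)" for j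
    by (cases j) (auto simp: dilate_def intro!: derivative_eq_intros)
  ultimately have "((\<lambda>a. q vs (dual_map 1 (dilate B a) u)) has_field_derivative
     (\<Sum>j\<in>UNIV. (case j of None \<Rightarrow> 0 | Some i \<Rightarrow> if i \<in> B then u $ Some i else 0) * partial j (q vs) (dual_map 1 (dilate B a) u))) (at a)"
    by (rule poly_curve)
  then show ?case
    by (simp add: sum_option if_distrib[of "\<lambda>x. x * _"] sum.If_cases cong: if_cong)
next
  case (Cons w ws)
  let ?S = "dilate B" and ?D = "\<lambda>a. dual_map 1 (dilate B a) u"
  define v0 v1 where v01: "v0 = vs @ [?S 0 w]" "v1 = vs @ [restr B w]"
  have val: "q xs \<in> hpoly k" for xs by (rule alt_val[OF q]) simp
  have split: "q (vs @ ?S a w # xs) = (\<lambda>v. 1 * q (v0 @ xs) v + a * q (v1 @ xs) v)" for a xs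
    by (rule ext) (simp only: v01 append.simps append_assoc dilate_restr[of B a w] alt_lin[OF q])
  have pds: "partial j (q (vs @ ?S a w # xs)) v = partial j (q (v0 @ xs)) v + a * partial j (q (v1 @ xs)) v" for a xs j v
    unfolding split partial_add_scale[OF val val] by simp
  note IH0 = Cons[of v0] and IH1 = Cons[of v1]
  have v1: "q (vs @ restr B w # xs) = q (v1 @ xs)" for xs by (simp add: v01)
  have P: "(\<Sum>j\<in>B. u $ Some j * partial (Some j) (q (vs @ map (?S a) (w # ws))) (?D a))
    = (\<Sum>j\<in>B. u $ Some j * partial (Some j) (q (v0 @ map (?S a) ws)) (?D a)) +
      a * (\<Sum>j\<in>B. u $ Some j * partial (Some j) (q (v1 @ map (?S a) ws)) (?D a))"
    by (simp add: pds sum.distrib sum_distrib_left algebra_simps)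
  have Q: "(\<Sum>l<length (w # ws). q (vs @ (map (?S a) (w # ws))[l := restr B ((w # ws) ! l)]) (?D a))
    = q (v1 @ map (?S a) ws) (?D a) + ((\<Sum>l<length ws. q (v0 @ (map (?S a) ws)[l := restr B (ws ! l)]) (?D a)) +
      a * (\<Sum>l<length ws. q (v1 @ (map (?S a) ws)[l := restr B (ws ! l)]) (?D a)))"
    by (simp add: sum.lessThan_Suc_shift split v1 sum.distrib sum_distrib_left del: sum.lessThan_Suc)
  have "((\<lambda>a. q (v0 @ map (?S a) ws) (?D a) + a * q (v1 @ map (?S a) ws) (?D a)) has_field_derivative
     ((\<Sum>j\<in>B. u $ Some j * partial (Some j) (q (v0 @ map (?S a) ws)) (?D a)) +
      (\<Sum>l<length ws. q (v0 @ (map (?S a) ws)[l := restr B (ws ! l)]) (?D a))) +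
     (1 * q (v1 @ map (?S a) ws) (?D a) + ((\<Sum>j\<in>B. u $ Some j * partial (Some j) (q (v1 @ map (?S a) ws)) (?D a)) +
      (\<Sum>l<length ws. q (v1 @ (map (?S a) ws)[l := restr B (ws ! l)]) (?D a))) * a)) (at a)"
    by (intro DERIV_add IH0 DERIV_mult DERIV_ident IH1)
  moreover have "(\<lambda>a. q (vs @ map (?S a) (w # ws)) (?D a))
      = (\<lambda>a. q (v0 @ map (?S a) ws) (?D a) + a * q (v1 @ map (?S a) ws) (?D a))"
    by (rule ext) (simp add: split)
  moreover have "(\<Sum>j\<in>B. u $ Some j * partial (Some j) (q (vs @ map (?S a) (w # ws))) (?D a)) +
     (\<Sum>l<length (w # ws). q (vs @ (map (?S a) (w # ws))[l := restr B ((w # ws) ! l)]) (?D a))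
    = ((\<Sum>j\<in>B. u $ Some j * partial (Some j) (q (v0 @ map (?S a) ws)) (?D a)) +
      (\<Sum>l<length ws. q (v0 @ (map (?S a) ws)[l := restr B (ws ! l)]) (?D a))) +
     (1 * q (v1 @ map (?S a) ws) (?D a) + ((\<Sum>j\<in>B. u $ Some j * partial (Some j) (q (v1 @ map (?S a) ws)) (?D a)) +
      (\<Sum>l<length ws. q (v1 @ (map (?S a) ws)[l := restr B (ws ! l)]) (?D a))) * a)"
    unfolding P Q by (simp add: algebra_simps)
  ultimately show ?case by (simp only:)
qed

lemma poly_dilate_polynomial:
  fixes p :: "complex^('n::finite option) \<Rightarrow> complex"
  assumes "p \<in> hpoly k"
  shows "\<exists>P. degree P \<le> k \<and> (\<forall>a. p (dual_map 1 (dilate B a) u) = poly P a)"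
  using assms
proof (induction rule: wpoly_induct)
  case zero
  show ?case by (intro exI[of _ 0]) simp
next
  case (mpow \<alpha>)
  define c :: "'n option \<Rightarrow> complex poly" where
    "c j = (case j of None \<Rightarrow> [:u $ None:] | Some i \<Rightarrow> if i \<in> B then [:0, u $ Some i:] else [:u $ Some i:])" for j
  have c: "dual_map 1 (dilate B a) u $ j = poly (c j) a" for a j
    by (cases j) (auto simp: c_def dilate_def)
  have "degree (c j) \<le> 1" for j by (auto simp: c_def split: option.split)
  then have d: "degree (c j ^ \<alpha> j) \<le> \<alpha> j" for j
    using degree_power_le[of "c j" "\<alpha> j"] by (metis le_trans mult.left_neutral mult_le_mono1)
  have "degree (\<Prod>j\<in>UNIV. c j ^ \<alpha> j) \<le> sum (degree \<circ> (\<lambda>j. c j ^ \<alpha> j)) UNIV"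
    by (rule degree_prod_sum_le) simp
  also have "\<dots> \<le> sum \<alpha> UNIV" using d by (intro sum_mono) simp
  finally have "degree (\<Prod>j\<in>UNIV. c j ^ \<alpha> j) \<le> k" using mpow by (simp add: degs_def)
  then show ?case
    by (intro exI[of _ "\<Prod>j\<in>UNIV. c j ^ \<alpha> j"]) (simp add: mpow_def c poly_prod)
next
  case (add p q b)
  then obtain P Q where "degree P \<le> k" "\<forall>a. p (dual_map 1 (dilate B a) u) = poly P a"
    "degree Q \<le> k" "\<forall>a. q (dual_map 1 (dilate B a) u) = poly Q a" by blast
  then show ?case
    by (intro exI[of _ "P + Polynomial.smult b Q"]) (auto intro!: degree_add_le order_trans[OF degree_smult_le])
qed

text \<open>The degree is bounded by that of the coefficients plus the number of arguments, as each of
  these is affine in \<open>a\<close>. The prefix \<open>vs\<close> is for the induction.\<close>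

lemma pullback_dilate_polynomial:
  fixes q :: "'n::finite form"
  assumes q: "q \<in> alt_forms i (hpoly k)"
  shows "\<exists>P. degree P \<le> k + length ws \<and> (\<forall>a. q (vs @ map (dilate B a) ws) (dual_map 1 (dilate B a) u) = poly P a)"
proof (induction ws arbitrary: vs)
  case Nil
  have "q vs \<in> hpoly k" by (rule alt_val[OF q]) simp
  then show ?case using poly_dilate_polynomial by simp
next
  case (Cons w ws)
  obtain P where P: "degree P \<le> k + length ws"
    "\<forall>a. q ((vs @ [dilate B 0 w]) @ map (dilate B a) ws) (dual_map 1 (dilate B a) u) = poly P a"
    using Cons by blast
  obtain Q where Q: "degree Q \<le> k + length ws"
    "\<forall>a. q ((vs @ [restr B w]) @ map (dilate B a) ws) (dual_map 1 (dilate B a) u) = poly Q a"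
    using Cons by blast
  have "q (vs @ map (dilate B a) (w # ws)) (dual_map 1 (dilate B a) u) = poly (P + pCons 0 Q) a" for a
    using alt_lin[OF q, of vs 1 "dilate B 0 w" a "restr B w" "map (dilate B a) ws" "dual_map 1 (dilate B a) u"] P(2) Q(2)
    by (simp add: dilate_restr[of B a w])
  moreover have "degree (P + pCons 0 Q) \<le> k + length (w # ws)"
    using P(1) Q(1) by (intro degree_add_le) (auto simp: degree_pCons_eq_if)
  ultimately show ?case by blast
qed

lemma higgs_var_mult:
  assumes "p \<in> hpoly k"
  shows "higgs w (\<lambda>u. u $ Some j * p u) u = u $ None * w $ j * p u + u $ Some j * higgs w p u"
proof -
  have "((\<lambda>s. (u $ Some j + s * (u $ None * w $ j)) * p (u + s *s higgs1_dual w u)) has_field_derivative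
     (u $ None * w $ j * p u + (\<Sum>l\<in>UNIV. higgs1_dual w u $ l * partial l p u) * u $ Some j)) (at 0)"
    using poly_line[OF assms, of u "higgs1_dual w u"]
    by (auto intro!: derivative_eq_intros)
  moreover have "higgs w p u = (\<Sum>l\<in>UNIV. higgs1_dual w u $ l * partial l p u)"
    unfolding higgs_def derivation_ext_def by (rule DERIV_imp_deriv[OF poly_line[OF assms]])
  moreover have "higgs w (\<lambda>u. u $ Some j * p u) u
      = deriv (\<lambda>s. (u $ Some j + s * (u $ None * w $ j)) * p (u + s *s higgs1_dual w u)) 0"
    by (simp add: higgs_def derivation_ext_def higgs1_dual_def)
  ultimately show ?thesis
    using DERIV_imp_deriv by (fastforce simp: mult_ac)
qed

text \<open>Moving the first argument to position \<open>l\<close> passes \<open>l\<close> other arguments.\<close>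

lemma alt_move_update:
  assumes "f \<in> alt_forms i V" "l < length ws"
  shows "(-1) ^ l * f (v # drop_nth l ws) u = f (ws[l := v]) u"
proof -
  have "f (v # take l ws @ drop (Suc l) ws) u = (-1) ^ l * f (take l ws @ v # drop (Suc l) ws) u"
    using alt_move[OF assms(1), of "[]" v "take l ws" "drop (Suc l) ws" u] assms(2) by simp
  then show ?thesis
    using assms(2) by (simp add: drop_nth_def upd_conv_take_nth_drop mult.assoc[symmetric] power_mult_distrib[symmetric])
qed

text \<open>Cartan's formula \<open>d \<iota> + \<iota> d = \<L>\<close> for a closed form, with the Lie derivative expressed as the
  derivative of the pullback along the dilations.\<close>

lemma wedge_higgs_contraction:
  fixes q :: "'n::finite form"
  assumes q: "q \<in> alt_forms i (hpoly k)" and closed: "wedge_higgs q = (\<lambda>_ _. 0)"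
    and F: "((\<lambda>a. q (map (dilate B a) ws) (dual_map 1 (dilate B a) u)) has_field_derivative F') (at a)"
  shows "wedge_higgs (contraction B a q) ws u = u $ None * F'"
proof -
  let ?S = "dilate B a" and ?D = "\<lambda>u. dual_map 1 (dilate B a) u"
  have val: "q xs \<in> hpoly k" for xs by (rule alt_val[OF q]) simp
  have valD: "(\<lambda>u. q xs (?D u)) \<in> hpoly k" for xs
    by (rule dual_map_wpoly[OF clinear_dilate _ val]) simp
  have valm: "(\<lambda>u. u $ Some j * q xs (?D u)) \<in> wpoly (\<lambda>_. 0) (1 + k) (0 + 0)" for xs j
    by (intro wpoly_mult valD wpoly_var) simp
  have h: "higgs w (contraction B a q vs) u
      = (\<Sum>j\<in>B. u $ None * w $ j * q (axis j 1 # map ?S vs) (?D u))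
      + (\<Sum>j\<in>B. u $ Some j * higgs (?S w) (q (axis j 1 # map ?S vs)) (?D u))" for w vs
  proof -
    have "higgs w (contraction B a q vs) u = (\<Sum>j\<in>B. higgs w (\<lambda>u. u $ Some j * q (axis j 1 # map ?S vs) (?D u)) u)"
      using higgs_sum[where I=B and c="\<lambda>_. 1" and w=w and p="\<lambda>j u. u $ Some j * q (axis j 1 # map ?S vs) (?D u)", OF valm]
      by (simp add: contraction_def[abs_def])
    also have "\<dots> = (\<Sum>j\<in>B. u $ None * w $ j * q (axis j 1 # map ?S vs) (?D u) + u $ Some j * higgs (?S w) (q (axis j 1 # map ?S vs)) (?D u))"
      by (intro sum.cong refl) (simp add: higgs_var_mult[OF valD] higgs_pullback[OF clinear_dilate])
    finally show ?thesis by (simp add: sum.distrib)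
  qed
  have 1: "(\<Sum>l<length ws. (-1) ^ l * (\<Sum>j\<in>B. u $ None * (ws ! l) $ j * q (axis j 1 # map ?S (drop_nth l ws)) (?D u)))
     = u $ None * (\<Sum>l<length ws. q ((map ?S ws)[l := restr B (ws ! l)]) (?D u))"
    unfolding sum_distrib_left
  proof (intro sum.cong refl)
    fix l assume l: "l \<in> {..<length ws}"
    have "(\<Sum>j\<in>B. (-1) ^ l * (u $ None * (ws ! l) $ j * q (axis j 1 # map ?S (drop_nth l ws)) (?D u)))
        = u $ None * ((-1) ^ l * (\<Sum>j\<in>B. (ws ! l) $ j * q (axis j 1 # drop_nth l (map ?S ws)) (?D u)))"
      by (simp add: map_drop_nth sum_distrib_left mult_ac)
    also have "(\<Sum>j\<in>B. (ws ! l) $ j * q (axis j 1 # drop_nth l (map ?S ws)) (?D u)) = q (restr B (ws ! l) # drop_nth l (map ?S ws)) (?D u)"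
      unfolding restr_sum alt_sum_app[OF q, of "[]", unfolded append_Nil] ..
    also have "(-1) ^ l * q (restr B (ws ! l) # drop_nth l (map ?S ws)) (?D u) = q ((map ?S ws)[l := restr B (ws ! l)]) (?D u)"
      using l by (intro alt_move_update[OF q]) simp
    finally show "(\<Sum>j\<in>B. (-1) ^ l * (u $ None * (ws ! l) $ j * q (axis j 1 # map ?S (drop_nth l ws)) (?D u)))
       = u $ None * q ((map ?S ws)[l := restr B (ws ! l)]) (?D u)" .
  qed
  have 2: "(\<Sum>l<length ws. (-1) ^ l * (\<Sum>j\<in>B. u $ Some j * higgs (?S (ws ! l)) (q (axis j 1 # map ?S (drop_nth l ws))) (?D u)))
     = u $ None * (\<Sum>j\<in>B. u $ Some j * partial (Some j) (q (map ?S ws)) (?D u))"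
  proof -
    have "(\<Sum>l<length ws. (-1) ^ l * (\<Sum>j\<in>B. u $ Some j * higgs (?S (ws ! l)) (q (axis j 1 # map ?S (drop_nth l ws))) (?D u)))
      = (\<Sum>j\<in>B. u $ Some j * wedge_higgs (\<lambda>vs. q (axis j 1 # vs)) (map ?S ws) (?D u))"
      unfolding wedge_higgs_def sum_distrib_left
      by (subst sum.swap) (intro sum.cong refl; simp add: map_drop_nth mult_ac)
    also have "\<dots> = (\<Sum>j\<in>B. u $ Some j * (u $ None * partial (Some j) (q (map ?S ws)) (?D u)))"
    proof (intro sum.cong refl)
      fix j
      have "wedge_higgs q (axis j 1 # map ?S ws) (?D u) = 0" by (simp add: closed)
      then have "wedge_higgs (\<lambda>vs. q (axis j 1 # vs)) (map ?S ws) (?D u) = higgs (axis j 1) (q (map ?S ws)) (?D u)"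
        unfolding wedge_higgs_op wedge_op_Cons by simp
      then show "u $ Some j * wedge_higgs (\<lambda>vs. q (axis j 1 # vs)) (map ?S ws) (?D u) = u $ Some j * (u $ None * partial (Some j) (q (map ?S ws)) (?D u))"
        by (simp add: higgs_axis_partial[OF val])
    qed
    finally show ?thesis by (simp add: sum_distrib_left mult_ac)
  qed
  have "F' = (\<Sum>j\<in>B. u $ Some j * partial (Some j) (q (map ?S ws)) (?D u)) +
     (\<Sum>l<length ws. q ((map ?S ws)[l := restr B (ws ! l)]) (?D u))"
    using DERIV_unique[OF F pullback_dilate_derivative[OF q, of "[]" B ws u a, simplified]] .
  moreover have "wedge_higgs (contraction B a q) ws u
     = (\<Sum>l<length ws. (-1) ^ l * (\<Sum>j\<in>B. u $ None * (ws ! l) $ j * q (axis j 1 # map ?S (drop_nth l ws)) (?D u)))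
     + (\<Sum>l<length ws. (-1) ^ l * (\<Sum>j\<in>B. u $ Some j * higgs (?S (ws ! l)) (q (axis j 1 # map ?S (drop_nth l ws))) (?D u)))"
    by (simp add: wedge_higgs_def h distrib_left sum.distrib)
  ultimately show ?thesis unfolding 1 2 by (simp add: algebra_simps)
qed

lemma dilate_1 [simp]: "dilate B 1 = id"
  by (simp add: dilate_def fun_eq_iff vec_eq_iff)

lemma dual_map_1 [simp]: "dual_map 1 id u = u"
  by (simp add: vec_eq_iff dual_map_def split: option.split)

lemma contraction_forms:
  fixes q :: "'n::finite form"
  assumes q: "\<And>j. j \<in> B \<Longrightarrow> (\<lambda>ws. q (axis j 1 # ws)) \<in> alt_forms i (wpoly \<omega> k (m - \<omega> (Some j)))"
  shows "contraction B a q \<in> alt_forms i (wpoly \<omega> (Suc k) m)"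
proof -
  have *: "(\<lambda>ws u. u $ Some j * pullback 1 (dilate B a) (\<lambda>ws. q (axis j 1 # ws)) ws u) \<in> alt_forms i (wpoly \<omega> (Suc k) m)"
    if "j \<in> B" for j
  proof -
    have p: "pullback 1 (dilate B a) (\<lambda>ws. q (axis j 1 # ws)) \<in> alt_forms i (wpoly \<omega> k (m - \<omega> (Some j)))"
      by (rule alt_pullback[OF q[OF that] clinear_dilate csubspace_wpoly], rule dual_map_wpoly[OF clinear_dilate])
         (auto simp: dilate_def axis_def split: if_splits)
    show ?thesis
    proof (rule alt_forms_map[OF p csubspace_wpoly])
      fix p assume "p \<in> wpoly \<omega> k (m - \<omega> (Some j))"
      from wpoly_mult[OF wpoly_var[of \<omega> "Some j", OF order_refl] this]
      show "(\<lambda>u. u $ Some j * p u) \<in> wpoly \<omega> (Suc k) m" by simp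
    qed (simp add: fun_eq_iff algebra_simps)
  qed
  have "(\<lambda>ws u. \<Sum>j\<in>I. u $ Some j * pullback 1 (dilate B a) (\<lambda>ws. q (axis j 1 # ws)) ws u) \<in> alt_forms i (wpoly \<omega> (Suc k) m)"
    if "I \<subseteq> B" for I
  proof -
    have "finite I" by simp
    then show ?thesis using that
    proof (induction I rule: finite_induct)
      case empty
      then show ?case by (simp add: alt_forms_zero csubspace_wpoly)
    next
      case (insert j I)
      then show ?case
        using alt_forms_lincomb[OF *[of j] _ csubspace_wpoly, of _ 1 1] by simp
    qed
  qed
  from this[of B] show ?thesis by (simp add: contraction_def[abs_def] pullback_def)
qed

lemma homotopy_forms:
  assumes "\<And>j. j \<in> B \<Longrightarrow> (\<lambda>ws. q (axis j 1 # ws)) \<in> alt_forms i (wpoly \<omega> k (m - \<omega> (Some j)))"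
  shows "homotopy d B q \<in> alt_forms i (wpoly \<omega> (Suc k) m)"
proof -
  have "(\<lambda>ws u. \<Sum>r\<in>I. quad_weight d r * contraction B (quad_node d r) q ws u) \<in> alt_forms i (wpoly \<omega> (Suc k) m)"
    if "finite I" for I
    using that
  proof (induction I rule: finite_induct)
    case empty
    then show ?case by (simp add: alt_forms_zero csubspace_wpoly)
  next
    case (insert r I)
    then show ?case
      using alt_forms_lincomb[OF contraction_forms[of B q, OF assms] insert.IH csubspace_wpoly, where a="quad_weight d r" and b=1] by simp
  qed
  from this[of "{..d}"] show ?thesis by (simp add: homotopy_def[abs_def])
qed

text \<open>The integral over \<open>a\<close> of Cartan's formula.\<close>

theorem wedge_higgs_homotopy:
  fixes q :: "'n::finite form"
  assumes q: "q \<in> alt_forms (Suc i) (hpoly k)" and closed: "wedge_higgs q = (\<lambda>_ _. 0)"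
    and d: "d \<ge> k + i"
  shows "wedge_higgs (homotopy d B q) ws u = u $ None * (q ws u - pullback 1 (dilate B 0) q ws u)"
proof -
  obtain P where P: "degree P \<le> Suc d" "\<And>a. q (map (dilate B a) ws) (dual_map 1 (dilate B a) u) = poly P a"
  proof (cases "length ws = Suc i")
    case True
    obtain P where "degree P \<le> k + length ws" "\<forall>a. q ([] @ map (dilate B a) ws) (dual_map 1 (dilate B a) u) = poly P a"
      using pullback_dilate_polynomial[OF q] by blast
    then show ?thesis using that[of P] True d by simp
  next
    case False
    then show ?thesis using that[of 0] alt_len[OF q, of "map _ ws"] by simp
  qed
  have "((\<lambda>a. q (map (dilate B a) ws) (dual_map 1 (dilate B a) u)) has_field_derivative poly (pderiv P) a) (at a)" for a
    unfolding P(2) by (rule poly_DERIV)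
  from wedge_higgs_contraction[OF q closed this]
  have c: "wedge_higgs (contraction B a q) ws u = u $ None * poly (pderiv P) a" for a .
  have cv: "contraction B a q vs \<in> hpoly (Suc k)" for a vs
    by (rule alt_val[OF contraction_forms]) (use alt_contract[OF q] in auto)
  have "higgs w (homotopy d B q vs) v = (\<Sum>r\<le>d. quad_weight d r * higgs w (contraction B (quad_node d r) q vs) v)" for w vs v
    using higgs_sum[where I="{..d}" and w=w and c="quad_weight d" and p="\<lambda>r. contraction B (quad_node d r) q vs", OF cv]
    by (simp add: homotopy_def[abs_def])
  then have "wedge_higgs (homotopy d B q) ws u = (\<Sum>r\<le>d. quad_weight d r * wedge_higgs (contraction B (quad_node d r) q) ws u)"
    unfolding wedge_higgs_def sum_distrib_left by (simp add: sum_distrib_left) (subst sum.swap, simp add: mult_ac)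
  also have "\<dots> = u $ None * (\<Sum>r\<le>d. quad_weight d r * poly (pderiv P) (quad_node d r))"
    unfolding c sum_distrib_left by (simp add: mult_ac)
  also have "\<dots> = u $ None * (poly P 1 - poly P 0)"
    unfolding quadrature[OF P(1)] ..
  also have "\<dots> = u $ None * (q ws u - pullback 1 (dilate B 0) q ws u)"
    using P(2)[of 0] P(2)[of 1] by (simp add: pullback_def)
  finally show ?thesis .
qed

section \<open>Primitives of closed square-integrable forms\<close>

text \<open>For the part of \<open>p\<close> consisting of the monomials divisible by \<open>t\<close>, the quotient by \<open>t\<close>.\<close>

definition divt :: "nat \<Rightarrow> (complex^('n::finite option) \<Rightarrow> complex) \<Rightarrow> complex^('n option) \<Rightarrow> complex" where
  "divt k p u = (\<Sum>\<alpha>\<in>{\<alpha>\<in>degrees (Suc k). \<alpha> None \<noteq> 0}. coef (Suc k) \<alpha> p * mpow (\<alpha>(None := \<alpha> None - 1)) u)"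

abbreviation drop_t :: "complex^('n::finite option) \<Rightarrow> complex^('n option)" where
  "drop_t \<equiv> bi_scale 1 0"

lemma bi_scale_nth [simp]: "bi_scale a b u $ None = b * u $ None" "bi_scale a b u $ Some i = a * u $ Some i"
  by (simp_all add: bi_scale_def)

lemma divt_lincomb: "divt k (\<lambda>u. a * p u + b * q u) = (\<lambda>u. a * divt k p u + b * divt k q u)"
  by (simp add: divt_def[abs_def] coef_lincomb sum.distrib sum_distrib_left algebra_simps)

lemma divt_wpoly:
  assumes "p \<in> wpoly \<omega> (Suc k) m"
  shows "divt k p \<in> wpoly \<omega> k (m - \<omega> None)"
proof -
  have "(\<lambda>u. \<Sum>\<alpha>\<in>{\<alpha>\<in>degrees (Suc k). \<alpha> None \<noteq> 0}. coef (Suc k) \<alpha> p * mpow (\<alpha>(None := \<alpha> None - 1)) u) \<in> wpoly \<omega> k (m - \<omega> None)"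
  proof (rule wpoly_sum)
    fix \<alpha> :: "'a option \<Rightarrow> nat"
    assume \<alpha>: "\<alpha> \<in> {\<alpha>\<in>degrees (Suc k). \<alpha> None \<noteq> 0}"
    show "(\<lambda>u. coef (Suc k) \<alpha> p * mpow (\<alpha>(None := \<alpha> None - 1)) u) \<in> wpoly \<omega> k (m - \<omega> None)"
    proof (cases "(\<Sum>j\<in>UNIV. \<omega> j * int (\<alpha> j)) > m")
      case True
      then show ?thesis using coef_eq_0[OF assms, of \<alpha>] \<alpha> by simp
    next
      case False
      have "\<alpha>(None := \<alpha> None - 1) \<in> degs \<omega> k (m - \<omega> None)"
        using False \<alpha> by (simp add: degs_def sum_option of_nat_diff algebra_simps)
      then show ?thesis by (intro wpoly_scale mpow_wpoly)
    qed
  qed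
  then show ?thesis by (simp add: divt_def[abs_def])
qed

lemma divt:
  fixes p :: "complex^('n::finite option) \<Rightarrow> complex"
  assumes "p \<in> hpoly (Suc k)"
  shows "p u = u $ None * divt k p u + p (drop_t u)"
proof -
  have 1: "mpow \<alpha> (drop_t u) = (if \<alpha> None = 0 then mpow \<alpha> u else 0)" for \<alpha> :: "'n option \<Rightarrow> nat"
    by (auto simp: mpow_def UNIV_option_conv prod.reindex power_0_left)
  have 2: "u $ None * mpow (\<alpha>(None := \<alpha> None - 1)) u = mpow \<alpha> u" if "\<alpha> None \<noteq> 0" for \<alpha> :: "'n option \<Rightarrow> nat"
    using that unfolding var_mult_mpow by (intro arg_cong[of _ _ "\<lambda>\<alpha>. mpow \<alpha> u"]) auto
  have "p u = (\<Sum>\<alpha>\<in>degrees (Suc k). coef (Suc k) \<alpha> p * mpow \<alpha> u)"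
    by (rule coef_expand[OF assms])
  also have "\<dots> = (\<Sum>\<alpha>\<in>degrees (Suc k). if \<alpha> None \<noteq> 0 then coef (Suc k) \<alpha> p * mpow \<alpha> u else 0)
      + (\<Sum>\<alpha>\<in>degrees (Suc k). coef (Suc k) \<alpha> p * mpow \<alpha> (drop_t u))"
    unfolding sum.distrib[symmetric] by (intro sum.cong refl) (simp add: 1)
  also have "(\<Sum>\<alpha>\<in>degrees (Suc k). if \<alpha> None \<noteq> 0 then coef (Suc k) \<alpha> p * mpow \<alpha> u else 0)
      = (\<Sum>\<alpha>\<in>{\<alpha>\<in>degrees (Suc k). \<alpha> None \<noteq> 0}. coef (Suc k) \<alpha> p * mpow \<alpha> u)"
    by (rule sum.inter_filter[symmetric]) simp
  also have "\<dots> = u $ None * divt k p u"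
    unfolding divt_def sum_distrib_left
    by (intro sum.cong refl) (subst mult.left_commute, subst 2, auto)
  also have "(\<Sum>\<alpha>\<in>degrees (Suc k). coef (Suc k) \<alpha> p * mpow \<alpha> (drop_t u)) = p (drop_t u)"
    by (rule coef_expand[OF assms, symmetric])
  finally show ?thesis .
qed

lemma wpoly_drop_t: "p \<in> wpoly \<omega> k m \<Longrightarrow> (\<lambda>u. p (drop_t u)) \<in> wpoly \<omega> k m"
proof (erule wpoly_subst)
  fix j
  show "(\<lambda>u. drop_t u $ j) \<in> wpoly \<omega> 1 (\<omega> j)"
    by (cases j) (use wpoly_var[of \<omega> j, OF order_refl] in simp_all)
qed

text \<open>By continuity; this extends identities obtained after division by \<open>t\<close> to \<open>t = 0\<close>.\<close>

lemma wpoly_continuous_None: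
  fixes p :: "complex^('n::finite option) \<Rightarrow> complex"
  assumes "p \<in> wpoly \<omega> k m" "\<And>t. t \<noteq> 0 \<Longrightarrow> p (bi_scale a t u) = c"
  shows "p (bi_scale a 0 u) = c"
proof -
  have "((\<lambda>t. bi_scale a t u $ j) has_field_derivative (case j of None \<Rightarrow> u $ None | Some i \<Rightarrow> 0)) (at 0)" for j
    by (cases j) (auto intro!: derivative_eq_intros)
  from poly_curve[OF assms(1) this] have "isCont (\<lambda>t. p (bi_scale a t u)) 0"
    by (rule DERIV_isCont)
  then have "((\<lambda>t. p (bi_scale a t u)) \<longlongrightarrow> p (bi_scale a 0 u)) (at 0)"
    by (simp add: isCont_def)
  moreover have "((\<lambda>t. p (bi_scale a t u)) \<longlongrightarrow> c) (at 0)"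
    by (rule tendsto_eventually) (use assms(2) in \<open>auto simp: eventually_at_filter\<close>)
  ultimately show ?thesis by (rule tendsto_unique[OF at_neq_bot])
qed

lemma bi_scale_bi_scale [simp]: "bi_scale a b (bi_scale c d u) = bi_scale (a * c) (b * d) u"
  by (simp add: vec_eq_iff bi_scale_def split: option.split)

lemma bi_scale_1 [simp]: "bi_scale 1 1 u = u"
  by (simp add: vec_eq_iff bi_scale_def split: option.split)

text \<open>Let \<open>f = f\<^sub>0 + t q\<close>. In \<open>0 = d f\<^sub>0 + t d q\<close>, the first term does not depend on \<open>t\<close> and the second
  vanishes for \<open>t = 0\<close>.\<close>

lemma closed_drop_t:
  fixes f :: "'n::finite form"
  assumes f: "f \<in> alt_forms i (hpoly (Suc k))" and closed: "wedge_higgs f = (\<lambda>_ _. 0)"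
  shows "wedge_higgs (\<lambda>ws. divt k (f ws)) = (\<lambda>_ _. 0)" "wedge_higgs (\<lambda>ws u. f ws (drop_t u)) = (\<lambda>_ _. 0)"
proof -
  let ?q = "\<lambda>ws. divt k (f ws)" and ?g = "\<lambda>ws u. f ws (drop_t u)"
  have fv: "f ws \<in> hpoly (Suc k)" for ws by (rule alt_val[OF f]) simp
  have qv: "?q ws \<in> hpoly k" for ws using divt_wpoly[OF fv] by simp
  have gv: "?g ws \<in> hpoly (Suc k)" for ws by (rule wpoly_drop_t[OF fv])
  have tq: "(\<lambda>u. u $ None * divt k (f ws) u) \<in> hpoly (Suc k)" for ws
    using wpoly_mult[OF wpoly_var[of "\<lambda>_. 0" None 0] qv] by simp
  have ht: "higgs w (\<lambda>u. u $ None * p u) u = u $ None * higgs w p u" if "p \<in> hpoly k" for w p u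
  proof -
    have "((\<lambda>s. u $ None * p (u + s *s higgs1_dual w u)) has_field_derivative u $ None * higgs w p u) (at 0)"
      unfolding higgs_def derivation_ext_def
      using poly_line[OF that, of u "higgs1_dual w u"] by (auto intro!: derivative_eq_intros dest: DERIV_imp_deriv)
    then show ?thesis
      unfolding higgs_def derivation_ext_def by (intro DERIV_imp_deriv) (simp add: higgs1_dual_def)
  qed
  have "higgs w (f ws) u = u $ None * higgs w (?q ws) u + higgs w (?g ws) u" for w ws u
  proof -
    have "f ws = (\<lambda>u. 1 * (u $ None * ?q ws u) + 1 * ?g ws u)"
      by (rule ext) (simp only: mult_1_left divt[OF fv, symmetric])
    then have "higgs w (f ws) u = higgs w (\<lambda>u. 1 * (u $ None * ?q ws u) + 1 * ?g ws u) u"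
      by (rule arg_cong[of _ _ "\<lambda>p. higgs w p u"])
    also have "\<dots> = 1 * higgs w (\<lambda>u. u $ None * ?q ws u) u + 1 * higgs w (?g ws) u"
      by (rule higgs_lincomb[OF tq gv])
    finally show ?thesis using ht[OF qv] by simp
  qed
  then have sum0: "u $ None * wedge_higgs ?q ws u + wedge_higgs ?g ws u = 0" for ws u
    using fun_cong[OF fun_cong[OF closed, of ws], of u]
    by (simp add: wedge_higgs_def sum_distrib_left sum.distrib algebra_simps)
  \<comment> \<open>The function \<open>H\<close> is the differential of \<open>f\<^sub>0\<close> at the point with the same \<open>x\<close> and \<open>t = 1\<close>. It does not
    depend on \<open>t\<close>, and the differential of \<open>f\<^sub>0\<close> is \<open>t H\<close>.\<close>
  define H where "H ws u = wedge_higgs ?g ws (bi_scale 1 1 (u + (1 - u $ None) *s axis None 1))" for ws u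
  have g: "wedge_higgs ?g ws u = u $ None * H ws u" for ws u
  proof -
    have partial: "partial (Some i) (\<lambda>u. p (drop_t u)) u = partial (Some i) (\<lambda>u. p (drop_t u)) (u + (1 - u $ None) *s axis None 1)"
      for p :: "complex^('n option) \<Rightarrow> complex" and i u
    proof -
      have "drop_t (u + (1 - u $ None) *s axis None 1 + s *s axis (Some i) 1) = drop_t (u + s *s axis (Some i) 1)" for s
        by (simp add: vec_eq_iff bi_scale_def axis_def split: option.split)
      then show ?thesis by (simp add: partial_def)
    qed
    show ?thesis
      unfolding wedge_higgs_def H_def bi_scale_1 higgs_eq[OF gv] sum_distrib_left
      by (intro sum.cong refl) (subst partial, simp add: axis_def mult_ac)
  qed
  have Hs: "H ws (bi_scale 1 t u) = H ws u" for ws t u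
  proof -
    have "bi_scale 1 t u + (1 - bi_scale 1 t u $ None) *s axis None 1 = u + (1 - u $ None) *s axis None 1"
      by (auto simp: vec_eq_iff bi_scale_def axis_def split: option.split)
    then show ?thesis by (simp only: H_def bi_scale_1)
  qed
  have wq: "wedge_higgs ?q ws \<in> hpoly k" for ws
    unfolding wedge_higgs_op by (intro wedge_op_value csubspace_wpoly higgs_wpoly[OF qv]) simp
  have K: "wedge_higgs ?q ws u = - H ws u" if "u $ None \<noteq> 0" for ws u
    
  proof -
    have "u $ None * (wedge_higgs ?q ws u + H ws u) = 0"
      using sum0[of u ws] unfolding g by (simp only: distrib_left)
    then show ?thesis using that by (simp add: eq_neg_iff_add_eq_0)
  qed
  have K0: "wedge_higgs ?q ws u = 0" if "u $ None = 0" for ws u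
    unfolding wedge_higgs_def higgs_eq[OF qv] using that by simp
  have "H ws u = 0" if "u $ None \<noteq> 0" for ws u
  proof -
    have "wedge_higgs ?q ws (bi_scale 1 0 u) = - H ws u"
      by (rule wpoly_continuous_None[OF wq]) (use K[of "bi_scale 1 _ u" ws] that in \<open>simp add: Hs\<close>)
    moreover have "wedge_higgs ?q ws (bi_scale 1 0 u) = 0" by (rule K0) simp
    ultimately show ?thesis by simp
  qed
  then have "wedge_higgs ?q ws u = 0" "wedge_higgs ?g ws u = 0" for ws u
    using K[of u ws] K0[of u ws] g[of ws u] by (cases "u $ None = 0"; simp)+
  then show "wedge_higgs ?q = (\<lambda>_ _. 0)" "wedge_higgs ?g = (\<lambda>_ _. 0)"
    by (intro ext; simp)+
qed

text \<open>The first summand integrates in the direction of \<open>x\<^sub>1\<close>, and the second one integrates what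
  remains, the restriction to \<open>x\<^sub>1 = 0\<close>, in all directions.\<close>

definition primitive :: "nat \<Rightarrow> nat \<Rightarrow> 'n::finite form \<Rightarrow> 'n form" where
  "primitive i k f ws u = homotopy (k + i) {i\<^sub>1} (\<lambda>ws. divt k (f ws)) ws u
     + homotopy (k + i) UNIV (pullback 1 (dilate {i\<^sub>1} 0) (\<lambda>ws. divt k (f ws))) ws u"

lemma divt_forms:
  assumes "f \<in> alt_forms i (wpoly \<omega> (Suc k) m)"
  shows "(\<lambda>ws. divt k (f ws)) \<in> alt_forms i (wpoly \<omega> k (m - \<omega> None))"
  by (rule alt_forms_map[OF assms csubspace_wpoly divt_wpoly divt_lincomb])

lemma primitive_forms:
  assumes f: "f \<in> alt_forms (Suc i) (hpoly (Suc k))"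
  shows "primitive i k f \<in> alt_forms i (hpoly (Suc k))"
proof -
  have q: "(\<lambda>ws. divt k (f ws)) \<in> alt_forms (Suc i) (hpoly k)"
    using divt_forms[OF f] by simp
  have 1: "homotopy (k + i) {i\<^sub>1} (\<lambda>ws. divt k (f ws)) \<in> alt_forms i (hpoly (Suc k))"
    by (rule homotopy_forms) (use alt_contract[OF q] in simp)
  have 2: "homotopy (k + i) UNIV (pullback 1 (dilate {i\<^sub>1} 0) (\<lambda>ws. divt k (f ws))) \<in> alt_forms i (hpoly (Suc k))"
    by (rule homotopy_forms) (use alt_contract[OF alt_pullback_sym[OF q clinear_dilate]] in simp)
  show ?thesis
    using alt_forms_lincomb[OF 1 2 csubspace_wpoly, of 1 1] by (simp add: primitive_def[abs_def])
qed

text \<open>The two homotopy formulas add up telescopically: the first leaves the restriction of \<open>q\<close> to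
  \<open>x\<^sub>1 = 0\<close>, and the second leaves the pullback to the origin, which vanishes in positive degree.\<close>

theorem wedge_higgs_primitive:
  assumes f: "f \<in> alt_forms (Suc i) (hpoly (Suc k))" and closed: "wedge_higgs f = (\<lambda>_ _. 0)"
  shows "wedge_higgs (primitive i k f) ws u = f ws u - f ws (drop_t u)"
proof -
  let ?q = "\<lambda>ws. divt k (f ws)" and ?p = "pullback 1 (dilate {i\<^sub>1} 0)"
  have q: "?q \<in> alt_forms (Suc i) (hpoly k)"
    using divt_forms[OF f] by simp
  have cq: "wedge_higgs ?q = (\<lambda>_ _. 0)" by (rule closed_drop_t[OF f closed])
  have pq: "?p ?q \<in> alt_forms (Suc i) (hpoly k)" by (rule alt_pullback_sym[OF q clinear_dilate])
  have cpq: "wedge_higgs (?p ?q) = (\<lambda>_ _. 0)"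
    unfolding wedge_higgs_pullback[OF clinear_dilate] cq by (simp add: pullback_def fun_eq_iff)
  have "homotopy (k + i) {i\<^sub>1} ?q \<in> alt_forms i (hpoly (Suc k))"
    by (rule homotopy_forms) (use alt_contract[OF q] in simp)
  then have h1: "homotopy (k + i) {i\<^sub>1} ?q ws \<in> hpoly (Suc k)" for ws
    by (rule alt_val) simp
  have "homotopy (k + i) UNIV (?p ?q) \<in> alt_forms i (hpoly (Suc k))"
    by (rule homotopy_forms) (use alt_contract[OF pq] in simp)
  then have h2: "homotopy (k + i) UNIV (?p ?q) ws \<in> hpoly (Suc k)" for ws
    by (rule alt_val) simp
  have "wedge_higgs (primitive i k f) ws u
      = wedge_higgs (homotopy (k + i) {i\<^sub>1} ?q) ws u + wedge_higgs (homotopy (k + i) UNIV (?p ?q)) ws u"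
    using wedge_op_lincomb[OF form_op_higgs h1 h2, where a=1 and b=1 and ws=ws and u=u]
    by (simp add: primitive_def[abs_def] wedge_higgs_op)
  also have "\<dots> = u $ None * (?q ws u - pullback 1 (dilate UNIV 0) (?p ?q) ws u)"
    unfolding wedge_higgs_homotopy[OF q cq order_refl] wedge_higgs_homotopy[OF pq cpq order_refl]
    by (simp add: algebra_simps)
  also have "pullback 1 (dilate UNIV 0) (?p ?q) ws u = 0"
  proof (cases ws)
    case Nil
    then have "?q [] = (\<lambda>_. 0)" by (intro alt_len[OF q]) simp
    then show ?thesis using Nil by (simp add: pullback_def fun_eq_iff)
  next
    case (Cons w ws')
    have "dilate UNIV 0 w = 0" by (simp add: dilate_def vec_eq_iff)
    then have "?p ?q (map (dilate UNIV 0) ws) = (\<lambda>_. 0)"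
      using Cons by (intro alt_zero_entry[OF pq]) simp
    then show ?thesis by (simp add: pullback_def[of _ "dilate UNIV 0"] fun_eq_iff)
  qed
  also have "u $ None * (?q ws u - 0) = f ws u - f ws (drop_t u)"
  proof -
    have "f ws \<in> hpoly (Suc k)" by (rule alt_val[OF f]) simp
    from divt[OF this, of u] show ?thesis by simp
  qed
  finally show ?thesis .
qed

text \<open>Division by \<open>t\<close> raises weights by one. In the first summand, the contraction only involves values
  of \<open>q\<close> with the argument \<open>e\<^sub>1\<close>, which have weight at most \<open>-1\<close>, and multiplies them by \<open>x\<^sub>1\<close>, of
  weight \<open>1\<close>. The second summand does not involve \<open>x\<^sub>1\<close>, so it has weight at most \<open>0\<close>. Both summands
  vanish when \<open>e\<^sub>1\<close> is among the arguments.\<close>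

lemma primitive_l2:
  fixes f :: "'n::finite form"
  assumes f: "f \<in> l2_forms (Suc k) (Suc i)"
  shows "primitive i k f \<in> l2_forms (Suc k) i"
proof -
  let ?q = "\<lambda>ws. divt k (f ws)" and ?p = "pullback 1 (dilate {i\<^sub>1} 0)" and ?e = "axis i\<^sub>1 1 :: complex^'n"
  \<comment> \<open>With this weight, weight at most \<open>0\<close> means not involving \<open>x\<^sub>1\<close>.\<close>
  define \<omega> :: "'n option \<Rightarrow> int" where "\<omega> j = (if j = Some i\<^sub>1 then 1 else 0)" for j
  have f0: "f \<in> alt_forms (Suc i) (wpoly cusp_wt (Suc k) 0)"
    and fe: "\<And>ws. ?e \<in> set ws \<Longrightarrow> f ws \<in> wpoly cusp_wt (Suc k) (-2)"
    using f unfolding l2_forms_iff by auto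
  have q: "?q \<in> alt_forms (Suc i) (wpoly cusp_wt k 1)"
    using divt_forms[OF f0] by simp
  have qe: "?q ws \<in> wpoly cusp_wt k (-1)" if "?e \<in> set ws" for ws
    using divt_wpoly[OF fe[OF that]] by simp
  have "(\<lambda>ws. ?q (?e # ws)) \<in> alt_forms i (wpoly cusp_wt k (-1))"
    by (rule alt_mono[OF alt_contract[OF q]]) (rule qe, simp)
  then have 1: "homotopy (k + i) {i\<^sub>1} ?q \<in> alt_forms i (wpoly cusp_wt (Suc k) 0)"
    by (intro homotopy_forms) simp
  have q': "?q \<in> alt_forms (Suc i) (hpoly k)"
    using divt_forms[OF l2_forms_alt[OF f]] by simp
  have pq: "?p ?q \<in> alt_forms (Suc i) (wpoly \<omega> k 0)"
  proof (rule alt_pullback[OF q' clinear_dilate csubspace_wpoly], erule wpoly_subst)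
    fix j
    show "(\<lambda>u. dual_map 1 (dilate {i\<^sub>1} 0) u $ j) \<in> wpoly \<omega> 1 0"
    proof (cases j)
      case None
      then show ?thesis using wpoly_var[of \<omega> j 0] by (simp add: \<omega>_def)
    next
      case (Some i)
      then show ?thesis using wpoly_var[of \<omega> j 0] by (cases "i = i\<^sub>1") (auto simp: dilate_def \<omega>_def)
    qed
  qed
  have e0: "dilate {i\<^sub>1} 0 ?e = 0" by (simp add: dilate_axis)
  have pqe: "?p ?q ws = (\<lambda>_. 0)" if "?e \<in> set ws" for ws
  proof -
    have "0 \<in> set (map (dilate {i\<^sub>1} 0) ws)" using that e0 by force
    from alt_zero_entry[OF q' this] show ?thesis by (simp add: pullback_def fun_eq_iff)
  qed
  have "(\<lambda>ws. ?p ?q (axis j 1 # ws)) \<in> alt_forms i (wpoly \<omega> k (0 - \<omega> (Some j)))" for j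
  proof (cases "j = i\<^sub>1")
    case True
    then show ?thesis
      by (intro alt_mono[OF alt_contract[OF pq]]) (simp add: pqe)
  next
    case False
    then show ?thesis using alt_contract[OF pq] by (simp add: \<omega>_def)
  qed
  then have 2: "homotopy (k + i) UNIV (?p ?q) \<in> alt_forms i (wpoly \<omega> (Suc k) 0)"
    by (intro homotopy_forms) blast
  have 2: "homotopy (k + i) UNIV (?p ?q) \<in> alt_forms i (wpoly cusp_wt (Suc k) 0)"
  proof (rule alt_mono[OF 2], rule wpoly_subset)
    show "degs \<omega> (Suc k) 0 \<subseteq> degs cusp_wt (Suc k) 0"
      by (auto simp: degs_def cusp_wt_sum \<omega>_def if_distrib[of "\<lambda>x. x * _"] sum.delta cong: if_cong)
    show "homotopy (k + i) UNIV (?p ?q) ws \<in> wpoly \<omega> (Suc k) 0" for ws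
      by (rule alt_val[OF 2]) simp
  qed
  have sc: "dilate B a ?e = (if i\<^sub>1 \<in> B then a else 1) *s ?e" for B a
    by (simp add: dilate_axis)
  have e1: "homotopy (k + i) {i\<^sub>1} ?q ws = (\<lambda>_. 0)" if "?e \<in> set ws" for ws
  proof -
    have "?q (?e # map (dilate {i\<^sub>1} a) ws) = (\<lambda>_. 0)" for a
      by (rule alt_repeated_entry[OF q' that, of "dilate {i\<^sub>1} a" a]) (simp add: sc)
    then show ?thesis by (simp add: homotopy_def[abs_def] contraction_def fun_eq_iff)
  qed
  have e2: "homotopy (k + i) UNIV (?p ?q) ws = (\<lambda>_. 0)" if e: "?e \<in> set ws" for ws
  proof -
    have "?p ?q (axis j 1 # map (dilate UNIV a) ws) v = 0" for j a v
    proof -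
      obtain xs ys where ws: "ws = xs @ ?e # ys" using e by (meson split_list)
      have "?p ?q (axis j 1 # map (dilate UNIV a) ws) v = a * ?p ?q ((axis j 1 # map (dilate UNIV a) xs) @ ?e # map (dilate UNIV a) ys) v"
        using alt_scale_entry[OF pq, of "axis j 1 # map (dilate UNIV a) xs" a ?e "map (dilate UNIV a) ys" v] ws
        by (simp add: sc)
      also have "\<dots> = 0" by (subst pqe) simp_all
      finally show ?thesis .
    qed
    then show ?thesis by (simp add: homotopy_def[abs_def] contraction_def fun_eq_iff)
  qed
  show ?thesis
    unfolding l2_forms_iff
  proof (intro conjI allI impI)
    show "primitive i k f \<in> alt_forms i (wpoly cusp_wt (Suc k) 0)"
      using alt_forms_lincomb[OF 1 2 csubspace_wpoly, of 1 1] by (simp add: primitive_def[abs_def])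
    show "primitive i k f ws \<in> wpoly cusp_wt (Suc k) (-2)" if "?e \<in> set ws" for ws
      using e1[OF that] e2[OF that] by (simp add: primitive_def[abs_def])
  qed
qed

section \<open>The extreme summands\<close>

lemma sym_power_homogeneous:
  assumes "p \<in> hpoly k"
  shows "p (bi_scale a a u) = a ^ k * p u"
  using assms
proof (induction rule: wpoly_induct)
  case (mpow \<alpha>)
  have "bi_scale a a u $ j = a * u $ j" for j by (cases j) simp_all
  then show ?case using mpow
    by (simp add: mpow_def degs_def power_mult_distrib prod.distrib power_sum[symmetric])
qed (simp_all add: algebra_simps)

lemma sym_summand_top_iff:
  "p \<in> sym_summand k k \<longleftrightarrow> p \<in> hpoly k \<and> (\<forall>u. p (drop_t u) = p u)"
proof
  assume "p \<in> sym_summand k k"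
  then have p: "p \<in> sym_power k" "\<forall>a b u. p (bi_scale a b u) = a ^ k * b ^ (k - k) * p u"
    unfolding sym_summand_def by auto
  then show "p \<in> hpoly k \<and> (\<forall>u. p (drop_t u) = p u)"
    by (simp add: sym_power_wpoly)
next
  assume A: "p \<in> hpoly k \<and> (\<forall>u. p (drop_t u) = p u)"
  have "p (bi_scale a b u) = a ^ k * p u" for a b u
  proof -
    have "p (bi_scale a b u) = p (bi_scale a 0 u)"
      using A[THEN conjunct2, rule_format, of "bi_scale a b u"] by simp
    also have "\<dots> = p (bi_scale a a u)"
      using A[THEN conjunct2, rule_format, of "bi_scale a a u"] by simp
    also have "\<dots> = a ^ k * p u" using A by (intro sym_power_homogeneous) blast
    finally show ?thesis .
  qed
  then show "p \<in> sym_summand k k" using A by (simp add: sym_summand_def sym_power_wpoly)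
qed

lemma sym_summand_0_iff:
  "p \<in> sym_summand k 0 \<longleftrightarrow> p \<in> hpoly k \<and> (\<forall>u. p (bi_scale 0 1 u) = p u)"
proof
  assume "p \<in> sym_summand k 0"
  then have p: "p \<in> sym_power k" "\<forall>a b u. p (bi_scale a b u) = a ^ 0 * b ^ (k - 0) * p u"
    unfolding sym_summand_def by auto
  then show "p \<in> hpoly k \<and> (\<forall>u. p (bi_scale 0 1 u) = p u)"
    by (simp add: sym_power_wpoly)
next
  assume A: "p \<in> hpoly k \<and> (\<forall>u. p (bi_scale 0 1 u) = p u)"
  have "p (bi_scale a b u) = b ^ k * p u" for a b u
  proof -
    have "p (bi_scale a b u) = p (bi_scale 0 b u)"
      using A[THEN conjunct2, rule_format, of "bi_scale a b u"] by simp
    also have "\<dots> = p (bi_scale b b u)"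
      using A[THEN conjunct2, rule_format, of "bi_scale b b u"] by simp
    also have "\<dots> = b ^ k * p u" using A by (intro sym_power_homogeneous) blast
    finally show ?thesis .
  qed
  then show "p \<in> sym_summand k 0" using A by (simp add: sym_summand_def sym_power_wpoly)
qed

lemma higgs_sym_summand_0:
  assumes "p \<in> sym_summand k 0"
  shows "higgs w p = (\<lambda>_. 0)"
proof
  fix u
  have p: "p (bi_scale 0 1 v) = p v" for v using assms sym_summand_0_iff by blast
  have "bi_scale 0 1 (u + s *s higgs1_dual w u) = bi_scale 0 1 u" for s
    by (simp add: vec_eq_iff bi_scale_def higgs1_dual_def split: option.split)
  then have "p (u + s *s higgs1_dual w u) = p u" for s by (metis p)
  then show "higgs w p u = 0" by (simp add: higgs_def derivation_ext_def)
qed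

text \<open>For \<open>t \<noteq> 0\<close>, the derivative of \<open>a \<mapsto> p(a x, t)\<close> vanishes; for \<open>t = 0\<close>, use continuity.\<close>

lemma closed_sym_summand_0:
  fixes p :: "complex^('n::finite option) \<Rightarrow> complex"
  assumes p: "p \<in> hpoly k" and closed: "\<And>w. higgs w p = (\<lambda>_. 0)"
  shows "p \<in> sym_summand k 0"
  unfolding sym_summand_0_iff
proof (intro conjI allI p)
  have *: "p (bi_scale 0 1 u) = p u" if "u $ None \<noteq> 0" for u
  proof -
    have "((\<lambda>a. p (bi_scale a 1 u)) has_field_derivative 0) (at a)" for a
    proof -
      have "((\<lambda>a. bi_scale a 1 u $ j) has_field_derivative (case j of None \<Rightarrow> 0 | Some i \<Rightarrow> u $ Some i)) (at a)" for j
        by (cases j) (auto intro!: derivative_eq_intros)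
      from poly_curve[OF p this]
      have "((\<lambda>a. p (bi_scale a 1 u)) has_field_derivative (\<Sum>i\<in>UNIV. u $ Some i * partial (Some i) p (bi_scale a 1 u))) (at a)"
        by (simp add: sum_option)
      moreover have "higgs (\<chi> i. u $ Some i) p (bi_scale a 1 u) = 0" by (simp add: closed)
      then have "(\<Sum>i\<in>UNIV. u $ Some i * partial (Some i) p (bi_scale a 1 u)) = 0"
        using that by (simp add: higgs_eq[OF p])
      ultimately show ?thesis by simp
    qed
    then obtain c where "\<And>a. p (bi_scale a 1 u) = c"
      using has_field_derivative_zero_constant[of UNIV "\<lambda>a. p (bi_scale a 1 u)"] by auto
    from this[of 0] this[of 1] show ?thesis by simp
  qed
  fix u :: "complex^('n option)"
  \<comment> \<open>A point with the same \<open>x\<close> and \<open>t = 1\<close>, in order to approach \<open>u\<close> through points with \<open>t \<noteq> 0\<close>.\<close>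
  define v where "v = u + (1 - u $ None) *s axis None 1"
  have u: "u = bi_scale 1 (u $ None) v"
    by (simp add: v_def vec_eq_iff bi_scale_def axis_def split: option.split)
  show "p (bi_scale 0 1 u) = p u"
  proof (cases "u $ None = 0")
    case False
    then show ?thesis by (rule *)
  next
    case True
    have v: "v $ None = 1" by (simp add: v_def axis_def)
    have "(\<lambda>w. p (bi_scale 0 1 w)) \<in> hpoly k"
    proof (rule wpoly_subst[OF p])
      fix j
      show "(\<lambda>w. bi_scale 0 1 w $ j) \<in> wpoly (\<lambda>_. 0) 1 0"
        by (cases j) (use wpoly_var[of "\<lambda>_. 0" j 0] in simp_all)
    qed
    then have d: "(\<lambda>w. 1 * p (bi_scale 0 1 w) + (-1) * p w) \<in> hpoly k"
      by (rule wpoly_lincomb[OF _ p])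
    have "(\<lambda>w. 1 * p (bi_scale 0 1 w) + (-1) * p w) (bi_scale 1 0 v) = 0"
      by (rule wpoly_continuous_None[OF d]) (use *[of "bi_scale 1 _ v"] v in simp)
    then show ?thesis using u True by simp
  qed
qed

lemma sym_summand_0_cusp:
  assumes "p \<in> sym_summand k 0"
  shows "p \<in> wpoly cusp_wt k 0"
proof -
  have p: "p \<in> hpoly k" "\<And>u. p (bi_scale 0 1 u) = p u"
    using assms sym_summand_0_iff by blast+
  have "(\<lambda>u. p (bi_scale 0 1 u)) \<in> wpoly cusp_wt k 0"
  proof (rule wpoly_subst[OF p(1)])
    fix j
    show "(\<lambda>w. bi_scale 0 1 w $ j) \<in> wpoly cusp_wt 1 0"
      by (cases j) (use wpoly_var[of cusp_wt j 0] in simp_all)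
  qed
  then show ?thesis by (simp add: p(2))
qed

section \<open>Holomorphic functions of several variables\<close>

definition holo_at :: "complex^'n::finite \<Rightarrow> (complex^'n \<Rightarrow> complex) \<Rightarrow> bool" where
  "holo_at z f \<longleftrightarrow> (\<exists>f'. (f has_derivative f') (at z) \<and> (\<forall>a v. f' (a *s v) = a * f' v))"

lemma holo_on_iff: "holo_on S f \<longleftrightarrow> (\<forall>z\<in>S. holo_at z f)"
  by (simp add: holo_on_def holo_at_def)

lemma holo_atI: "(f has_derivative f') (at z) \<Longrightarrow> (\<And>a v. f' (a *s v) = a * f' v) \<Longrightarrow> holo_at z f"
  unfolding holo_at_def by blast

abbreviation dderiv :: "(complex^'n::finite \<Rightarrow> complex) \<Rightarrow> complex^'n \<Rightarrow> complex^'n \<Rightarrow> complex" where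
  "dderiv f z \<equiv> frechet_derivative f (at z)"

lemma holo_at_frechet:
  assumes "holo_at z f"
  shows "(f has_derivative dderiv f z) (at z)" "dderiv f z (a *s v) = a * dderiv f z v"
    "dderiv f z (v + w) = dderiv f z v + dderiv f z w"
proof -
  obtain f' where f': "(f has_derivative f') (at z)" "\<And>a v. f' (a *s v) = a * f' v"
    using assms unfolding holo_at_def by blast
  then have "dderiv f z = f'" by (metis frechet_derivative_at)
  then show "(f has_derivative dderiv f z) (at z)" "dderiv f z (a *s v) = a * dderiv f z v"
    "dderiv f z (v + w) = dderiv f z v + dderiv f z w"
    using f' has_derivative_bounded_linear[OF f'(1)] by (auto simp: linear_simps)
qed

lemma dderiv_eq: "(f has_derivative f') (at z) \<Longrightarrow> dderiv f z = f'"
  by (metis frechet_derivative_at)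

lemma dderiv_sum:
  assumes "holo_at z f"
  shows "dderiv f z (\<Sum>i\<in>I. c i *s v i) = (\<Sum>i\<in>I. c i * dderiv f z (v i))"
proof (induction I rule: infinite_finite_induct)
  case (insert i I)
  then show ?case by (simp add: holo_at_frechet[OF assms])
qed (use has_derivative_bounded_linear[OF holo_at_frechet(1)[OF assms]] in \<open>auto simp: linear_simps\<close>)

lemma dderiv_axis:
  assumes "holo_at z f"
  shows "dderiv f z v = (\<Sum>i\<in>UNIV. v $ i * dderiv f z (axis i 1))"
  using dderiv_sum[OF assms, of "\<lambda>i. v $ i" "\<lambda>i. axis i 1" UNIV] by (simp add: basis_expansion)

lemma holo_at_cong:
  assumes "open U" "z \<in> U" "\<And>w. w \<in> U \<Longrightarrow> f w = g w" "holo_at z f"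
  shows "holo_at z g"
  using assms unfolding holo_at_def by (metis has_derivative_transform_within_open)

lemma holo_at_const [simp]: "holo_at z (\<lambda>_. c)"
  by (rule holo_atI[OF has_derivative_const]) simp

lemma bounded_linear_coord: "bounded_linear (\<lambda>z. z $ i :: complex)"
  by (rule bounded_linear_vec_nth)

lemma coord_has_derivative: "((\<lambda>z. z $ i) has_derivative (\<lambda>v. v $ i)) (at (z::complex^'n::finite))"
  by (rule bounded_linear.has_derivative[OF bounded_linear_coord has_derivative_ident])

lemma holo_at_coord [simp]: "holo_at z (\<lambda>z. z $ i)"
  by (rule holo_atI[OF coord_has_derivative]) simp

lemma holo_at_add:
  assumes "holo_at z f" "holo_at z g"
  shows "holo_at z (\<lambda>z. f z + g z)"
  by (rule holo_atI[OF has_derivative_add[OF holo_at_frechet(1)[OF assms(1)] holo_at_frechet(1)[OF assms(2)]]])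
     (simp add: holo_at_frechet[OF assms(1)] holo_at_frechet[OF assms(2)] algebra_simps)

lemma holo_at_mult:
  assumes "holo_at z f" "holo_at z g"
  shows "holo_at z (\<lambda>z. f z * g z)"
  by (rule holo_atI[OF has_derivative_mult[OF holo_at_frechet(1)[OF assms(1)] holo_at_frechet(1)[OF assms(2)]]])
     (simp add: holo_at_frechet[OF assms(1)] holo_at_frechet[OF assms(2)] algebra_simps)

lemma holo_at_sum: "(\<And>i. i \<in> I \<Longrightarrow> holo_at z (f i)) \<Longrightarrow> holo_at z (\<lambda>z. \<Sum>i\<in>I. f i z)"
  by (induction I rule: infinite_finite_induct) (auto intro: holo_at_add)

lemma holo_at_power: "holo_at z f \<Longrightarrow> holo_at z (\<lambda>z. f z ^ n)"
  by (induction n) (auto intro: holo_at_mult)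

lemma holo_at_prod: "(\<And>i. i \<in> I \<Longrightarrow> holo_at z (f i)) \<Longrightarrow> holo_at z (\<lambda>z. \<Prod>i\<in>I. f i z)"
  by (induction I rule: infinite_finite_induct) (auto intro: holo_at_mult)

lemma holo_at_divide:
  assumes "holo_at z f" "holo_at z g" "g z \<noteq> 0"
  shows "holo_at z (\<lambda>z. f z / g z)"
  by (rule holo_atI[OF has_derivative_divide'[OF holo_at_frechet(1)[OF assms(1)] holo_at_frechet(1)[OF assms(2)] assms(3)]])
     (simp add: holo_at_frechet[OF assms(1)] holo_at_frechet[OF assms(2)] algebra_simps)

lemma has_derivative_vec:
  fixes F :: "complex^'n::finite \<Rightarrow> complex^'m::finite"
  assumes "\<And>i. ((\<lambda>z. F z $ i) has_derivative (\<lambda>v. F' v $ i)) (at z)"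
  shows "(F has_derivative F') (at z)"
proof -
  have "((\<lambda>z. F z \<bullet> b) has_derivative (\<lambda>v. F' v \<bullet> b)) (at z)" if b: "b \<in> Basis" for b
  proof -
    obtain i c where "b = axis i c" using b by (auto simp: Basis_vec_def)
    then show ?thesis
      using has_derivative_inner_left[OF assms[of i], of c] by (simp add: inner_axis)
  qed
  then show ?thesis using has_derivative_componentwise_within[of F F' z UNIV] by blast
qed

lemma holo_map_has_derivative:
  fixes F :: "complex^'n::finite \<Rightarrow> complex^'m::finite"
  assumes "\<And>i. holo_at z (\<lambda>z. F z $ i)"
  shows "(F has_derivative (\<lambda>v. \<chi> i. dderiv (\<lambda>z. F z $ i) z v)) (at z)"
  using holo_at_frechet(1)[OF assms] by (intro has_derivative_vec) simp

lemma holo_at_compose: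
  fixes F :: "complex^'n::finite \<Rightarrow> complex^'m::finite"
  assumes F: "\<And>i. holo_at z (\<lambda>z. F z $ i)" and f: "holo_at (F z) f"
  shows "holo_at z (\<lambda>z. f (F z))"
proof (rule holo_atI)
  show "((\<lambda>z. f (F z)) has_derivative (\<lambda>v. dderiv f (F z) (\<chi> i. dderiv (\<lambda>z. F z $ i) z v))) (at z)"
    using diff_chain_at[OF holo_map_has_derivative[OF F] holo_at_frechet(1)[OF f]] by (simp add: o_def)
  fix a v
  have "(\<chi> i. dderiv (\<lambda>z. F z $ i) z (a *s v)) = a *s (\<chi> i. dderiv (\<lambda>z. F z $ i) z v)"
    by (simp add: vec_eq_iff holo_at_frechet(2)[OF F])
  then show "dderiv f (F z) (\<chi> i. dderiv (\<lambda>z. F z $ i) z (a *s v)) = a * dderiv f (F z) (\<chi> i. dderiv (\<lambda>z. F z $ i) z v)"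
    by (simp add: holo_at_frechet(2)[OF f])
qed

lemma holo_at_isCont: "holo_at z f \<Longrightarrow> isCont f z"
  using holo_at_frechet(1) has_derivative_continuous by (metis)

lemma holo_on_continuous: "holo_on S f \<Longrightarrow> continuous_on S f"
  by (intro continuous_at_imp_continuous_on) (simp add: holo_on_iff holo_at_isCont)

lemma isCont_vec:
  fixes F :: "'a::t2_space \<Rightarrow> complex^'m::finite"
  assumes "\<And>i. isCont (\<lambda>z. F z $ i) z"
  shows "isCont F z"
  using assms unfolding isCont_def by (rule vec_tendstoI)

text \<open>Leibniz's rule needs joint continuity of the derivative. It suffices to have it on each
  tangent vector, as there are finitely many basis vectors.\<close>

lemma holo_at_integral:
  fixes f :: "complex^'n::finite \<Rightarrow> real \<Rightarrow> complex"
  assumes U: "open U" "z0 \<in> U"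
    and f: "\<And>z t. z \<in> U \<Longrightarrow> t \<in> {0..1} \<Longrightarrow> ((\<lambda>z. f z t) has_derivative f' z t) (at z)"
    and hom: "\<And>z t a v. z \<in> U \<Longrightarrow> t \<in> {0..1} \<Longrightarrow> f' z t (a *s v) = a * f' z t v"
    and cont': "\<And>v. continuous_on (U \<times> {0..1}) (\<lambda>(z, t). f' z t v)"
    and cont: "\<And>z. z \<in> U \<Longrightarrow> continuous_on {0..1} (f z)"
  shows "holo_at z0 (\<lambda>z. integral {0..1} (f z))"
proof -
  obtain r where r: "r > 0" "ball z0 r \<subseteq> U" using U by (meson openE)
  define g where "g z t = Blinfun (f' z t)" for z t
  have g: "blinfun_apply (g z t) = f' z t" if "z \<in> U" "t \<in> {0..1}" for z t
    unfolding g_def by (intro bounded_linear_Blinfun_apply has_derivative_bounded_linear[OF f[OF that]])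
  have gc: "continuous_on (U \<times> {0..1}) (\<lambda>(z, t). g z t)"
  proof (rule continuous_on_blinfun_componentwise)
    fix i :: "complex^'n" assume "i \<in> Basis"
    show "continuous_on (U \<times> {0..1}) (\<lambda>x. blinfun_apply (case x of (z, t) \<Rightarrow> g z t) i)"
      by (rule continuous_on_eq[OF cont'[of i]]) (auto simp: g)
  qed
  have "((\<lambda>z. integral (cbox 0 1) (f z)) has_derivative blinfun_apply (integral (cbox 0 1) (g z0))) (at z0 within ball z0 r)"
  proof (rule leibniz_rule)
    show "((\<lambda>z. f z t) has_derivative blinfun_apply (g z t)) (at z within ball z0 r)"
      if "z \<in> ball z0 r" "t \<in> cbox 0 1" for z t
    proof -
      have zt: "z \<in> U" "t \<in> {0..1}" using that r by auto
      show ?thesis unfolding g[OF zt] by (rule has_derivative_at_withinI[OF f[OF zt]])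
    qed
    show "f z integrable_on cbox 0 1" if "z \<in> ball z0 r" for z
      using that r cont[of z] by (intro integrable_continuous) auto
    show "continuous_on (ball z0 r \<times> cbox 0 1) (\<lambda>(z, t). g z t)"
      by (rule continuous_on_subset[OF gc]) (use r in auto)
  qed (use r in auto)
  then have d: "((\<lambda>z. integral {0..1} (f z)) has_derivative blinfun_apply (integral {0..1} (g z0))) (at z0)"
    using r by (simp add: at_within_open[OF _ open_ball])
  have "continuous_on {0..1} (\<lambda>t. case (z0, t) of (z, t) \<Rightarrow> g z t)"
    by (rule continuous_on_compose2[OF gc]) (use U in \<open>auto intro!: continuous_intros\<close>)
  then have gi: "g z0 integrable_on {0..1}"
    by (intro integrable_continuous_interval) simp
  have ap: "blinfun_apply (integral {0..1} (g z0)) v = integral {0..1} (\<lambda>t. f' z0 t v)" for v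
  proof -
    have "integral {0..1} ((\<lambda>B. blinfun_apply B v) \<circ> g z0) = blinfun_apply (integral {0..1} (g z0)) v"
      by (rule integral_linear[OF gi]) (rule blinfun.bounded_linear_left)
    moreover have "integral {0..1} ((\<lambda>B. blinfun_apply B v) \<circ> g z0) = integral {0..1} (\<lambda>t. f' z0 t v)"
      by (rule integral_cong) (use g U in auto)
    ultimately show ?thesis by simp
  qed
  show ?thesis
  proof (rule holo_atI[OF d])
    fix a v
    have "integral {0..1} (\<lambda>t. f' z0 t (a *s v)) = integral {0..1} (\<lambda>t. a * f' z0 t v)"
      by (rule integral_cong) (use hom U in auto)
    then show "blinfun_apply (integral {0..1} (g z0)) (a *s v) = a * blinfun_apply (integral {0..1} (g z0)) v"
      unfolding ap by simp
  qed
qed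

lemma norm_cscale: "norm (a *s v :: complex^'n::finite) = cmod a * norm v"
  by (simp add: norm_vec_def norm_mult L2_set_right_distrib[symmetric])

lemma continuous_on_cscale:
  assumes "continuous_on S a" "continuous_on S v"
  shows "continuous_on S (\<lambda>x. a x *s (v x :: complex^'n::finite))"
  unfolding vector_scalar_mult_def
  by (intro continuous_on_vec_lambda continuous_intros assms)

definition circle_pt :: "real \<Rightarrow> real \<Rightarrow> complex" where
  "circle_pt r t = of_real r * exp (2 * of_real pi * \<i> * of_real t)"

lemma cmod_circle_pt: "cmod (circle_pt r t) = \<bar>r\<bar>"
proof -
  have "exp (2 * of_real pi * \<i> * of_real t) = exp (\<i> * of_real (2 * pi * t))"
    by (simp add: mult_ac)
  then show ?thesis by (simp add: circle_pt_def norm_mult)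
qed

lemma continuous_circle_pt: "continuous_on S (circle_pt r)"
  unfolding circle_pt_def by (intro continuous_intros)

text \<open>Cauchy's formula for the restriction of \<open>f\<close> to the complex line through \<open>z\<close> in direction \<open>v\<close>.\<close>

lemma dderiv_Cauchy:
  fixes f :: "complex^'n::finite \<Rightarrow> complex"
  assumes r: "r > 0" and f: "\<And>a. cmod a \<le> r \<Longrightarrow> holo_at (z + a *s v) f"
  shows "dderiv f z v = integral {0..1} (\<lambda>t. f (z + circle_pt r t *s v) / circle_pt r t)"
proof -
  let ?g = "\<lambda>a. f (z + a *s v)"
  have der: "(?g has_field_derivative dderiv f (z + a *s v) v) (at a)" if "cmod a \<le> r" for a
  proof -
    have l: "((\<lambda>a. z + a *s v) has_derivative (\<lambda>h. h *s v)) (at a)"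
    proof -
      have "bounded_linear (\<lambda>h. h *s v)"
        by (rule linear_conv_bounded_linear[THEN iffD1]) (auto intro!: linearI simp: vec_eq_iff algebra_simps)
      from bounded_linear.has_derivative[OF this has_derivative_ident] show ?thesis
        by (auto intro!: derivative_eq_intros)
    qed
    have "(?g has_derivative (\<lambda>h. dderiv f (z + a *s v) (h *s v))) (at a)"
      using diff_chain_at[OF l holo_at_frechet(1)[OF f[OF that]]] by (simp add: o_def)
    then show ?thesis
      by (simp add: holo_at_frechet(2)[OF f[OF that]] has_field_derivative_def mult_commute_abs)
  qed
  have cont: "continuous_on (cball 0 r) ?g"
    by (intro continuous_at_imp_continuous_on ballI DERIV_isCont[OF der]) simp
  have hol: "?g holomorphic_on ball 0 r"
    unfolding holomorphic_on_def field_differentiable_def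
  proof
    fix a :: complex assume "a \<in> ball 0 r"
    then show "\<exists>f'. (?g has_field_derivative f') (at a within ball 0 r)"
      using der[of a] by (auto intro: has_field_derivative_at_within)
  qed
  have "(?g has_field_derivative (1 / (2 * of_real pi * \<i>) * contour_integral (circlepath 0 r) (\<lambda>u. ?g u / (u - 0)^2))) (at 0)"
    by (rule Cauchy_derivative_integral_circlepath(2)[OF cont hol]) (use r in simp)
  moreover have "(?g has_field_derivative dderiv f z v) (at 0)" using der[of 0] r by simp
  ultimately have "dderiv f z v = 1 / (2 * of_real pi * \<i>) * contour_integral (circlepath 0 r) (\<lambda>u. ?g u / (u - 0)^2)"
    using DERIV_unique by blast
  also have "contour_integral (circlepath 0 r) (\<lambda>u. ?g u / (u - 0)^2)
      = integral {0..1} (\<lambda>t. 2 * of_real pi * \<i> * (?g (circle_pt r t) / circle_pt r t))"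
    unfolding contour_integral_integral
  proof (rule integral_cong)
    fix t :: real assume "t \<in> {0..1}"
    have n: "circle_pt r t \<noteq> 0" using cmod_circle_pt[of r t] r by auto
    have vd: "vector_derivative (circlepath 0 r) (at t) = 2 * of_real pi * \<i> * circle_pt r t"
      by (simp add: vector_derivative_circlepath circle_pt_def mult_ac)
    have cp: "circlepath 0 r t = circle_pt r t" by (simp add: circlepath circle_pt_def)
    show "?g (circlepath 0 r t) / (circlepath 0 r t - 0)\<^sup>2 * vector_derivative (circlepath 0 r) (at t)
        = 2 * of_real pi * \<i> * (?g (circle_pt r t) / circle_pt r t)"
      unfolding vd cp using n by (simp add: power2_eq_square)
  qed
  also have "1 / (2 * of_real pi * \<i>) * integral {0..1} (\<lambda>t. 2 * of_real pi * \<i> * (?g (circle_pt r t) / circle_pt r t))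
      = integral {0..1} (\<lambda>t. ?g (circle_pt r t) / circle_pt r t)"
    by (subst integral_mult_right) simp
  finally show ?thesis .
qed

text \<open>The \<open>1\<close> in the denominator allows for \<open>v = 0\<close>.\<close>

lemma line_ball:
  fixes z :: "complex^'n::finite"
  assumes "z \<in> ball z0 d" "cmod a \<le> d / (norm v + 1)" "d > 0"
  shows "z + a *s v \<in> ball z0 (2 * d)"
proof -
  have "norm (a *s v) \<le> d / (norm v + 1) * norm v"
    unfolding norm_cscale by (intro mult_right_mono assms) simp
  also have "\<dots> \<le> d" using assms(3) by (simp add: field_simps add_pos_nonneg)
  finally have "norm (a *s v) \<le> d" .
  then show ?thesis using assms(1) dist_triangle[of z0 "z + a *s v" z]
    by (simp add: dist_norm)
qed

text \<open>By Cauchy's formula, the derivative is an integral of values of \<open>f\<close>.\<close>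

lemma holo_on_dderiv_continuous:
  fixes f :: "complex^'n::finite \<Rightarrow> complex"
  assumes f: "holo_on S f" and S: "open S"
  shows "continuous_on S (\<lambda>z. dderiv f z v)"
proof (rule continuous_at_imp_continuous_on, rule ballI)
  fix z0 assume "z0 \<in> S"
  then obtain e where e: "e > 0" "ball z0 e \<subseteq> S" using S by (meson openE)
  define d where "d = e / 2"
  define r where "r = d / (norm v + 1)"
  have d: "d > 0" and r: "r > 0" using e by (auto simp: d_def r_def intro!: divide_pos_pos add_nonneg_pos)
  have S': "z + a *s v \<in> S" if "z \<in> ball z0 d" "cmod a \<le> r" for z a
    using line_ball[OF that(1) that(2)[unfolded r_def] d] e by (auto simp: d_def)
  have "continuous_on (ball z0 d) (\<lambda>z. integral (cbox 0 1) (\<lambda>t. f (z + circle_pt r t *s v) / circle_pt r t))"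
  proof (rule integral_continuous_on_param)
    have "continuous_on (ball z0 d \<times> cbox 0 1) (\<lambda>x. f (fst x + circle_pt r (snd x) *s v) / circle_pt r (snd x))"
    proof (intro continuous_on_divide continuous_on_compose2[OF holo_on_continuous[OF f]])
      show "continuous_on (ball z0 d \<times> cbox 0 1) (\<lambda>x. circle_pt r (snd x))"
        by (rule continuous_on_compose2[OF continuous_circle_pt[of UNIV]]) (auto intro!: continuous_intros)
      show "\<forall>x\<in>ball z0 d \<times> cbox 0 1. circle_pt r (snd x) \<noteq> 0"
        using cmod_circle_pt r by (metis abs_of_pos norm_zero less_irrefl)
      show "continuous_on (ball z0 d \<times> cbox 0 1) (\<lambda>x. fst x + circle_pt r (snd x) *s v)"
        by (intro continuous_on_add continuous_on_cscale continuous_on_fst continuous_on_snd continuous_on_id continuous_on_const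
            continuous_on_compose2[OF continuous_circle_pt[of UNIV]]) auto
      show "(\<lambda>x. fst x + circle_pt r (snd x) *s v) ` (ball z0 d \<times> cbox 0 1) \<subseteq> S"
        using S' cmod_circle_pt r by (auto simp del: mem_ball)
    qed
    then show "continuous_on (ball z0 d \<times> cbox 0 1) (\<lambda>(z, t). f (z + circle_pt r t *s v) / circle_pt r t)"
      by (simp add: case_prod_unfold)
  qed
  then have "continuous_on (ball z0 d) (\<lambda>z. dderiv f z v)"
  proof (rule continuous_on_eq)
    fix z assume z: "z \<in> ball z0 d"
    have "dderiv f z v = integral {0..1} (\<lambda>t. f (z + circle_pt r t *s v) / circle_pt r t)"
      by (rule dderiv_Cauchy[OF r]) (use S' z f in \<open>simp add: holo_on_iff del: mem_ball\<close>)
    then show "integral (cbox 0 1) (\<lambda>t. f (z + circle_pt r t *s v) / circle_pt r t) = dderiv f z v" by simp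
  qed
  then show "isCont (\<lambda>z. dderiv f z v) z0"
    using d by (simp add: continuous_on_eq_continuous_at)
qed

lemma dderiv_continuous2:
  fixes f :: "complex^'n::finite \<Rightarrow> complex"
  assumes f: "holo_on S f" and S: "open S"
    and \<phi>: "continuous_on T \<phi>" "\<phi> ` T \<subseteq> S" and \<psi>: "continuous_on T \<psi>"
  shows "continuous_on T (\<lambda>x. dderiv f (\<phi> x) (\<psi> x))"
proof -
  have "continuous_on T (\<lambda>x. \<Sum>i\<in>UNIV. \<psi> x $ i * dderiv f (\<phi> x) (axis i 1))"
    by (intro continuous_on_sum continuous_on_mult continuous_on_component \<psi>
        continuous_on_compose2[OF holo_on_dderiv_continuous[OF f S] \<phi>])
  then show ?thesis
  proof (rule continuous_on_eq)
    fix x assume "x \<in> T"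
    then have "holo_at (\<phi> x) f" using \<phi>(2) f by (auto simp: holo_on_iff)
    from dderiv_axis[OF this, of "\<psi> x"]
    show "(\<Sum>i\<in>UNIV. \<psi> x $ i * dderiv f (\<phi> x) (axis i 1)) = dderiv f (\<phi> x) (\<psi> x)" by simp
  qed
qed

text \<open>Differentiating Cauchy's formula under the integral sign, which is possible since the
  derivatives of \<open>f\<close> are continuous.\<close>

theorem holo_on_dderiv:
  fixes f :: "complex^'n::finite \<Rightarrow> complex"
  assumes f: "holo_on S f" and S: "open S"
  shows "holo_on S (\<lambda>z. dderiv f z v)"
  unfolding holo_on_iff
proof
  fix z0 assume "z0 \<in> S"
  then obtain e where e: "e > 0" "ball z0 e \<subseteq> S" using S by (meson openE)
  define d where "d = e / 2"
  define r where "r = d / (norm v + 1)"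
  have d: "d > 0" and r: "r > 0" using e by (auto simp: d_def r_def intro!: divide_pos_pos add_nonneg_pos)
  have S': "z + a *s v \<in> S" if "z \<in> ball z0 d" "cmod a \<le> r" for z a
    using line_ball[OF that(1) that(2)[unfolded r_def] d] e by (auto simp: d_def)
  have S'': "z + circle_pt r t *s v \<in> S" if "z \<in> ball z0 d" for z t
    using that cmod_circle_pt[of r t] r by (intro S') auto
  have n: "circle_pt r t \<noteq> 0" for t
    using cmod_circle_pt r by (metis abs_of_pos norm_zero less_irrefl)
  have c1: "continuous_on T (\<lambda>x. circle_pt r (h x))" if "continuous_on T h" for T and h :: "'b::topological_space \<Rightarrow> real"
    by (rule continuous_on_compose2[OF continuous_circle_pt[of UNIV] that]) auto
  have "holo_at z0 (\<lambda>z. integral {0..1} (\<lambda>t. f (z + circle_pt r t *s v) / circle_pt r t))"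
  proof (rule holo_at_integral[of "ball z0 d"])
    fix z t assume z: "z \<in> ball z0 d"
    have "holo_at (z + circle_pt r t *s v) f" using S''[OF z] f by (simp add: holo_on_iff)
    note h = holo_at_frechet[OF this]
    have "((\<lambda>z. z + circle_pt r t *s v) has_derivative (\<lambda>h. h)) (at z)"
      by (auto intro!: derivative_eq_intros)
    from diff_chain_at[OF this h(1)]
    have "((\<lambda>z. f (z + circle_pt r t *s v)) has_derivative dderiv f (z + circle_pt r t *s v)) (at z)"
      by (simp add: o_def)
    from bounded_linear.has_derivative[OF bounded_linear_divide[of "circle_pt r t"] this]
    show "((\<lambda>z. f (z + circle_pt r t *s v) / circle_pt r t) has_derivative (\<lambda>w. dderiv f (z + circle_pt r t *s v) w / circle_pt r t)) (at z)" .
    show "dderiv f (z + circle_pt r t *s v) (a *s w) / circle_pt r t = a * (dderiv f (z + circle_pt r t *s v) w / circle_pt r t)" for a w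
      by (simp add: h(2))
  next
    fix w
    have "continuous_on (ball z0 d \<times> {0..1}) (\<lambda>x. dderiv f (fst x + circle_pt r (snd x) *s v) w / circle_pt r (snd x))"
      by (intro continuous_on_divide dderiv_continuous2[OF f S] continuous_on_add continuous_on_cscale c1
          continuous_on_fst continuous_on_snd continuous_on_id continuous_on_const)
         (use n S'' in auto)
    then show "continuous_on (ball z0 d \<times> {0..1}) (\<lambda>(z, t). dderiv f (z + circle_pt r t *s v) w / circle_pt r t)"
      by (simp add: case_prod_unfold)
  next
    fix z assume z: "z \<in> ball z0 d"
    show "continuous_on {0..1} (\<lambda>t. f (z + circle_pt r t *s v) / circle_pt r t)"
      by (intro continuous_on_divide continuous_on_compose2[OF holo_on_continuous[OF f]] continuous_on_add continuous_on_cscale c1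
          continuous_on_id continuous_on_const)
         (use n S''[OF z] in auto)
  qed (use d in auto)
  then show "holo_at z0 (\<lambda>z. dderiv f z v)"
  proof (rule holo_at_cong[rotated 3, of _ _ "ball z0 d"])
    fix z assume z: "z \<in> ball z0 d"
    show "integral {0..1} (\<lambda>t. f (z + circle_pt r t *s v) / circle_pt r t) = dderiv f z v"
      by (rule dderiv_Cauchy[OF r, symmetric]) (use S' z f in \<open>simp add: holo_on_iff del: mem_ball\<close>)
  qed (use d in auto)
qed

section \<open>Division by a coordinate\<close>

lemma bounded_linear_log_scale: "bounded_linear (log_scale (of_real s) :: complex^'n::finite \<Rightarrow> _)"
  by (rule linear_conv_bounded_linear[THEN iffD1])
     (auto intro!: linearI simp: log_scale_def vec_eq_iff algebra_simps scaleR_conv_of_real)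

lemma log_scale_continuous:
  assumes "continuous_on T a" "continuous_on T v"
  shows "continuous_on T (\<lambda>x. log_scale (a x) (v x :: complex^'n::finite))"
proof -
  have "continuous_on T (\<lambda>x. if j = i\<^sub>1 then a x * v x $ j else v x $ j)" for j
    by (cases "j = i\<^sub>1") (auto intro!: continuous_on_mult continuous_on_component assms)
  then show ?thesis unfolding log_scale_def by (intro continuous_on_vec_lambda)
qed

text \<open>Near the zero set of the coordinate, the quotient is the integral of \<open>(\<partial>f/\<partial>z\<^sub>1)(s z\<^sub>1, z\<^sub>2, \<dots>, z\<^sub>n)\<close>
  over \<open>s\<close> from \<open>0\<close> to \<open>1\<close>, which is holomorphic.\<close>

theorem holo_on_divide_coord:
  fixes f :: "complex^'n::finite \<Rightarrow> complex"
  assumes f: "holo_on S f" and S: "open S" and zero: "\<And>z. z \<in> S \<Longrightarrow> z $ i\<^sub>1 = 0 \<Longrightarrow> f z = 0"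
  shows "\<exists>h. holo_on S h \<and> (\<forall>z\<in>S. f z = z $ i\<^sub>1 * h z)"
proof -
  define D where "D z = dderiv f z (axis i\<^sub>1 1)" for z
  have D: "holo_on S D" unfolding D_def by (rule holo_on_dderiv[OF f S])
  define h where "h z = (if z $ i\<^sub>1 = 0 then D z else f z / z $ i\<^sub>1)" for z
  have "holo_at p h" if p: "p \<in> S" for p
  proof (cases "p $ i\<^sub>1 = 0")
    case False
    have o: "open {z :: complex^'n. z $ i\<^sub>1 \<noteq> 0}"
      by (intro open_Collect_neq continuous_on_component continuous_on_id continuous_on_const)
    show ?thesis
      by (rule holo_at_cong[OF o _ _ holo_at_divide[OF _ holo_at_coord[of p i\<^sub>1]]])
         (use False f p in \<open>auto simp: h_def holo_on_iff\<close>)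
  next
    case True
    obtain e where e: "e > 0" "ball p e \<subseteq> S" using S p by (meson openE)
    have ls: "log_scale (of_real s) z \<in> ball p e" if "z \<in> ball p e" "s \<in> {0..1}" for z s
    proof -
      have "norm (p - log_scale (of_real s) z) \<le> norm (p - z)"
      proof (rule norm_le_componentwise_cart)
        fix i
        show "norm ((p - log_scale (of_real s) z) $ i) \<le> norm ((p - z) $ i)"
          using that True by (auto simp: log_scale_def norm_mult intro: mult_left_le_one_le)
      qed
      then show ?thesis using that by (simp add: dist_norm)
    qed
    have "holo_at p (\<lambda>z. integral {0..1} (\<lambda>s. D (log_scale (of_real s) z)))"
    proof (rule holo_at_integral[of "ball p e"])
      fix z :: "complex^'n" and s :: real assume zs: "z \<in> ball p e" "s \<in> {0..1}"
      have "holo_at (log_scale (of_real s) z) D"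
        using ls[OF zs] e D by (auto simp: holo_on_iff)
      note h = holo_at_frechet[OF this]
      from diff_chain_at[OF bounded_linear.has_derivative[OF bounded_linear_log_scale has_derivative_ident] h(1)]
      show "((\<lambda>z. D (log_scale (of_real s) z)) has_derivative (\<lambda>w. dderiv D (log_scale (of_real s) z) (log_scale (of_real s) w))) (at z)"
        by (simp add: o_def)
      fix a and w :: "complex^'n"
      have "log_scale (of_real s) (a *s w) = a *s log_scale (of_real s) w"
        by (simp add: log_scale_def vec_eq_iff)
      then show "dderiv D (log_scale (of_real s) z) (log_scale (of_real s) (a *s w)) = a * dderiv D (log_scale (of_real s) z) (log_scale (of_real s) w)"
        by (simp add: h(2))
    next
      fix w
      have "continuous_on (ball p e \<times> {0..1::real}) (\<lambda>x. dderiv D (log_scale (of_real (snd x)) (fst x)) (log_scale (of_real (snd x)) w))"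
        by (intro dderiv_continuous2[OF D S] log_scale_continuous continuous_intros) (use ls e in auto)
      then show "continuous_on (ball p e \<times> {0..1::real}) (\<lambda>(z, s). dderiv D (log_scale (of_real s) z) (log_scale (of_real s) w))"
        by (simp add: case_prod_unfold)
    next
      fix z assume z: "z \<in> ball p e"
      show "continuous_on {0..1::real} (\<lambda>s. D (log_scale (of_real s) z))"
        by (intro continuous_on_compose2[OF holo_on_continuous[OF D]] log_scale_continuous continuous_intros)
           (use ls[OF z] e in auto)
    qed (use e in auto)
    then show ?thesis
    proof (rule holo_at_cong[rotated 3, of _ _ "ball p e"])
      fix z assume z: "z \<in> ball p e"
      show "integral {0..1} (\<lambda>s. D (log_scale (of_real s) z)) = h z"
      proof (cases "z $ i\<^sub>1 = 0")
        case True
        then have "log_scale (of_real s) z = z" for s by (simp add: log_scale_def vec_eq_iff)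
        then show ?thesis using True by (simp add: h_def)
      next
        case False
        let ?g = "\<lambda>s::real. f (log_scale (of_real s) z)"
        have "((\<lambda>s. z $ i\<^sub>1 * D (log_scale (of_real s) z)) has_integral ?g 1 - ?g 0) {0..1}"
        proof (rule fundamental_theorem_of_calculus)
          fix s :: real assume s: "s \<in> {0..1}"
          have hol: "holo_at (log_scale (of_real s) z) f"
            using ls[OF z s] e f by (auto simp: holo_on_iff)
          have ax: "log_scale (of_real s) z = log_scale 0 z + s *\<^sub>R (z $ i\<^sub>1 *s axis i\<^sub>1 1)" for s
            by (simp add: log_scale_def vec_eq_iff axis_def scaleR_conv_of_real[where 'a=complex])
          have "((\<lambda>s. log_scale (of_real s) z) has_derivative (\<lambda>h. h *\<^sub>R (z $ i\<^sub>1 *s axis i\<^sub>1 1))) (at s)"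
            unfolding ax by (auto intro!: derivative_eq_intros)
          from diff_chain_at[OF this holo_at_frechet(1)[OF hol]]
          have "(?g has_derivative (\<lambda>h. dderiv f (log_scale (of_real s) z) (h *\<^sub>R (z $ i\<^sub>1 *s axis i\<^sub>1 1)))) (at s)"
            by (simp add: o_def)
          moreover have "dderiv f (log_scale (of_real s) z) (h *\<^sub>R (z $ i\<^sub>1 *s axis i\<^sub>1 1)) = h *\<^sub>R (z $ i\<^sub>1 * D (log_scale (of_real s) z))" for h
            using has_derivative_bounded_linear[OF holo_at_frechet(1)[OF hol]]
            by (simp add: linear_simps holo_at_frechet(2)[OF hol] D_def)
          ultimately show "(?g has_vector_derivative z $ i\<^sub>1 * D (log_scale (of_real s) z)) (at s within {0..1})"
            by (simp add: has_vector_derivative_def has_derivative_at_withinI)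
        qed simp
        moreover have "?g 1 = f z" by (rule arg_cong[of _ _ f]) (simp add: log_scale_def vec_eq_iff)
        moreover have "?g 0 = 0"
          using ls[OF z, of 0] e zero[of "log_scale 0 z"] by (auto simp: log_scale_def)
        ultimately have "((\<lambda>s. z $ i\<^sub>1 * D (log_scale (of_real s) z)) has_integral f z) {0..1}"
          by simp
        then have "integral {0..1} (\<lambda>s. z $ i\<^sub>1 * D (log_scale (of_real s) z)) = f z"
          by (rule integral_unique)
        then show ?thesis using False by (simp add: h_def field_simps)
      qed
    qed (use e in auto)
  qed
  moreover have "f z = z $ i\<^sub>1 * h z" if "z \<in> S" for z
    using zero[OF that] by (simp add: h_def)
  ultimately show ?thesis by (auto simp: holo_on_iff)
qed

section \<open>Holomorphic functions in charts\<close>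

text \<open>Holomorphy at a point is easier to handle than \<^term>\<open>holo_at_chart\<close>: it is local, and independent
  of the chart by \<open>hol_at_change\<close>.\<close>

definition hol_at :: "('x::t2_space, 'n::finite) chart \<Rightarrow> 'x \<Rightarrow> ('x \<Rightarrow> complex) \<Rightarrow> bool" where
  "hol_at c x f \<longleftrightarrow> holo_at (crd c x) (\<lambda>z. f (crd_inv c z))"

lemma crd_inv_crd: "is_chart c \<Longrightarrow> x \<in> dom_of c \<Longrightarrow> crd_inv c (crd c x) = x"
  by (simp add: is_chart_def homeomorphism_def)

lemma crd_image_open:
  assumes "is_chart c" "open W" "W \<subseteq> dom_of c"
  shows "open (crd c ` W)"
proof -
  have h: "homeomorphism (dom_of c) (crd c ` dom_of c) (crd c) (crd_inv c)"
    and o: "open (dom_of c)" "open (crd c ` dom_of c)"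
    using assms(1) by (auto simp: is_chart_def)
  have "openin (top_of_set (crd c ` dom_of c)) (crd c ` W)"
    using homeomorphism_imp_open_map[OF h] assms(2,3) o by (simp add: openin_open_eq)
  then show ?thesis using o by (simp add: openin_open_eq)
qed

lemma holo_at_chart_iff:
  assumes "is_chart c" "S \<subseteq> dom_of c"
  shows "holo_at_chart c S f \<longleftrightarrow> (\<forall>x\<in>S. hol_at c x f)"
  by (simp add: holo_at_chart_def holo_on_iff hol_at_def)

lemma hol_at_cong:
  assumes "is_chart c" "open W" "x \<in> W" "x \<in> dom_of c" "\<And>y. y \<in> W \<Longrightarrow> y \<in> dom_of c \<Longrightarrow> f y = h y" "hol_at c x f"
  shows "hol_at c x h"
proof -
  have o: "open (crd c ` (W \<inter> dom_of c))"
    using assms by (intro crd_image_open) (auto simp: is_chart_def)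
  show ?thesis
    unfolding hol_at_def
  proof (rule holo_at_cong[OF o])
    show "holo_at (crd c x) (\<lambda>z. f (crd_inv c z))" using assms(6) by (simp add: hol_at_def)
  qed (use assms crd_inv_crd[OF assms(1)] in auto)
qed

lemma hol_at_const [simp]: "hol_at c x (\<lambda>_. a)"
  by (simp add: hol_at_def)

lemma hol_at_add: "hol_at c x f \<Longrightarrow> hol_at c x h \<Longrightarrow> hol_at c x (\<lambda>y. f y + h y)"
  by (simp add: hol_at_def holo_at_add)

lemma hol_at_mult: "hol_at c x f \<Longrightarrow> hol_at c x h \<Longrightarrow> hol_at c x (\<lambda>y. f y * h y)"
  by (simp add: hol_at_def holo_at_mult)

lemma hol_at_sum: "(\<And>i. i \<in> I \<Longrightarrow> hol_at c x (f i)) \<Longrightarrow> hol_at c x (\<lambda>y. \<Sum>i\<in>I. f i y)"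
  by (simp add: hol_at_def holo_at_sum)

lemma hol_at_prod: "(\<And>i. i \<in> I \<Longrightarrow> hol_at c x (f i)) \<Longrightarrow> hol_at c x (\<lambda>y. \<Prod>i\<in>I. f i y)"
  by (simp add: hol_at_def holo_at_prod)

lemma hol_at_power: "hol_at c x f \<Longrightarrow> hol_at c x (\<lambda>y. f y ^ n)"
  by (simp add: hol_at_def holo_at_power)

lemma atlas_holo_charts: "complex_atlas \<A> \<Longrightarrow> c \<in> \<A> \<Longrightarrow> c \<in> holo_charts \<A>"
  by (simp add: complex_atlas_def holo_charts_def)

lemma log_chartsD:
  assumes "c \<in> log_charts \<A> D"
  shows "c \<in> holo_charts \<A>" "is_chart c" "x \<in> dom_of c \<Longrightarrow> crd c x $ i\<^sub>1 = 0 \<longleftrightarrow> x \<in> D"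
  using assms by (auto simp: log_charts_def holo_charts_def)

lemma transition_crd: "is_chart c \<Longrightarrow> x \<in> dom_of c \<Longrightarrow> transition c c' (crd c x) = crd c' x"
  by (simp add: transition_def crd_inv_crd)

text \<open>Charts of the maximal atlas are compatible with each other because this can be tested in a
  chart of the given atlas around the point.\<close>

lemma transition_holo:
  assumes \<A>: "complex_atlas \<A>" and c: "c \<in> holo_charts \<A>" "c' \<in> holo_charts \<A>"
    and x: "x \<in> dom_of c" "x \<in> dom_of c'"
  shows "holo_at (crd c x) (\<lambda>z. transition c c' z $ i)"
proof -
  obtain d where d: "d \<in> \<A>" "x \<in> dom_of d" using \<A> unfolding complex_atlas_def by blast
  have ch: "is_chart c" "is_chart c'" "is_chart d"
    using c d \<A> by (auto simp: holo_charts_def complex_atlas_def)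
  have 1: "holo_at (crd c x) (\<lambda>z. transition c d z $ i)" for i
    using c(1) d x by (auto simp: holo_charts_def holo_compatible_def holo_on_iff)
  have 2: "holo_at (crd d x) (\<lambda>z. transition d c' z $ i)" for i
    using c(2) d x by (auto simp: holo_charts_def holo_compatible_def holo_on_iff)
  have "holo_at (crd c x) (\<lambda>z. transition d c' (transition c d z) $ i)"
    by (rule holo_at_compose[OF 1]) (simp add: transition_crd ch x 2)
  then show ?thesis
  proof (rule holo_at_cong[rotated 3])
    show "open (crd c ` (dom_of c \<inter> dom_of d))"
      using ch by (intro crd_image_open) (auto simp: is_chart_def)
    show "transition d c' (transition c d w) $ i = transition c c' w $ i" if "w \<in> crd c ` (dom_of c \<inter> dom_of d)" for w
      using that by (auto simp: transition_crd ch)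
  qed (use x d in auto)
qed

lemma hol_at_change:
  assumes \<A>: "complex_atlas \<A>" and c: "c \<in> holo_charts \<A>" "c' \<in> holo_charts \<A>"
    and x: "x \<in> dom_of c" "x \<in> dom_of c'" and f: "hol_at c x f"
  shows "hol_at c' x f"
proof -
  have ch: "is_chart c" "is_chart c'" using c by (auto simp: holo_charts_def)
  have "holo_at (crd c' x) (\<lambda>z. f (crd_inv c (transition c' c z)))"
    by (rule holo_at_compose[OF transition_holo[OF \<A> c(2,1) x(2,1)]])
       (use f ch x in \<open>simp add: transition_crd hol_at_def\<close>)
  then have "holo_at (crd c' x) (\<lambda>z. f (crd_inv c' z))"
  proof (rule holo_at_cong[rotated 3])
    show "open (crd c' ` (dom_of c \<inter> dom_of c'))"
      using ch by (intro crd_image_open) (auto simp: is_chart_def)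
    show "f (crd_inv c (transition c' c w)) = f (crd_inv c' w)" if "w \<in> crd c' ` (dom_of c \<inter> dom_of c')" for w
      using that by (auto simp: transition_crd ch crd_inv_crd)
  qed (use x in auto)
  then show ?thesis by (simp add: hol_at_def)
qed

text \<open>The divisor is nowhere dense: its points are limits of points outside along the first
  coordinate line.\<close>

lemma hol_at_eq_on_divisor:
  assumes c: "c \<in> log_charts \<A> D" and x: "x \<in> dom_of c" and W: "open W" "x \<in> W"
    and hol: "hol_at c x f" "hol_at c x h"
    and eq: "\<And>y. y \<in> W \<Longrightarrow> y \<in> dom_of c \<Longrightarrow> y \<notin> D \<Longrightarrow> f y = h y"
  shows "f x = h x"
proof (cases "x \<in> D")
  case False
  then show ?thesis using eq W x by blast
next
  case True
  have ch: "is_chart c" using log_chartsD[OF c] by blast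
  have o: "open (crd c ` (W \<inter> dom_of c))"
    using ch W by (intro crd_image_open) (auto simp: is_chart_def)
  define \<phi> where "\<phi> s = crd c x + s *s axis i\<^sub>1 1" for s
  have \<phi>: "isCont \<phi> 0"
  proof (rule isCont_vec)
    show "isCont (\<lambda>s. \<phi> s $ i) 0" for i by (auto simp: \<phi>_def intro!: continuous_intros)
  qed
  have \<phi>0: "\<phi> 0 = crd c x" by (simp add: \<phi>_def)
  have z: "crd c x $ i\<^sub>1 = 0" using log_chartsD(3)[OF c x] True by simp
  have lim: "((\<lambda>s. F (crd_inv c (\<phi> s))) \<longlongrightarrow> F x) (at 0)" if "hol_at c x F" for F
  proof -
    have "isCont (\<lambda>z. F (crd_inv c z)) (\<phi> 0)"
      using that unfolding hol_at_def \<phi>0 by (rule holo_at_isCont)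
    from isCont_o2[OF \<phi> this] show ?thesis
      unfolding isCont_def by (simp add: \<phi>0 crd_inv_crd[OF ch x])
  qed
  have "\<forall>\<^sub>F s in at 0. \<phi> s \<in> crd c ` (W \<inter> dom_of c)"
    by (rule topological_tendstoD[OF \<phi>[unfolded isCont_def] o]) (use \<phi>0 W x in auto)
  moreover have "\<forall>\<^sub>F s in at (0::complex). s \<noteq> 0" by (simp add: eventually_at_filter)
  ultimately have "\<forall>\<^sub>F s in at 0. f (crd_inv c (\<phi> s)) = h (crd_inv c (\<phi> s))"
  proof eventually_elim
    case (elim s)
    then obtain y where y: "y \<in> W" "y \<in> dom_of c" "\<phi> s = crd c y" by blast
    have "crd c y $ i\<^sub>1 \<noteq> 0" using elim z unfolding y(3)[symmetric] by (simp add: \<phi>_def axis_def)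
    then have "y \<notin> D" using log_chartsD(3)[OF c y(2)] by simp
    then show ?case using eq y by (simp add: y(3) crd_inv_crd[OF ch])
  qed
  from Lim_transform_eventually[OF lim[OF hol(1)] this]
  show ?thesis using lim[OF hol(2)] by (rule tendsto_unique[OF at_neq_bot])
qed

section \<open>The logarithmic tangent bundle\<close>

lemma log_scale_expand: "log_scale a v = (\<Sum>j\<in>UNIV. v $ j *s log_scale a (axis j 1))"
  by (simp add: log_scale_def vec_eq_iff axis_def if_distrib[of "\<lambda>x. _ * x"] sum.delta cong: if_cong)

lemma frechet_transition:
  assumes "complex_atlas \<A>" "c \<in> holo_charts \<A>" "c' \<in> holo_charts \<A>" "x \<in> dom_of c" "x \<in> dom_of c'"
  shows "(transition c c' has_derivative frechet_derivative (transition c c') (at (crd c x))) (at (crd c x))"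
    "frechet_derivative (transition c c') (at (crd c x)) v = (\<chi> i. dderiv (\<lambda>z. transition c c' z $ i) (crd c x) v)"
proof -
  have "(transition c c' has_derivative (\<lambda>v. \<chi> i. dderiv (\<lambda>z. transition c c' z $ i) (crd c x) v)) (at (crd c x))"
    by (rule holo_map_has_derivative) (rule transition_holo[OF assms])
  moreover from this have "(\<lambda>v. \<chi> i. dderiv (\<lambda>z. transition c c' z $ i) (crd c x) v) = frechet_derivative (transition c c') (at (crd c x))"
    by (rule frechet_derivative_at)
  ultimately show "(transition c c' has_derivative frechet_derivative (transition c c') (at (crd c x))) (at (crd c x))"
    "frechet_derivative (transition c c') (at (crd c x)) v = (\<chi> i. dderiv (\<lambda>z. transition c c' z $ i) (crd c x) v)"
    by (simp, metis)
qed

lemma log_transition_cocycle: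
  assumes \<A>: "complex_atlas \<A>" and c: "c1 \<in> log_charts \<A> D" "c2 \<in> log_charts \<A> D" "c3 \<in> log_charts \<A> D"
    and x: "x \<in> dom_of c1" "x \<in> dom_of c2" "x \<in> dom_of c3" "x \<notin> D"
  shows "log_transition c2 c3 x (log_transition c1 c2 x v) = log_transition c1 c3 x v"
proof -
  note h = log_chartsD(1)[OF c(1)] log_chartsD(1)[OF c(2)] log_chartsD(1)[OF c(3)]
  note ch = log_chartsD(2)[OF c(1)] log_chartsD(2)[OF c(2)] log_chartsD(2)[OF c(3)]
  have n: "crd c2 x $ i\<^sub>1 \<noteq> 0" using log_chartsD(3)[OF c(2) x(2)] x(4) by simp
  have "(transition c2 c3 has_derivative frechet_derivative (transition c2 c3) (at (crd c2 x))) (at (transition c1 c2 (crd c1 x)))"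
    using frechet_transition(1)[OF \<A> h(2,3) x(2,3)] by (simp add: transition_crd ch x)
  from diff_chain_at[OF frechet_transition(1)[OF \<A> h(1,2) x(1,2)] this]
  have d: "((transition c2 c3 \<circ> transition c1 c2) has_derivative
     (frechet_derivative (transition c2 c3) (at (crd c2 x)) \<circ> frechet_derivative (transition c1 c2) (at (crd c1 x)))) (at (crd c1 x))" .
  have "(transition c1 c3 has_derivative
     (frechet_derivative (transition c2 c3) (at (crd c2 x)) \<circ> frechet_derivative (transition c1 c2) (at (crd c1 x)))) (at (crd c1 x))"
  proof (rule has_derivative_transform_within_open[OF d])
    show "open (crd c1 ` (dom_of c1 \<inter> dom_of c2))"
      using ch by (intro crd_image_open) (auto simp: is_chart_def)
    show "(transition c2 c3 \<circ> transition c1 c2) w = transition c1 c3 w" if "w \<in> crd c1 ` (dom_of c1 \<inter> dom_of c2)" for w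
      using that by (auto simp: transition_crd ch)
  qed (use x in auto)
  from frechet_derivative_at[OF this, symmetric]
  have "frechet_derivative (transition c1 c3) (at (crd c1 x)) w
      = frechet_derivative (transition c2 c3) (at (crd c2 x)) (frechet_derivative (transition c1 c2) (at (crd c1 x)) w)" for w
    by simp
  moreover have "log_scale (crd c2 x $ i\<^sub>1) (log_scale (1 / crd c2 x $ i\<^sub>1) w) = w" for w :: "complex^'b"
    using n by (simp add: log_scale_def vec_eq_iff)
  ultimately show ?thesis by (simp add: log_transition_def)
qed

text \<open>A change of adapted charts maps the first coordinate \<open>z\<^sub>1\<close> to \<open>z\<^sub>1 h\<close> with a holomorphic function
  \<open>h\<close> without zeros, since both coordinates vanish exactly on \<open>D\<close>, and to first order. In terms of
  \<open>h\<close>, the matrix has no poles.\<close>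

theorem log_transition_extends:
  fixes c c' :: "('x::t2_space, 'n::finite) chart"
  assumes \<A>: "complex_atlas \<A>" and c: "c \<in> log_charts \<A> D" "c' \<in> log_charts \<A> D"
  shows "\<exists>M :: 'x \<Rightarrow> complex^'n^'n.
    (\<forall>x\<in>dom_of c \<inter> dom_of c'. \<forall>i j. hol_at c x (\<lambda>x. M x $ i $ j)) \<and>
    (\<forall>x\<in>dom_of c \<inter> dom_of c' - D. \<forall>v. log_transition c c' x v = M x *v v) \<and>
    (\<forall>x\<in>dom_of c \<inter> dom_of c' \<inter> D. M x *v axis i\<^sub>1 1 = axis i\<^sub>1 1)"
proof -
  note hc = log_chartsD(1)[OF c(1)] log_chartsD(1)[OF c(2)]
  note ch = log_chartsD(2)[OF c(1)] log_chartsD(2)[OF c(2)]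
  note D = log_chartsD(3)[OF c(1)] log_chartsD(3)[OF c(2)]
  let ?Y = "dom_of c \<inter> dom_of c'"
  let ?F = "\<lambda>i z. transition c c' z $ i"
  define S where "S = crd c ` ?Y"
  have oY: "open ?Y" using ch by (auto simp: is_chart_def)
  have S: "open S" unfolding S_def using oY by (intro crd_image_open ch) auto
  have F: "holo_on S (?F i)" for i
    using transition_holo[OF \<A> hc] by (auto simp: S_def holo_on_iff)
  have zero: "?F i\<^sub>1 z = 0 \<longleftrightarrow> z $ i\<^sub>1 = 0" if "z \<in> S" for z
    using that D by (auto simp: S_def transition_crd ch)
  obtain h where h: "holo_on S h" "\<And>z. z \<in> S \<Longrightarrow> ?F i\<^sub>1 z = z $ i\<^sub>1 * h z"
    using holo_on_divide_coord[OF F S] zero by metis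
  have dF: "dderiv (?F i\<^sub>1) z w = z $ i\<^sub>1 * dderiv h z w + w $ i\<^sub>1 * h z" if z: "z \<in> S" for z w
  proof -
    have hz: "holo_at z h" using h(1) z by (simp add: holo_on_iff)
    have p: "((\<lambda>z. z $ i\<^sub>1 * h z) has_derivative (\<lambda>w. z $ i\<^sub>1 * dderiv h z w + w $ i\<^sub>1 * h z)) (at z)"
      by (rule has_derivative_mult[OF coord_has_derivative holo_at_frechet(1)[OF hz]])
    have "(?F i\<^sub>1 has_derivative (\<lambda>w. z $ i\<^sub>1 * dderiv h z w + w $ i\<^sub>1 * h z)) (at z)"
      by (rule has_derivative_transform_within_open[OF p S z]) (simp add: h(2))
    from fun_cong[OF dderiv_eq[OF this], of w] show ?thesis .
  qed
  \<comment> \<open>If \<open>h\<close> had a zero on \<open>D\<close>, the derivative of the first coordinate of the transition map would vanish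
    there, but the transition map has a differentiable inverse.\<close>
  have hn: "h z \<noteq> 0" if z: "z \<in> S" for z
  proof
    assume h0: "h z = 0"
    then have z1: "z $ i\<^sub>1 = 0" using zero[OF z] h(2)[OF z] by simp
    obtain x where x: "x \<in> ?Y" "z = crd c x" using z by (auto simp: S_def)
    have d0: "dderiv (?F i\<^sub>1) z = (\<lambda>w. 0)"
      by (rule ext) (use dF[OF z] h0 z1 in simp)
    have "(?F i\<^sub>1 has_derivative dderiv (?F i\<^sub>1) z) (at z)"
      using F z by (intro holo_at_frechet) (simp add: holo_on_iff)
    then have "(?F i\<^sub>1 has_derivative (\<lambda>w. 0)) (at (transition c' c (crd c' x)))"
      unfolding d0 using x by (simp add: transition_crd ch)
    from diff_chain_at[OF frechet_transition(1)[OF \<A> hc(2,1)] this]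
    have "((\<lambda>y. ?F i\<^sub>1 (transition c' c y)) has_derivative (\<lambda>w. 0)) (at (crd c' x))"
      using x by (simp add: o_def)
    then have "((\<lambda>y. y $ i\<^sub>1) has_derivative (\<lambda>w. 0)) (at (crd c' x))"
    proof (rule has_derivative_transform_within_open)
      show "open (crd c' ` ?Y)" using oY by (intro crd_image_open ch) auto
      show "?F i\<^sub>1 (transition c' c y) = y $ i\<^sub>1" if "y \<in> crd c' ` ?Y" for y
        using that by (auto simp: transition_crd ch)
    qed (use x in auto)
    from has_derivative_unique[OF this coord_has_derivative]
    have "(\<lambda>w. 0) = (\<lambda>w::complex^'n. w $ i\<^sub>1)" .
    from fun_cong[OF this, of "axis i\<^sub>1 1"] show False by (simp add: axis_def)
  qed
  \<comment> \<open>The entries of the transition matrix, with the first row expressed through the logarithmic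
    derivative of \<open>h\<close>.\<close>
  define N where "N z i j = (if i = i\<^sub>1
      then dderiv h z (log_scale (z $ i\<^sub>1) (axis j 1)) / h z + (if j = i\<^sub>1 then 1 else 0)
      else dderiv (?F i) z (log_scale (z $ i\<^sub>1) (axis j 1)))" for z i j
  have ls: "log_scale a (axis j 1) = (if j = i\<^sub>1 then a else 1) *s axis j 1" for a and j :: 'n
    by (simp add: log_scale_def vec_eq_iff axis_def)
  have dls: "holo_at z (\<lambda>z. dderiv f z (log_scale (z $ i\<^sub>1) (axis j 1)))" if f: "holo_on S f" and z: "z \<in> S" for f z j
  proof -
    have "holo_at z (\<lambda>z. (if j = i\<^sub>1 then z $ i\<^sub>1 else 1) * dderiv f z (axis j 1))"
      using holo_on_dderiv[OF f S] z by (intro holo_at_mult; cases "j = i\<^sub>1"; simp add: holo_on_iff)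
    then show ?thesis
      by (rule holo_at_cong[OF S z, rotated]) (use f in \<open>simp add: ls holo_on_iff holo_at_frechet(2)\<close>)
  qed
  have N: "holo_at z (\<lambda>z. N z i j)" if z: "z \<in> S" for z i j
    unfolding N_def using h(1) hn[OF z] z F
    by (cases "i = i\<^sub>1") (auto intro!: holo_at_add holo_at_divide dls simp: holo_on_iff)
  define M where "M x = (\<chi> i j. N (crd c x) i j)" for x
  have "hol_at c x (\<lambda>x. M x $ i $ j)" if x: "x \<in> ?Y" for x i j
  proof -
    have "holo_at (crd c x) (\<lambda>z. N z i j)" using N x by (simp add: S_def)
    then show ?thesis
      unfolding hol_at_def
      by (rule holo_at_cong[OF S, rotated 2]) (use x in \<open>auto simp: S_def M_def crd_inv_crd ch\<close>)
  qed
  moreover have "log_transition c c' x v = M x *v v" if x: "x \<in> ?Y - D" for x v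
  proof -
    let ?z = "crd c x"
    have z: "?z \<in> S" using x by (auto simp: S_def)
    have z1: "?z $ i\<^sub>1 \<noteq> 0" using D(1)[of x] x by simp
    have c1: "crd c' x $ i\<^sub>1 = ?z $ i\<^sub>1 * h ?z" using h(2)[OF z] x by (simp add: transition_crd ch)
    have e: "dderiv f ?z (log_scale a v) = (\<Sum>j\<in>UNIV. v $ j * dderiv f ?z (log_scale a (axis j 1)))"
      if "holo_on S f" for f a
      using dderiv_sum[of ?z f] that z by (subst log_scale_expand) (simp add: holo_on_iff)
    have sl: "(\<Sum>j\<in>UNIV. v $ j * (log_scale a (axis j 1) $ i\<^sub>1)) = a * v $ i\<^sub>1" for a
      by (simp add: log_scale_def axis_def if_distrib[of "\<lambda>x. _ * x"] sum.delta cong: if_cong)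
    show ?thesis
    proof (subst vec_eq_iff, rule allI)
      fix i
      have lt: "log_transition c c' x v $ i = (if i = i\<^sub>1 then 1 / crd c' x $ i\<^sub>1 else 1) * dderiv (?F i) ?z (log_scale (?z $ i\<^sub>1) v)"
        using x by (simp add: log_transition_def log_scale_def[of "1 / _"] frechet_transition(2)[OF \<A> hc])
      show "log_transition c c' x v $ i = (M x *v v) $ i"
      proof (cases "i = i\<^sub>1")
        case False
        then show ?thesis
          unfolding lt e[OF F] by (simp add: matrix_vector_mult_def M_def N_def mult.commute)
      next
        case True
        have "(M x *v v) $ i = (\<Sum>j\<in>UNIV. v $ j * dderiv h ?z (log_scale (?z $ i\<^sub>1) (axis j 1)) / h ?z) + v $ i\<^sub>1"
          using True by (simp add: matrix_vector_mult_def M_def N_def distrib_left sum.distrib mult.commute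
              if_distrib[of "\<lambda>x. _ * x"] sum.delta cong: if_cong)
        also have "\<dots> = dderiv h ?z (log_scale (?z $ i\<^sub>1) v) / h ?z + v $ i\<^sub>1"
          unfolding e[OF h(1)] by (simp add: sum_divide_distrib)
        also have "\<dots> = 1 / crd c' x $ i\<^sub>1 * dderiv (?F i\<^sub>1) ?z (log_scale (?z $ i\<^sub>1) v)"
          unfolding dF[OF z] c1 using z1 hn[OF z] by (simp add: log_scale_def field_simps)
        finally show ?thesis using lt True by simp
      qed
    qed
  qed
  moreover have "M x *v axis i\<^sub>1 1 = axis i\<^sub>1 1" if x: "x \<in> ?Y \<inter> D" for x
  proof -
    let ?z = "crd c x"
    have z: "?z \<in> S" using x by (auto simp: S_def)
    have z1: "?z $ i\<^sub>1 = 0" using D(1)[of x] x by simp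
    have "log_scale (?z $ i\<^sub>1) (axis i\<^sub>1 1) = (0 :: complex^'n)" unfolding z1 ls by simp
    moreover have "dderiv f ?z 0 = 0" if "holo_on S f" for f
      using holo_at_frechet(2)[of ?z f 0 0] that z by (simp add: holo_on_iff)
    ultimately have "N ?z i i\<^sub>1 = (if i = i\<^sub>1 then 1 else 0)" for i
      using h(1) F by (simp add: N_def)
    then show ?thesis
      by (simp add: vec_eq_iff matrix_vector_mult_def M_def axis_def if_distrib[of "\<lambda>x. _ * x"] sum.delta cong: if_cong)
  qed
  ultimately show ?thesis by blast
qed

section \<open>Families of forms depending holomorphically on a point\<close>

lemma hol_coef: "(\<And>v. hol_at c x (\<lambda>y. p y v)) \<Longrightarrow> hol_at c x (\<lambda>y. coef k \<alpha> (p y))"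
  unfolding coef_def by (intro hol_at_sum hol_at_mult) auto

text \<open>The coefficients are combinations of values, and monomials are products of coordinates.\<close>

lemma hol_poly:
  fixes p :: "'x::t2_space \<Rightarrow> complex^'m::finite \<Rightarrow> complex" and c :: "('x, 'n::finite) chart"
  assumes c: "is_chart c" and W: "open W" "x \<in> W" "x \<in> dom_of c"
    and p: "\<And>y. y \<in> W \<Longrightarrow> y \<in> dom_of c \<Longrightarrow> p y \<in> hpoly k"
    and hol: "\<And>v. hol_at c x (\<lambda>y. p y v)" and \<Phi>: "\<And>j. hol_at c x (\<lambda>y. \<Phi> y $ j)"
  shows "hol_at c x (\<lambda>y. p y (\<Phi> y))"
proof -
  have "hol_at c x (\<lambda>y. \<Sum>\<alpha>\<in>degrees k. coef k \<alpha> (p y) * mpow \<alpha> (\<Phi> y))"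
    unfolding mpow_def
    by (rule hol_at_sum, rule hol_at_mult, rule hol_coef, rule hol, rule hol_at_prod, rule hol_at_power, rule \<Phi>)
  then show ?thesis
    by (rule hol_at_cong[OF c W, rotated]) (rule coef_expand[OF p, symmetric])
qed

lemma hol_higgs:
  fixes p :: "'x::t2_space \<Rightarrow> complex^('n::finite option) \<Rightarrow> complex" and c :: "('x, 'n) chart"
  assumes c: "is_chart c" and W: "open W" "x \<in> W" "x \<in> dom_of c"
    and p: "\<And>y. y \<in> W \<Longrightarrow> y \<in> dom_of c \<Longrightarrow> p y \<in> hpoly k"
    and hol: "\<And>v. hol_at c x (\<lambda>y. p y v)"
  shows "hol_at c x (\<lambda>y. higgs w (p y) u)"
proof -
  have "hol_at c x (\<lambda>y. \<Sum>\<alpha>\<in>degrees k. coef k \<alpha> (p y) * higgs w (mpow \<alpha>) u)"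
    by (rule hol_at_sum, rule hol_at_mult, rule hol_coef, rule hol, rule hol_at_const)
  then show ?thesis
  proof (rule hol_at_cong[OF c W, rotated])
    fix y assume "y \<in> W" "y \<in> dom_of c"
    then have y: "p y \<in> hpoly k" by (rule p)
    have "mpow \<alpha> \<in> hpoly k" if "\<alpha> \<in> degrees k" for \<alpha> :: "'n option \<Rightarrow> nat"
      using that by (intro mpow_wpoly) (simp add: degs_def)
    from higgs_sum[where I="degrees k" and p=mpow and c="\<lambda>\<alpha>. coef k \<alpha> (p y)" and w=w, OF this]
    have "higgs w (\<lambda>u. \<Sum>\<alpha>\<in>degrees k. coef k \<alpha> (p y) * mpow \<alpha> u) u
        = (\<Sum>\<alpha>\<in>degrees k. coef k \<alpha> (p y) * higgs w (mpow \<alpha>) u)" by simp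
    moreover have "(\<lambda>u. \<Sum>\<alpha>\<in>degrees k. coef k \<alpha> (p y) * mpow \<alpha> u) = p y"
      by (rule ext) (rule coef_expand[OF y, symmetric])
    ultimately show "(\<Sum>\<alpha>\<in>degrees k. coef k \<alpha> (p y) * higgs w (mpow \<alpha>) u) = higgs w (p y) u"
      by (simp only:)
  qed
qed

text \<open>By multilinearity, arguments that depend on the point can be replaced by the constant basis
  vectors, one after the other.\<close>

lemma hol_pullback:
  fixes F :: "'x::t2_space \<Rightarrow> 'n::finite form" and c :: "('x, 'n) chart" and M :: "'x \<Rightarrow> complex^'n^'n"
  assumes c: "is_chart c" and W: "open W" "x \<in> W" "x \<in> dom_of c"
    and F: "\<And>y. y \<in> W \<Longrightarrow> y \<in> dom_of c \<Longrightarrow> F y \<in> alt_forms i (hpoly k)"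
    and hol: "\<And>vs v. hol_at c x (\<lambda>y. F y vs v)"
    and M: "\<And>i j. hol_at c x (\<lambda>y. M y $ i $ j)" and a: "hol_at c x a"
  shows "hol_at c x (\<lambda>y. pullback (a y) (\<lambda>v. M y *v v) (F y) ws u)"
proof -
  have Mw: "hol_at c x (\<lambda>y. (M y *v w) $ i)" for w i
    unfolding matrix_vector_mult_def by (simp, intro hol_at_sum hol_at_mult M hol_at_const)
  have ws: "hol_at c x (\<lambda>y. F y (vs @ map (\<lambda>v. M y *v v) ws) v)" for vs v
  proof (induction ws arbitrary: vs)
    case Nil
    then show ?case using hol by simp
  next
    case (Cons w ws)
    have "hol_at c x (\<lambda>y. \<Sum>j\<in>UNIV. (M y *v w) $ j * F y ((vs @ [axis j 1]) @ map (\<lambda>v. M y *v v) ws) v)"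
      by (intro hol_at_sum hol_at_mult Mw Cons)
    then show ?case
    proof (rule hol_at_cong[OF c W, rotated])
      fix y assume y: "y \<in> W" "y \<in> dom_of c"
      have "F y (vs @ (M y *v w) # map (\<lambda>v. M y *v v) ws) v
          = F y (vs @ (\<Sum>j\<in>UNIV. (M y *v w) $ j *s axis j 1) # map (\<lambda>v. M y *v v) ws) v"
        by (simp only: basis_expansion)
      also have "\<dots> = (\<Sum>j\<in>UNIV. (M y *v w) $ j * F y (vs @ axis j 1 # map (\<lambda>v. M y *v v) ws) v)"
        by (rule alt_sum_app[OF F[OF y]])
      finally show "(\<Sum>j\<in>UNIV. (M y *v w) $ j * F y ((vs @ [axis j 1]) @ map (\<lambda>v. M y *v v) ws) v)
          = F y (vs @ map (\<lambda>v. M y *v v) (w # ws)) v" by simp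
    qed
  qed
  have \<Phi>: "hol_at c x (\<lambda>y. dual_map (a y) (\<lambda>v. M y *v v) u $ j)" for j
    by (cases j) (auto intro!: hol_at_mult a Mw)
  show ?thesis
    unfolding pullback_def
  proof (rule hol_poly[OF c W])
    fix y assume "y \<in> W" "y \<in> dom_of c"
    from F[OF this] show "F y (map ((*v) (M y)) ws) \<in> hpoly k"
      by (rule alt_val) simp
  next
    show "hol_at c x (\<lambda>y. F y (map ((*v) (M y)) ws) v)" for v
      using ws[of "[]" v] by simp
  qed (rule \<Phi>)
qed

lemma hol_primitive:
  assumes "\<And>ws v. hol_at c x (\<lambda>y. F y ws v)"
  shows "hol_at c x (\<lambda>y. primitive i k (F y) ws u)"
  unfolding primitive_def homotopy_def contraction_def pullback_def divt_def
  by (intro hol_at_add hol_at_sum hol_at_mult hol_at_const hol_coef assms)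

section \<open>Sheaves of sections\<close>

locale log_bundle =
  fixes \<A> \<C> :: "('x::t2_space, 'n::finite) chart set" and D :: "'x set"
    and g :: "('x, 'n) chart \<Rightarrow> ('x, 'n) chart \<Rightarrow> 'x \<Rightarrow> complex"
  assumes atlas: "complex_atlas \<A>" and log_charts: "\<C> \<subseteq> log_charts \<A> D" and line_bundle: "line_bundle \<C> g"
begin

lemma C_charts: "c \<in> \<C> \<Longrightarrow> c \<in> log_charts \<A> D" "c \<in> \<C> \<Longrightarrow> c \<in> holo_charts \<A>" "c \<in> \<C> \<Longrightarrow> is_chart c"
  using log_charts log_chartsD by blast+

lemma A_charts: "c \<in> \<A> \<Longrightarrow> is_chart c"
  using atlas by (simp add: complex_atlas_def)

lemma chart_open: "is_chart c \<Longrightarrow> open (dom_of c)"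
  by (simp add: is_chart_def)

lemma log_transition_matrix:
  assumes "c \<in> \<C>" "c' \<in> \<C>"
  shows "\<exists>M :: 'x \<Rightarrow> complex^'n^'n.
    (\<forall>x\<in>dom_of c \<inter> dom_of c'. \<forall>i j. hol_at c x (\<lambda>x. M x $ i $ j)) \<and>
    (\<forall>x\<in>dom_of c \<inter> dom_of c' - D. \<forall>v. log_transition c c' x v = M x *v v) \<and>
    (\<forall>x\<in>dom_of c \<inter> dom_of c' \<inter> D. M x *v axis i\<^sub>1 1 = axis i\<^sub>1 1)"
  by (intro log_transition_extends[OF atlas] C_charts assms)

lemma clinear_matrix: "clinear_map (\<lambda>v. M *v v)"
  by (simp add: clinear_map_def matrix_vector_right_distrib vector_scalar_commute)

lemma clinear_log_transition:
  assumes "c \<in> \<C>" "c' \<in> \<C>" "x \<in> dom_of c" "x \<in> dom_of c'" "x \<notin> D"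
  shows "clinear_map (log_transition c c' x)"
proof -
  obtain M :: "complex^'n^'n" where "log_transition c c' x = (\<lambda>v. M *v v)"
    using log_transition_matrix[OF assms(1,2)] assms(3-) by fastforce
  then show ?thesis using clinear_matrix by simp
qed

lemma hol_at_C:
  assumes "c \<in> \<C>" "c' \<in> \<C>" "x \<in> dom_of c" "x \<in> dom_of c'" "hol_at c x f"
  shows "hol_at c' x f"
  by (rule hol_at_change[OF atlas C_charts(2)[OF assms(1)] C_charts(2)[OF assms(2)] assms(3-)])

lemma dual_transition_map: "dual_transition g c c' x = dual_map (g c c' x) (log_transition c c' x)"
  by (simp add: fun_eq_iff dual_transition_def dual_map_def)

lemma higgs_sections_iff:
  assumes "open U"
  shows "s \<in> higgs_sections D \<C> g k i U \<longleftrightarrow>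
     (\<forall>c x. c \<notin> \<C> \<or> x \<notin> U \<inter> dom_of c \<longrightarrow> s c x = (\<lambda>_ _. 0)) \<and>
     (\<forall>c\<in>\<C>. \<forall>x\<in>U \<inter> dom_of c. s c x \<in> alt_forms i (hpoly k)) \<and>
     (\<forall>c\<in>\<C>. \<forall>x\<in>U \<inter> dom_of c. \<forall>ws u. hol_at c x (\<lambda>x. s c x ws u)) \<and>
     (\<forall>c\<in>\<C>. \<forall>c'\<in>\<C>. \<forall>x\<in>U \<inter> dom_of c \<inter> dom_of c' - D.
        s c x = pullback (g c c' x) (log_transition c c' x) (s c' x))"
proof -
  have "(\<forall>c\<in>\<C>. \<forall>ws u. holo_at_chart c (U \<inter> dom_of c) (\<lambda>x. s c x ws u)) \<longleftrightarrow>
     (\<forall>c\<in>\<C>. \<forall>x\<in>U \<inter> dom_of c. \<forall>ws u. hol_at c x (\<lambda>x. s c x ws u))"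
    using holo_at_chart_iff[OF C_charts(3)] by (auto simp: holo_at_chart_iff[OF C_charts(3)])
  then show ?thesis
    unfolding higgs_sections_def mem_Collect_eq sym_power_wpoly dual_transition_map
    by (simp add: fun_eq_iff pullback_def)
qed

lemma higgs_sectionsD:
  assumes "s \<in> higgs_sections D \<C> g k i U" "open U"
  shows "c \<notin> \<C> \<or> x \<notin> U \<or> x \<notin> dom_of c \<Longrightarrow> s c x = (\<lambda>_ _. 0)"
    and "s c x \<in> alt_forms i (hpoly k)"
    and "c \<in> \<C> \<Longrightarrow> x \<in> U \<Longrightarrow> x \<in> dom_of c \<Longrightarrow> hol_at c x (\<lambda>x. s c x ws u)"
    and "c \<in> \<C> \<Longrightarrow> c' \<in> \<C> \<Longrightarrow> x \<in> U \<Longrightarrow> x \<in> dom_of c \<Longrightarrow> x \<in> dom_of c' \<Longrightarrow> x \<notin> D \<Longrightarrow>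
        s c x = pullback (g c c' x) (log_transition c c' x) (s c' x)"
proof -
  note s = assms(1)[unfolded higgs_sections_iff[OF assms(2)]]
  show z: "c \<notin> \<C> \<or> x \<notin> U \<or> x \<notin> dom_of c \<Longrightarrow> s c x = (\<lambda>_ _. 0)" for c x using s by blast
  show "s c x \<in> alt_forms i (hpoly k)"
  proof (cases "c \<notin> \<C> \<or> x \<notin> U \<or> x \<notin> dom_of c")
    case True
    then show ?thesis unfolding z[OF True] by (intro alt_forms_zero csubspace_wpoly)
  next
    case False
    then show ?thesis using s by blast
  qed
  show "c \<in> \<C> \<Longrightarrow> x \<in> U \<Longrightarrow> x \<in> dom_of c \<Longrightarrow> hol_at c x (\<lambda>x. s c x ws u)" using s by blast
  show "c \<in> \<C> \<Longrightarrow> c' \<in> \<C> \<Longrightarrow> x \<in> U \<Longrightarrow> x \<in> dom_of c \<Longrightarrow> x \<in> dom_of c' \<Longrightarrow> x \<notin> D \<Longrightarrow>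
        s c x = pullback (g c c' x) (log_transition c c' x) (s c' x)" using s by blast
qed

lemma higgs_sectionsI:
  assumes "open U"
    and "\<And>c x. c \<notin> \<C> \<or> x \<notin> U \<or> x \<notin> dom_of c \<Longrightarrow> s c x = (\<lambda>_ _. 0)"
    and "\<And>c x. c \<in> \<C> \<Longrightarrow> x \<in> U \<Longrightarrow> x \<in> dom_of c \<Longrightarrow> s c x \<in> alt_forms i (hpoly k)"
    and "\<And>c x ws u. c \<in> \<C> \<Longrightarrow> x \<in> U \<Longrightarrow> x \<in> dom_of c \<Longrightarrow> hol_at c x (\<lambda>x. s c x ws u)"
    and "\<And>c c' x. c \<in> \<C> \<Longrightarrow> c' \<in> \<C> \<Longrightarrow> x \<in> U \<Longrightarrow> x \<in> dom_of c \<Longrightarrow> x \<in> dom_of c' \<Longrightarrow> x \<notin> D \<Longrightarrow>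
        s c x = pullback (g c c' x) (log_transition c c' x) (s c' x)"
  shows "s \<in> higgs_sections D \<C> g k i U"
  unfolding higgs_sections_iff[OF assms(1)] using assms(2-) by (intro conjI allI ballI impI) blast+

lemma holo_ring_iff:
  assumes "open U"
  shows "f \<in> carrier (holo_ring \<A> U) \<longleftrightarrow> (\<forall>x. x \<notin> U \<longrightarrow> f x = 0) \<and> (\<forall>c\<in>\<A>. \<forall>x\<in>U \<inter> dom_of c. hol_at c x f)"
proof -
  have "cut U f = f \<longleftrightarrow> (\<forall>x. x \<notin> U \<longrightarrow> f x = 0)"
    by (auto simp: cut_def fun_eq_iff)
  moreover have "(\<forall>c\<in>\<A>. holo_at_chart c (U \<inter> dom_of c) f) \<longleftrightarrow> (\<forall>c\<in>\<A>. \<forall>x\<in>U \<inter> dom_of c. hol_at c x f)"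
    by (auto simp: holo_at_chart_iff[OF A_charts])
  ultimately show ?thesis by (simp add: holo_ring_def)
qed

lemma holo_ring_hol:
  assumes "open U" "f \<in> carrier (holo_ring \<A> U)" "c \<in> \<C>" "x \<in> U" "x \<in> dom_of c"
  shows "hol_at c x f"
proof -
  obtain d where d: "d \<in> \<A>" "x \<in> dom_of d" using atlas unfolding complex_atlas_def by blast
  then have "hol_at d x f" using assms by (auto simp: holo_ring_iff)
  then show ?thesis
    using hol_at_change[OF atlas atlas_holo_charts[OF atlas d(1)] C_charts(2)[OF assms(3)] d(2) assms(5)] by blast
qed

lemma holo_ring_cring:
  assumes U: "open U"
  shows "cring (holo_ring \<A> U)"
proof (rule cringI)
  have one: "cut U (\<lambda>_. 1) \<in> carrier (holo_ring \<A> U)"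
    unfolding holo_ring_iff[OF U]
  proof (intro conjI ballI)
    fix c x assume c: "c \<in> \<A>" "x \<in> U \<inter> dom_of c"
    show "hol_at c x (cut U (\<lambda>_. 1))"
      by (rule hol_at_cong[OF A_charts[OF c(1)] U, of _ "\<lambda>_. 1"]) (use c in \<open>auto simp: cut_def\<close>)
  qed (simp add: cut_def)
  have add: "(\<lambda>x. f x + h x) \<in> carrier (holo_ring \<A> U)" if "f \<in> carrier (holo_ring \<A> U)" "h \<in> carrier (holo_ring \<A> U)" for f h
    using that unfolding holo_ring_iff[OF U] by (auto intro: hol_at_add)
  have mult: "(\<lambda>x. f x * h x) \<in> carrier (holo_ring \<A> U)" if "f \<in> carrier (holo_ring \<A> U)" "h \<in> carrier (holo_ring \<A> U)" for f h
    using that unfolding holo_ring_iff[OF U] by (auto intro: hol_at_mult)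
  have neg: "(\<lambda>x. - f x) \<in> carrier (holo_ring \<A> U)" if "f \<in> carrier (holo_ring \<A> U)" for f
    using that unfolding holo_ring_iff[OF U] by (auto intro: hol_at_mult[of _ _ "\<lambda>_. -1", simplified])
  have zero: "(\<lambda>_. 0) \<in> carrier (holo_ring \<A> U)" by (simp add: holo_ring_iff[OF U])
  show "abelian_group (holo_ring \<A> U)"
  proof (rule abelian_groupI)
    fix f assume f: "f \<in> carrier (holo_ring \<A> U)"
    show "\<exists>h\<in>carrier (holo_ring \<A> U). h \<oplus>\<^bsub>holo_ring \<A> U\<^esub> f = \<zero>\<^bsub>holo_ring \<A> U\<^esub>"
      by (rule bexI[OF _ neg[OF f]]) (simp add: holo_ring_def)
  qed (use add zero in \<open>auto simp: holo_ring_def algebra_simps\<close>)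
  show "comm_monoid (holo_ring \<A> U)"
  proof (rule comm_monoidI)
    fix f assume "f \<in> carrier (holo_ring \<A> U)"
    then have "f x = 0" if "x \<notin> U" for x using that unfolding holo_ring_iff[OF U] by blast
    then show "\<one>\<^bsub>holo_ring \<A> U\<^esub> \<otimes>\<^bsub>holo_ring \<A> U\<^esub> f = f"
      by (auto simp: holo_ring_def cut_def fun_eq_iff)
  qed (use mult one in \<open>auto simp: holo_ring_def algebra_simps\<close>)
qed (auto simp: holo_ring_def algebra_simps)

text \<open>Conditions on the values of sections that define subsheaves of modules.\<close>

definition subspaces :: "('x \<Rightarrow> 'n form set) \<Rightarrow> bool" where
  "subspaces Q \<longleftrightarrow> (\<forall>x. (\<lambda>_ _. 0) \<in> Q x \<and>
     (\<forall>p\<in>Q x. \<forall>q\<in>Q x. \<forall>a b. (\<lambda>ws u. a * p ws u + b * q ws u) \<in> Q x))"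

lemma subspacesD:
  assumes "subspaces Q"
  shows "(\<lambda>_ _. 0) \<in> Q x" "p \<in> Q x \<Longrightarrow> q \<in> Q x \<Longrightarrow> (\<lambda>ws u. a * p ws u + b * q ws u) \<in> Q x"
  using assms unfolding subspaces_def by blast+

abbreviation sections where
  "sections k i Q U \<equiv> carrier (Sec (section_sheaf D \<C> g k i Q) U)"

lemma sections_iff:
  "s \<in> sections k i Q U \<longleftrightarrow> s \<in> higgs_sections D \<C> g k i U \<and> (\<forall>c\<in>\<C>. \<forall>x\<in>U \<inter> dom_of c. s c x \<in> Q x)"
  by (simp add: section_sheaf_def)

lemma sections_Q:
  assumes "s \<in> sections k i Q U" "subspaces Q" "open U"
  shows "s c x \<in> Q x"
proof (cases "c \<in> \<C> \<and> x \<in> U \<inter> dom_of c")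
  case True
  then show ?thesis using assms(1) by (simp add: sections_iff)
next
  case False
  then have "s c x = (\<lambda>_ _. 0)" using assms by (intro higgs_sectionsD(1)) (auto simp: sections_iff)
  then show ?thesis using subspacesD(1)[OF assms(2)] by simp
qed

lemma section_sheaf_ops:
  "s \<oplus>\<^bsub>Sec (section_sheaf D \<C> g k i Q) U\<^esub> t = (\<lambda>c x ws u. s c x ws u + t c x ws u)"
  "\<zero>\<^bsub>Sec (section_sheaf D \<C> g k i Q) U\<^esub> = (\<lambda>c x ws u. 0)"
  "f \<odot>\<^bsub>Sec (section_sheaf D \<C> g k i Q) U\<^esub> s = (\<lambda>c x ws u. f x * s c x ws u)"
  "Res (section_sheaf D \<C> g k i Q) U V s = (\<lambda>c x ws u. if x \<in> V then s c x ws u else 0)"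
  by (simp_all add: section_sheaf_def)

lemma pullback_lincomb:
  "pullback a L (\<lambda>ws u. b * f ws u + d * h ws u) = (\<lambda>ws u. b * pullback a L f ws u + d * pullback a L h ws u)"
  by (simp add: pullback_def fun_eq_iff)

lemma pullback_zero [simp]: "pullback a L (\<lambda>_ _. 0) = (\<lambda>_ _. 0)"
  by (simp add: pullback_def fun_eq_iff)

lemma sections_lincomb:
  assumes U: "open U" and Q: "subspaces Q" and s: "s \<in> sections k i Q U" "t \<in> sections k i Q U"
    and a: "\<And>c x. c \<in> \<C> \<Longrightarrow> x \<in> U \<Longrightarrow> x \<in> dom_of c \<Longrightarrow> hol_at c x a"
    and b: "\<And>c x. c \<in> \<C> \<Longrightarrow> x \<in> U \<Longrightarrow> x \<in> dom_of c \<Longrightarrow> hol_at c x b"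
  shows "(\<lambda>c x ws u. a x * s c x ws u + b x * t c x ws u) \<in> sections k i Q U"
  unfolding sections_iff
proof (intro conjI ballI)
  have h: "s \<in> higgs_sections D \<C> g k i U" "t \<in> higgs_sections D \<C> g k i U" using s by (auto simp: sections_iff)
  note sD = higgs_sectionsD[OF h(1) U] and tD = higgs_sectionsD[OF h(2) U]
  show "(\<lambda>c x ws u. a x * s c x ws u + b x * t c x ws u) \<in> higgs_sections D \<C> g k i U"
  proof (rule higgs_sectionsI[OF U])
    fix c x
    show "c \<notin> \<C> \<or> x \<notin> U \<or> x \<notin> dom_of c \<Longrightarrow> (\<lambda>ws u. a x * s c x ws u + b x * t c x ws u) = (\<lambda>_ _. 0)"
      by (simp add: sD(1) tD(1))
    show "(\<lambda>ws u. a x * s c x ws u + b x * t c x ws u) \<in> alt_forms i (hpoly k)"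
      by (intro alt_forms_lincomb sD tD csubspace_wpoly)
  next
    fix c x ws u assume "c \<in> \<C>" "x \<in> U" "x \<in> dom_of c"
    then show "hol_at c x (\<lambda>x. a x * s c x ws u + b x * t c x ws u)"
      by (intro hol_at_add hol_at_mult a b sD tD)
  next
    fix c c' x assume A: "c \<in> \<C>" "c' \<in> \<C>" "x \<in> U" "x \<in> dom_of c" "x \<in> dom_of c'" "x \<notin> D"
    show "(\<lambda>ws u. a x * s c x ws u + b x * t c x ws u)
        = pullback (g c c' x) (log_transition c c' x) (\<lambda>ws u. a x * s c' x ws u + b x * t c' x ws u)"
      unfolding pullback_lincomb sD(4)[OF A] tD(4)[OF A] ..
  qed
  fix c x
  show "(\<lambda>ws u. a x * s c x ws u + b x * t c x ws u) \<in> Q x"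
    by (intro subspacesD[OF Q] sections_Q[OF s(1) Q U] sections_Q[OF s(2) Q U])
qed

lemma sections_zero:
  assumes U: "open U" and Q: "subspaces Q"
  shows "(\<lambda>_ _ _ _. 0) \<in> sections k i Q U"
  unfolding sections_iff
  by (intro conjI ballI subspacesD[OF Q] higgs_sectionsI[OF U]) (auto intro: alt_forms_zero csubspace_wpoly)

lemma sections_restrict:
  assumes U: "open U" "open V" "V \<subseteq> U" and s: "s \<in> sections k i Q U"
  shows "(\<lambda>c x ws u. if x \<in> V then s c x ws u else 0) \<in> sections k i Q V"
  unfolding sections_iff
proof (intro conjI ballI)
  have h: "s \<in> higgs_sections D \<C> g k i U" using s by (auto simp: sections_iff)
  note sD = higgs_sectionsD[OF h U(1)]
  show "(\<lambda>c x ws u. if x \<in> V then s c x ws u else 0) \<in> higgs_sections D \<C> g k i V"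
  proof (rule higgs_sectionsI[OF U(2)])
    fix c x
    show "c \<notin> \<C> \<or> x \<notin> V \<or> x \<notin> dom_of c \<Longrightarrow> (\<lambda>ws u. if x \<in> V then s c x ws u else 0) = (\<lambda>_ _. 0)"
      by (auto simp: sD(1) fun_eq_iff)
    show "x \<in> V \<Longrightarrow> (\<lambda>ws u. if x \<in> V then s c x ws u else 0) \<in> alt_forms i (hpoly k)"
      by (simp add: sD(2))
  next
    fix c x ws u assume c: "c \<in> \<C>" "x \<in> V" "x \<in> dom_of c"
    then have "hol_at c x (\<lambda>x. s c x ws u)" using U by (intro sD) auto
    then show "hol_at c x (\<lambda>x. if x \<in> V then s c x ws u else 0)"
      by (rule hol_at_cong[OF C_charts(3)[OF c(1)] U(2) c(2,3), rotated]) simp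
  next
    fix c c' x assume c: "c \<in> \<C>" "c' \<in> \<C>" "x \<in> V" "x \<in> dom_of c" "x \<in> dom_of c'" "x \<notin> D"
    then have "s c x = pullback (g c c' x) (log_transition c c' x) (s c' x)" using U by (intro sD) auto
    then show "(\<lambda>ws u. if x \<in> V then s c x ws u else 0)
        = pullback (g c c' x) (log_transition c c' x) (\<lambda>ws u. if x \<in> V then s c' x ws u else 0)"
      using c(3) by simp
  qed
  fix c x assume "c \<in> \<C>" "x \<in> V \<inter> dom_of c"
  then show "(\<lambda>ws u. if x \<in> V then s c x ws u else 0) \<in> Q x"
    using s U by (auto simp: sections_iff)
qed

lemma section_sheaf_module:
  assumes U: "open U" and Q: "subspaces Q"
  shows "Module.module (holo_ring \<A> U) (Sec (section_sheaf D \<C> g k i Q) U)"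
proof (rule Module.moduleI)
  let ?M = "Sec (section_sheaf D \<C> g k i Q) U"
  show "cring (holo_ring \<A> U)" by (rule holo_ring_cring[OF U])
  note lc = sections_lincomb[OF U Q]
  have add: "s \<oplus>\<^bsub>?M\<^esub> t \<in> carrier ?M" if "s \<in> carrier ?M" "t \<in> carrier ?M" for s t
    using lc[OF that, of "\<lambda>_. 1" "\<lambda>_. 1"] by (simp add: section_sheaf_ops)
  show "abelian_group ?M"
  proof (rule abelian_groupI)
    fix s assume s: "s \<in> carrier ?M"
    have "(\<lambda>c x ws u. (-1) * s c x ws u + 0 * s c x ws u) \<in> carrier ?M"
      by (rule lc[OF s s, of "\<lambda>_. -1" "\<lambda>_. 0"]) auto
    then show "\<exists>t\<in>carrier ?M. t \<oplus>\<^bsub>?M\<^esub> s = \<zero>\<^bsub>?M\<^esub>"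
      by (rule bexI[rotated]) (simp add: section_sheaf_ops)
  qed (use add sections_zero[OF U Q] in \<open>auto simp: section_sheaf_ops algebra_simps\<close>)
  show "f \<odot>\<^bsub>?M\<^esub> s \<in> carrier ?M" if f: "f \<in> carrier (holo_ring \<A> U)" and s: "s \<in> carrier ?M" for f s
    using lc[OF s s, of f "\<lambda>_. 0"] holo_ring_hol[OF U f] by (simp add: section_sheaf_ops)
  show "\<one>\<^bsub>holo_ring \<A> U\<^esub> \<odot>\<^bsub>?M\<^esub> s = s" if s: "s \<in> carrier ?M" for s
  proof -
    have h: "s \<in> higgs_sections D \<C> g k i U" using s by (auto simp: sections_iff)
    show ?thesis
      unfolding section_sheaf_ops using higgs_sectionsD(1)[OF h U] by (auto simp: holo_ring_def cut_def fun_eq_iff)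
  qed
qed (simp_all add: section_sheaf_ops holo_ring_def algebra_simps)

text \<open>A section is given by its values at points, and all conditions on it are local.\<close>

lemma section_sheaf_glue:
  assumes Q: "subspaces Q" and \<U>: "\<forall>U\<in>\<U>. open U \<and> s U \<in> sections k i Q U"
    and eq: "\<forall>U\<in>\<U>. \<forall>V\<in>\<U>. Res (section_sheaf D \<C> g k i Q) U (U \<inter> V) (s U) = Res (section_sheaf D \<C> g k i Q) V (U \<inter> V) (s V)"
  shows "\<exists>!t. t \<in> sections k i Q (\<Union>\<U>) \<and> (\<forall>U\<in>\<U>. Res (section_sheaf D \<C> g k i Q) (\<Union>\<U>) U t = s U)"
proof
  have o: "open (\<Union>\<U>)" and oU: "\<And>U. U \<in> \<U> \<Longrightarrow> open U" using \<U> by auto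
  have h: "s U \<in> higgs_sections D \<C> g k i U" and q: "\<And>c x. s U c x \<in> Q x" if "U \<in> \<U>" for U
    using \<U> that sections_Q[OF _ Q] by (auto simp: sections_iff)
  note sD = higgs_sectionsD[OF h oU]
  have agree: "s U c x = s V c x" if "U \<in> \<U>" "V \<in> \<U>" "x \<in> U" "x \<in> V" for U V c x
  proof (intro ext)
    fix ws u
    from fun_cong[OF fun_cong[OF fun_cong[OF fun_cong[OF
      eq[rule_format, OF that(1,2), unfolded section_sheaf_ops], of c], of x], of ws], of u]
    have "(if x \<in> U \<inter> V then s U c x ws u else 0) = (if x \<in> U \<inter> V then s V c x ws u else 0)" .
    moreover have "x \<in> U \<inter> V" using that by blast
    ultimately show "s U c x ws u = s V c x ws u" by (simp only: if_True)
  qed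
  define W where "W x = (SOME U. U \<in> \<U> \<and> x \<in> U)" for x
  have W: "W x \<in> \<U>" "x \<in> W x" if "x \<in> \<Union>\<U>" for x
  proof -
    have "\<exists>U. U \<in> \<U> \<and> x \<in> U" using that by blast
    from someI_ex[OF this] show "W x \<in> \<U>" "x \<in> W x" unfolding W_def by blast+
  qed
  define t where "t c x ws u = (if x \<in> \<Union>\<U> then s (W x) c x ws u else 0)" for c x ws u
  have t: "t c x = s U c x" if "U \<in> \<U>" "x \<in> U" for c x U
  proof -
    have x: "x \<in> \<Union>\<U>" using that by blast
    have "t c x = s (W x) c x" unfolding t_def using x by (simp only: if_True)
    also have "\<dots> = s U c x" by (rule agree[OF W(1)[OF x] that(1) W(2)[OF x] that(2)])
    finally show ?thesis .
  qed
  have t0: "t c x = (\<lambda>_ _. 0)" if "x \<notin> \<Union>\<U>" for c x using that by (auto simp: t_def fun_eq_iff)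
  show "t \<in> sections k i Q (\<Union>\<U>) \<and> (\<forall>U\<in>\<U>. Res (section_sheaf D \<C> g k i Q) (\<Union>\<U>) U t = s U)"
  proof (intro conjI ballI)
    show "t \<in> sections k i Q (\<Union>\<U>)"
      unfolding sections_iff
    proof (intro conjI ballI higgs_sectionsI[OF o])
      fix c x assume "c \<notin> \<C> \<or> x \<notin> \<Union>\<U> \<or> x \<notin> dom_of c"
      then show "t c x = (\<lambda>_ _. 0)"
      proof (cases "x \<in> \<Union>\<U>")
        case True
        then obtain U where U: "U \<in> \<U>" "x \<in> U" by blast
        show ?thesis unfolding t[OF U] using \<open>c \<notin> \<C> \<or> x \<notin> \<Union>\<U> \<or> x \<notin> dom_of c\<close> True
          by (intro sD(1)[OF U(1) U(1)]) blast
      qed (rule t0)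
    next
      fix c x assume "c \<in> \<C>" "x \<in> \<Union>\<U>" "x \<in> dom_of c"
      then obtain U where U: "U \<in> \<U>" "x \<in> U" by blast
      show "t c x \<in> alt_forms i (hpoly k)" unfolding t[OF U] by (rule sD(2)[OF U(1) U(1)])
    next
      fix c x ws u assume c: "c \<in> \<C>" "x \<in> \<Union>\<U>" "x \<in> dom_of c"
      then obtain U where U: "U \<in> \<U>" "x \<in> U" by blast
      have "hol_at c x (\<lambda>x. s U c x ws u)" using c U by (intro sD(3)) auto
      then show "hol_at c x (\<lambda>x. t c x ws u)"
        by (rule hol_at_cong[OF C_charts(3)[OF c(1)] oU[OF U(1)] U(2) c(3), rotated]) (simp add: t[OF U(1)])
    next
      fix c c' x assume c: "c \<in> \<C>" "c' \<in> \<C>" "x \<in> \<Union>\<U>" "x \<in> dom_of c" "x \<in> dom_of c'" "x \<notin> D"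
      then obtain U where U: "U \<in> \<U>" "x \<in> U" by blast
      show "t c x = pullback (g c c' x) (log_transition c c' x) (t c' x)"
        unfolding t[OF U] using c U by (intro sD(4)) auto
    next
      fix c x assume "c \<in> \<C>" "x \<in> \<Union>\<U> \<inter> dom_of c"
      then obtain U where U: "U \<in> \<U>" "x \<in> U" by blast
      show "t c x \<in> Q x" unfolding t[OF U] by (rule q[OF U(1)])
    qed
    fix U assume U: "U \<in> \<U>"
    show "Res (section_sheaf D \<C> g k i Q) (\<Union>\<U>) U t = s U"
      unfolding section_sheaf_ops using t[OF U] sD(1)[OF U U] by (auto simp: fun_eq_iff)
  qed
  fix t' assume t': "t' \<in> sections k i Q (\<Union>\<U>) \<and> (\<forall>U\<in>\<U>. Res (section_sheaf D \<C> g k i Q) (\<Union>\<U>) U t' = s U)"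
  show "t' = t"
  proof (intro ext)
    fix c x ws u
    show "t' c x ws u = t c x ws u"
    proof (cases "x \<in> \<Union>\<U>")
      case True
      then obtain U where U: "U \<in> \<U>" "x \<in> U" by blast
      have "Res (section_sheaf D \<C> g k i Q) (\<Union>\<U>) U t' = s U" using t' U by blast
      from fun_cong[OF fun_cong[OF fun_cong[OF fun_cong[OF this[unfolded section_sheaf_ops], of c], of x], of ws], of u]
      have "t' c x ws u = s U c x ws u" using U(2) by simp
      then show ?thesis by (simp add: t[OF U])
    next
      case False
      have "t' \<in> higgs_sections D \<C> g k i (\<Union>\<U>)" using t' by (simp add: sections_iff)
      then show ?thesis using higgs_sectionsD(1)[OF _ o] False t0 by simp
    qed
  qed
qed

theorem section_sheaf_omodule:
  assumes Q: "subspaces Q"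
  shows "is_omodule \<A> (section_sheaf D \<C> g k i Q)"
  unfolding is_omodule_def
proof (intro conjI allI impI ballI)
  show "open U \<Longrightarrow> Module.module (holo_ring \<A> U) (Sec (section_sheaf D \<C> g k i Q) U)" for U
    by (rule section_sheaf_module[OF _ Q])
  show "Res (section_sheaf D \<C> g k i Q) U V \<in> sections k i Q U \<rightarrow> sections k i Q V"
    if "open U" "open V" "V \<subseteq> U" for U V
    using sections_restrict[OF that] by (auto simp: section_sheaf_ops)
  show "Res (section_sheaf D \<C> g k i Q) U U s = s" if "open U" "s \<in> sections k i Q U" for U s
  proof -
    have h: "s \<in> higgs_sections D \<C> g k i U" using that by (auto simp: sections_iff)
    show ?thesis unfolding section_sheaf_ops using higgs_sectionsD(1)[OF h that(1)] by (auto simp: fun_eq_iff)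
  qed
  show "\<exists>!t. t \<in> sections k i Q (\<Union>\<U>) \<and> (\<forall>U\<in>\<U>. Res (section_sheaf D \<C> g k i Q) (\<Union>\<U>) U t = s U)"
    if "\<forall>U\<in>\<U>. open U \<and> s U \<in> sections k i Q U"
      "\<forall>U\<in>\<U>. \<forall>V\<in>\<U>. Res (section_sheaf D \<C> g k i Q) U (U \<inter> V) (s U) = Res (section_sheaf D \<C> g k i Q) V (U \<inter> V) (s V)"
    for \<U> s
    by (rule section_sheaf_glue[OF Q that])
qed (auto simp: section_sheaf_ops fun_eq_iff cut_def)

end

section \<open>The Higgs complex and the complex T\<close>

lemma wedge_higgs_zero [simp]: "wedge_higgs (\<lambda>_ _. 0) = (\<lambda>_ _. 0)"
  by (simp add: wedge_higgs_def fun_eq_iff)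

lemma wedge_higgs_lincomb:
  assumes "f \<in> alt_forms i (hpoly k)" "h \<in> alt_forms j (hpoly k)"
  shows "wedge_higgs (\<lambda>ws u. a * f ws u + b * h ws u) = (\<lambda>ws u. a * wedge_higgs f ws u + b * wedge_higgs h ws u)"
  unfolding wedge_higgs_op
  by (intro ext wedge_op_lincomb[OF form_op_higgs[of "\<lambda>_. 0" k 0]] alt_val[OF assms(1)] alt_val[OF assms(2)] wpoly_zero)

lemma wedge_higgs_forms:
  assumes "f \<in> alt_forms i (hpoly k)"
  shows "wedge_higgs f \<in> alt_forms (Suc i) (hpoly k)"
  unfolding wedge_higgs_op
  by (rule wedge_op_forms[OF form_op_higgs assms csubspace_wpoly]) (erule higgs_wpoly, simp)

lemma wedge_higgs_square:
  assumes "f \<in> alt_forms i (hpoly k)"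
  shows "wedge_higgs (wedge_higgs f) = (\<lambda>_ _. 0)"
proof (intro ext)
  fix ws u
  show "wedge_higgs (wedge_higgs f) ws u = 0"
    unfolding wedge_higgs_op
  proof (rule wedge_op_square[OF form_op_higgs])
    show "higgs w p \<in> hpoly k" if "p \<in> hpoly k" for w p
      by (rule higgs_wpoly[OF that]) simp
    show "higgs v (higgs w p) = higgs w (higgs v p)" if "p \<in> hpoly k" for v w p
      by (rule higgs_commute[OF that])
    show "f ws \<in> hpoly k" for ws by (rule alt_val[OF assms]) simp
  qed
qed

lemma wedge_higgs_drop_t:
  assumes "f \<in> alt_forms i (hpoly k)"
  shows "wedge_higgs f ws (drop_t u) = 0"
proof -
  have "f ws \<in> hpoly k" for ws by (rule alt_val[OF assms]) simp
  then show ?thesis by (simp add: wedge_higgs_def higgs_eq[where \<omega>="\<lambda>_. 0" and k=k and m=0])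
qed

lemma csubspace_sym_summand: "csubspace (sym_summand k 0)" "csubspace (sym_summand k k)"
  unfolding csubspace_def by (auto simp: sym_summand_0_iff sym_summand_top_iff intro: wpoly_lincomb)

text \<open>Changes of charts are compatible with setting \<open>t = 0\<close>, as they multiply \<open>t\<close> by a function.\<close>

lemma pullback_drop_t:
  assumes "clinear_map L"
  shows "pullback a L (\<lambda>ws u. f ws (drop_t u)) ws u = pullback a L f ws (drop_t u)"
proof -
  have "drop_t (dual_map a L u) = dual_map a L (drop_t u)"
    by (simp add: vec_eq_iff bi_scale_def dual_map_def split: option.split)
  then show ?thesis by (simp add: pullback_def)
qed

lemma pullback_compose:
  assumes "clinear_map L'"
  shows "pullback a L (pullback b L' f) = pullback (b * a) (\<lambda>v. L' (L v)) f"
proof -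
  have "dual_map b L' (dual_map a L u) = dual_map (b * a) (\<lambda>v. L' (L v)) u" for u
  proof -
    have "(\<chi> l. dual_map a L u $ Some l) = a *s L (\<chi> l. u $ Some l) + 0 *s 0"
      by (simp add: vec_eq_iff)
    then have "L' (\<chi> l. dual_map a L u $ Some l) = a *s L' (L (\<chi> l. u $ Some l)) + 0 *s L' 0"
      using assms unfolding clinear_map_def by (simp only:)
    then show ?thesis
      by (simp add: vec_eq_iff dual_map_def[of b] dual_map_def[of "b * a"] split: option.split)
  qed
  then show ?thesis by (simp add: pullback_def fun_eq_iff o_def)
qed

context log_bundle
begin

lemma subspaces_l2: "subspaces (l2_condition D k i)"
  unfolding subspaces_def l2_condition_def by (auto intro: l2_forms_lincomb l2_forms_zero)

definition T_condition :: "nat \<Rightarrow> nat \<Rightarrow> 'x \<Rightarrow> 'n form set" where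
  "T_condition k i x = (if i = 0 then alt_forms 0 (sym_summand k 0)
     else {f\<in>alt_forms i (sym_summand k k). wedge_higgs f = (\<lambda>_ _. 0)} \<inter> l2_condition D k i x)"

lemma T_sheaf_eq: "T_sheaf D \<C> g k i = section_sheaf D \<C> g k i (T_condition k i)"
  by (cases "i = 0") (simp_all add: T_sheaf_def T_condition_def[abs_def])

lemma sym_summand_wpoly:
  "p \<in> sym_summand k 0 \<Longrightarrow> p \<in> hpoly k" "p \<in> sym_summand k k \<Longrightarrow> p \<in> hpoly k"
  by (simp_all add: sym_summand_0_iff sym_summand_top_iff)

lemma alt_sym_summand:
  "f \<in> alt_forms i (sym_summand k 0) \<Longrightarrow> f \<in> alt_forms i (hpoly k)"
  "f \<in> alt_forms i (sym_summand k k) \<Longrightarrow> f \<in> alt_forms i (hpoly k)"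
proof -
  assume f: "f \<in> alt_forms i (sym_summand k 0)"
  show "f \<in> alt_forms i (hpoly k)"
    by (rule alt_mono[OF f], rule sym_summand_wpoly(1), rule alt_val[OF f])
       (rule csubspaceD(1)[OF csubspace_sym_summand(1)])
next
  assume f: "f \<in> alt_forms i (sym_summand k k)"
  show "f \<in> alt_forms i (hpoly k)"
    by (rule alt_mono[OF f], rule sym_summand_wpoly(2), rule alt_val[OF f])
       (rule csubspaceD(1)[OF csubspace_sym_summand(2)])
qed

lemma subspaces_T: "subspaces (T_condition k i)"
  unfolding subspaces_def
proof (intro allI conjI ballI)
  fix x
  show "(\<lambda>_ _. 0) \<in> T_condition k i x"
    using subspacesD(1)[OF subspaces_l2, of k i x]
    by (simp add: T_condition_def alt_forms_zero csubspace_sym_summand)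
  fix p q a b assume "p \<in> T_condition k i x" "q \<in> T_condition k i x"
  then show "(\<lambda>ws u. a * p ws u + b * q ws u) \<in> T_condition k i x"
    using alt_forms_lincomb[OF _ _ csubspace_sym_summand(1), of p 0 k q a b]
      alt_forms_lincomb[OF _ _ csubspace_sym_summand(2), of p i k q a b]
      wedge_higgs_lincomb[OF alt_sym_summand(2) alt_sym_summand(2), of p i k q i a b]
      subspacesD(2)[OF subspaces_l2, of p k i x q a b]
    by (auto simp: T_condition_def split: if_splits)
qed

lemma T_condition_closed:
  assumes "f \<in> T_condition k i x"
  shows "wedge_higgs f = (\<lambda>_ _. 0)"
proof (cases "i = 0")
  case True
  then have "f ws \<in> sym_summand k 0" for ws
    using assms by (intro alt_val[of f 0] csubspaceD csubspace_sym_summand) (simp add: T_condition_def)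
  then have "higgs w (f ws) = (\<lambda>_. 0)" for w ws by (rule higgs_sym_summand_0)
  then show ?thesis by (simp add: wedge_higgs_def fun_eq_iff)
qed (use assms in \<open>simp add: T_condition_def\<close>)

text \<open>In degree \<open>0\<close>, the condition holds since \<open>t\<^sup>k\<close> has weight \<open>-k \<le> 0\<close>.\<close>

lemma T_condition_l2:
  assumes "f \<in> T_condition k i x"
  shows "f \<in> l2_condition D k i x"
proof (cases "i = 0")
  case True
  then have f: "f \<in> alt_forms 0 (sym_summand k 0)" using assms by (simp add: T_condition_def)
  have "f ws \<in> sym_summand k 0" for ws by (intro alt_val[OF f] csubspaceD csubspace_sym_summand)
  then have "f \<in> alt_forms 0 (wpoly cusp_wt k 0)" by (intro alt_mono[OF f] sym_summand_0_cusp)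
  moreover have "f ws \<in> wpoly cusp_wt k (-2)" if "axis i\<^sub>1 1 \<in> set ws" for ws
  proof -
    have "length ws \<noteq> 0" using that by auto
    then show ?thesis using alt_len[OF f] by simp
  qed
  ultimately show ?thesis using True by (simp add: l2_condition_def l2_forms_iff del: l2_forms.simps)
qed (use assms in \<open>simp add: T_condition_def\<close>)

lemma sections_forms: "s \<in> sections k i Q U \<Longrightarrow> open U \<Longrightarrow> s c x \<in> alt_forms i (hpoly k)"
  by (rule higgs_sectionsD(2)[where s=s and U=U]) (simp_all add: sections_iff)

lemma sections_outside:
  "s \<in> sections k i Q U \<Longrightarrow> open U \<Longrightarrow> c \<notin> \<C> \<or> x \<notin> U \<or> x \<notin> dom_of c \<Longrightarrow> s c x = (\<lambda>_ _. 0)"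
  by (rule higgs_sectionsD(1)[where s=s and U=U and k=k and i=i]) (simp_all add: sections_iff)

lemma hol_wedge_higgs:
  assumes s: "s \<in> sections k i Q U" and U: "open U" and c: "c \<in> \<C>" "x \<in> U" "x \<in> dom_of c"
  shows "hol_at c x (\<lambda>y. wedge_higgs (s c y) ws u)"
proof -
  have h: "s \<in> higgs_sections D \<C> g k i U" using s by (simp add: sections_iff)
  have "hol_at c x (\<lambda>y. higgs w (s c y vs) u)" for w vs
  proof (rule hol_higgs[OF C_charts(3)[OF c(1)] U c(2,3)])
    show "s c y vs \<in> hpoly k" for y by (rule alt_val[OF sections_forms[OF s U]]) simp
    show "hol_at c x (\<lambda>y. s c y vs v)" for v by (rule higgs_sectionsD(3)[OF h U c])
  qed
  then show ?thesis
    unfolding wedge_higgs_def by (intro hol_at_sum hol_at_mult hol_at_const)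
qed

lemma wedge_higgs_sections:
  assumes s: "s \<in> sections k i (l2_condition D k i) U" and U: "open U"
  shows "(\<lambda>c x. wedge_higgs (s c x)) \<in> sections k (Suc i) (l2_condition D k (Suc i)) U"
  unfolding sections_iff
proof (intro conjI ballI higgs_sectionsI[OF U])
  have h: "s \<in> higgs_sections D \<C> g k i U" using s by (simp add: sections_iff)
  fix c x
  show "c \<notin> \<C> \<or> x \<notin> U \<or> x \<notin> dom_of c \<Longrightarrow> wedge_higgs (s c x) = (\<lambda>_ _. 0)"
    by (simp add: sections_outside[OF s U])
  show "wedge_higgs (s c x) \<in> alt_forms (Suc i) (hpoly k)"
    by (rule wedge_higgs_forms[OF sections_forms[OF s U]])
  show "c \<in> \<C> \<Longrightarrow> x \<in> U \<Longrightarrow> x \<in> dom_of c \<Longrightarrow> hol_at c x (\<lambda>x. wedge_higgs (s c x) ws u)" for ws u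
    by (rule hol_wedge_higgs[OF s U])
  show "wedge_higgs (s c x) = pullback (g c c' x) (log_transition c c' x) (wedge_higgs (s c' x))"
    if A: "c \<in> \<C>" "c' \<in> \<C>" "x \<in> U" "x \<in> dom_of c" "x \<in> dom_of c'" "x \<notin> D" for c'
    unfolding higgs_sectionsD(4)[OF h U A]
    by (rule wedge_higgs_pullback[OF clinear_log_transition[OF A(1,2,4-)]])
  show "wedge_higgs (s c x) \<in> l2_condition D k (Suc i) x"
    using sections_Q[OF s subspaces_l2 U, of c x]
    by (auto simp: l2_condition_def intro: l2_forms_wedge simp del: l2_forms.simps)
qed

lemma if_apply_forms: "(\<lambda>ws u. if P then f ws u else 0) = (if P then f else (\<lambda>_ _. 0))"
  by simp

lemma l2_higgs_ocomplex: "is_ocomplex \<A> (l2_higgs_complex D \<C> g k)"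
  unfolding is_ocomplex_def l2_higgs_complex_def ocomplex.simps omodule_hom_def
proof (intro allI conjI impI ballI)
  fix i
  show "is_omodule \<A> (section_sheaf D \<C> g k i (l2_condition D k i))"
    by (rule section_sheaf_omodule[OF subspaces_l2])
  fix U :: "'x set" assume U: "open U"
  let ?S = "section_sheaf D \<C> g k"
  show "(\<lambda>s c x. wedge_higgs (s c x)) \<in> sections k i (l2_condition D k i) U \<rightarrow> sections k (Suc i) (l2_condition D k (Suc i)) U"
    using wedge_higgs_sections[OF _ U] by blast
  fix s assume s: "s \<in> sections k i (l2_condition D k i) U"
  note sf = sections_forms[OF s U]
  show "(\<lambda>c x. wedge_higgs ((s \<oplus>\<^bsub>Sec (?S i (l2_condition D k i)) U\<^esub> t) c x))
      = (\<lambda>c x. wedge_higgs (s c x)) \<oplus>\<^bsub>Sec (?S (Suc i) (l2_condition D k (Suc i))) U\<^esub> (\<lambda>c x. wedge_higgs (t c x))"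
    if t: "t \<in> sections k i (l2_condition D k i) U" for t
    unfolding section_sheaf_ops
  proof (intro ext)
    fix c x ws u
    show "wedge_higgs (\<lambda>ws u. s c x ws u + t c x ws u) ws u = wedge_higgs (s c x) ws u + wedge_higgs (t c x) ws u"
      using wedge_higgs_lincomb[OF sf[of c x] sections_forms[OF t U, of c x], of 1 1] by simp
  qed
  show "(\<lambda>c x. wedge_higgs ((f \<odot>\<^bsub>Sec (?S i (l2_condition D k i)) U\<^esub> s) c x))
      = f \<odot>\<^bsub>Sec (?S (Suc i) (l2_condition D k (Suc i))) U\<^esub> (\<lambda>c x. wedge_higgs (s c x))" for f
    unfolding section_sheaf_ops
  proof (intro ext)
    fix c x ws u
    show "wedge_higgs (\<lambda>ws u. f x * s c x ws u) ws u = f x * wedge_higgs (s c x) ws u"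
      using wedge_higgs_lincomb[OF sf[of c x] sf[of c x], of "f x" 0] by simp
  qed
  show "(\<lambda>c x. wedge_higgs (Res (?S i (l2_condition D k i)) U V s c x))
      = Res (?S (Suc i) (l2_condition D k (Suc i))) U V (\<lambda>c x. wedge_higgs (s c x))" for V
    unfolding section_sheaf_ops if_apply_forms by (intro ext) simp
  show "(\<lambda>c x. wedge_higgs (wedge_higgs (s c x))) = \<zero>\<^bsub>Sec (?S (Suc (Suc i)) (l2_condition D k (Suc (Suc i)))) U\<^esub>"
    unfolding section_sheaf_ops wedge_higgs_square[OF sf] ..
qed

lemma T_ocomplex: "is_ocomplex \<A> (T_complex D \<C> g k)"
  unfolding is_ocomplex_def T_complex_def ocomplex.simps omodule_hom_def T_sheaf_eq
proof (intro allI conjI impI ballI)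
  show "is_omodule \<A> (section_sheaf D \<C> g k i (T_condition k i))" for i
    by (rule section_sheaf_omodule[OF subspaces_T])
  show "(\<lambda>s c x ws u. 0) \<in> sections k i (T_condition k i) U \<rightarrow> sections k (Suc i) (T_condition k (Suc i)) U" if "open U" for i U
    using sections_zero[OF that subspaces_T] by blast
qed (simp_all add: section_sheaf_ops fun_eq_iff)

section \<open>Local primitives\<close>

text \<open>Over one chart \<open>c\<close>, the primitive is the one constructed above from the values in the frame of
  \<open>c\<close>; over the other charts, it is the pullback by the extended transition matrices. Outside of
  \<open>D\<close> it is a primitive there because the Higgs field is compatible with pullbacks, and on \<open>D\<close> by
  continuity.\<close>

lemma local_primitive:
  fixes t :: "('x, 'n) form_field"
  assumes U: "open U" and x: "x \<in> U" "c \<in> \<C>" "x \<in> dom_of c"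
    and t: "t \<in> sections (Suc k) (Suc j) (l2_condition D (Suc k) (Suc j)) U"
    and closed: "\<And>c x. wedge_higgs (t c x) = (\<lambda>_ _. 0)"
  shows "\<exists>\<eta>\<in>sections (Suc k) j (l2_condition D (Suc k) j) (U \<inter> dom_of c).
     \<forall>c' y ws u. y \<in> U \<inter> dom_of c \<longrightarrow> wedge_higgs (\<eta> c' y) ws u = t c' y ws u - t c' y ws (drop_t u)"
proof -
  let ?V = "U \<inter> dom_of c"
  have V: "open ?V" using U chart_open[OF C_charts(3)[OF x(2)]] by blast
  have h: "t \<in> higgs_sections D \<C> g (Suc k) (Suc j) U" using t by (simp add: sections_iff)
  note tD = higgs_sectionsD[OF h U]
  have "\<exists>M :: ('x, 'n) chart \<Rightarrow> 'x \<Rightarrow> complex^'n^'n. \<forall>c'\<in>\<C>.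
    (\<forall>x\<in>dom_of c' \<inter> dom_of c. \<forall>i j. hol_at c' x (\<lambda>x. M c' x $ i $ j)) \<and>
    (\<forall>x\<in>dom_of c' \<inter> dom_of c - D. \<forall>v. log_transition c' c x v = M c' x *v v) \<and>
    (\<forall>x\<in>dom_of c' \<inter> dom_of c \<inter> D. M c' x *v axis i\<^sub>1 1 = axis i\<^sub>1 1)"
    by (intro bchoice ballI log_transition_matrix x(2))
  then obtain M :: "('x, 'n) chart \<Rightarrow> 'x \<Rightarrow> complex^'n^'n" where M:
    "\<And>c' x i j. c' \<in> \<C> \<Longrightarrow> x \<in> dom_of c' \<Longrightarrow> x \<in> dom_of c \<Longrightarrow> hol_at c' x (\<lambda>x. M c' x $ i $ j)"
    "\<And>c' x. c' \<in> \<C> \<Longrightarrow> x \<in> dom_of c' \<Longrightarrow> x \<in> dom_of c \<Longrightarrow> x \<notin> D \<Longrightarrow> log_transition c' c x = (\<lambda>v. M c' x *v v)"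
    "\<And>c' x. c' \<in> \<C> \<Longrightarrow> x \<in> dom_of c' \<Longrightarrow> x \<in> dom_of c \<Longrightarrow> x \<in> D \<Longrightarrow> M c' x *v axis i\<^sub>1 1 = axis i\<^sub>1 1"
    by (elim exE) (rule that, auto simp: fun_eq_iff)
  define P where "P y = primitive j k (t c y)" for y
  define \<eta> where "\<eta> c' y = (if c' \<in> \<C> \<and> y \<in> ?V \<inter> dom_of c' then pullback (g c' c y) (\<lambda>v. M c' y *v v) (P y) else (\<lambda>_ _. 0))" for c' y
  have P: "P y \<in> alt_forms j (hpoly (Suc k))" for y
    unfolding P_def by (rule primitive_forms[OF sections_forms[OF t U]])
  have dP: "wedge_higgs (P y) ws u = t c y ws u - t c y ws (drop_t u)" for y ws u
    unfolding P_def by (rule wedge_higgs_primitive[OF sections_forms[OF t U] closed])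
  have \<eta>: "\<eta> c' y = pullback (g c' c y) (\<lambda>v. M c' y *v v) (P y)" if "c' \<in> \<C>" "y \<in> ?V" "y \<in> dom_of c'" for c' y
    using that by (simp add: \<eta>_def)
  have g_hol: "hol_at c' y (g c' c)" if "c' \<in> \<C>" "y \<in> dom_of c'" "y \<in> dom_of c" for c' y
  proof -
    have "holo_at_chart c' (dom_of c' \<inter> dom_of c) (g c' c)"
      using line_bundle that(1) x(2) unfolding line_bundle_def by blast
    then show ?thesis using that holo_at_chart_iff[OF C_charts(3)[OF that(1)], of "dom_of c' \<inter> dom_of c"] by auto
  qed
  have g_coc: "g c1 c y = g c2 c y * g c1 c2 y"
    if "c1 \<in> \<C>" "c2 \<in> \<C>" "y \<in> dom_of c1" "y \<in> dom_of c2" "y \<in> dom_of c" for c1 c2 y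
    using line_bundle that x(2) unfolding line_bundle_def by blast
  have \<eta>_sec: "\<eta> \<in> sections (Suc k) j (l2_condition D (Suc k) j) ?V"
    unfolding sections_iff
  proof (intro conjI ballI higgs_sectionsI[OF V])
    fix c' y
    show "c' \<notin> \<C> \<or> y \<notin> ?V \<or> y \<notin> dom_of c' \<Longrightarrow> \<eta> c' y = (\<lambda>_ _. 0)" by (auto simp: \<eta>_def)
  next
    fix c' y assume c': "c' \<in> \<C>" "y \<in> ?V" "y \<in> dom_of c'"
    show "\<eta> c' y \<in> alt_forms j (hpoly (Suc k))"
      unfolding \<eta>[OF c'] by (rule alt_pullback_sym[OF P clinear_matrix])
  next
    fix c' y ws u assume c': "c' \<in> \<C>" "y \<in> ?V" "y \<in> dom_of c'"
    have "hol_at c' y (\<lambda>y. pullback (g c' c y) (\<lambda>v. M c' y *v v) (P y) ws u)"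
    proof (rule hol_pullback[OF C_charts(3)[OF c'(1)] V c'(2,3)])
      show "P y \<in> alt_forms j (hpoly (Suc k))" for y by (rule P)
      show "hol_at c' y (\<lambda>y. P y vs v)" for vs v
      proof (rule hol_at_C[OF x(2) c'(1)])
        show "hol_at c y (\<lambda>y. P y vs v)"
          unfolding P_def using c' x by (intro hol_primitive tD(3)) auto
      qed (use c' in auto)
    qed (use c' M(1) g_hol in auto)
    then show "hol_at c' y (\<lambda>y. \<eta> c' y ws u)"
    proof (rule hol_at_cong[OF C_charts(3)[OF c'(1)] V c'(2,3), rotated])
      fix y' assume "y' \<in> ?V" "y' \<in> dom_of c'"
      from \<eta>[OF c'(1) this] show "pullback (g c' c y') (\<lambda>v. M c' y' *v v) (P y') ws u = \<eta> c' y' ws u" by simp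
    qed
  next
    fix c1 c2 y
    assume A: "c1 \<in> \<C>" "c2 \<in> \<C>" "y \<in> ?V" "y \<in> dom_of c1" "y \<in> dom_of c2" "y \<notin> D"
    then have yc: "y \<in> dom_of c" by blast
    have L: "log_transition c1 c y = (\<lambda>v. log_transition c2 c y (log_transition c1 c2 y v))"
      using log_transition_cocycle[OF atlas C_charts(1)[OF A(1)] C_charts(1)[OF A(2)] C_charts(1)[OF x(2)] A(4,5) yc A(6)]
      by (simp add: fun_eq_iff)
    have "\<eta> c1 y = pullback (g c1 c y) (log_transition c1 c y) (P y)"
      unfolding \<eta>[OF A(1,3,4)] M(2)[OF A(1,4) yc A(6)] ..
    also have "\<dots> = pullback (g c2 c y * g c1 c2 y) (\<lambda>v. log_transition c2 c y (log_transition c1 c2 y v)) (P y)"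
      unfolding L g_coc[OF A(1,2,4,5) yc] ..
    also have "\<dots> = pullback (g c1 c2 y) (log_transition c1 c2 y) (pullback (g c2 c y) (log_transition c2 c y) (P y))"
      by (rule pullback_compose[OF clinear_log_transition[OF A(2) x(2) A(5) yc A(6)], symmetric])
    also have "pullback (g c2 c y) (log_transition c2 c y) (P y) = \<eta> c2 y"
      unfolding \<eta>[OF A(2,3,5)] M(2)[OF A(2,5) yc A(6)] ..
    finally show "\<eta> c1 y = pullback (g c1 c2 y) (log_transition c1 c2 y) (\<eta> c2 y)" .
  next
    fix c' y assume c': "c' \<in> \<C>" "y \<in> ?V \<inter> dom_of c'"
    show "\<eta> c' y \<in> l2_condition D (Suc k) j y"
    proof (cases "y \<in> D")
      case True
      have "t c y \<in> l2_forms (Suc k) (Suc j)"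
        using sections_Q[OF t subspaces_l2 U, of c y] True by (simp add: l2_condition_def del: l2_forms.simps)
      then have "P y \<in> l2_forms (Suc k) j" unfolding P_def by (rule primitive_l2)
      then have "\<eta> c' y \<in> l2_forms (Suc k) j"
        using c' M(3)[of c' y] True \<eta>[of c' y] by (simp add: l2_forms_pullback clinear_matrix)
      then show ?thesis using True by (simp add: l2_condition_def)
    qed (simp add: l2_condition_def)
  qed
  moreover have "wedge_higgs (\<eta> c' y) ws u = t c' y ws u - t c' y ws (drop_t u)" if y: "y \<in> ?V" for c' y ws u
  proof (cases "c' \<in> \<C> \<and> y \<in> dom_of c'")
    case False
    then have "\<eta> c' y = (\<lambda>_ _. 0)" "t c' y = (\<lambda>_ _. 0)" using tD(1) by (auto simp: \<eta>_def)
    then show ?thesis by simp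
  next
    case True
    \<comment> \<open>Outside of \<open>D\<close>, the equation over \<open>c'\<close> is the pullback of the one over \<open>c\<close>.\<close>
    have off: "wedge_higgs (\<eta> c' z) ws u = t c' z ws u + (-1) * t c' z ws (drop_t u)"
      if z: "z \<in> ?V" "z \<in> dom_of c'" "z \<notin> D" for z
    proof -
      have zc: "z \<in> dom_of c" "z \<in> U" and c': "c' \<in> \<C>" using z True by auto
      let ?L = "log_transition c' c z"
      have L: "clinear_map ?L" by (rule clinear_log_transition[OF c' x(2) z(2) zc(1) z(3)])
      have tz: "t c' z = pullback (g c' c z) ?L (t c z)"
        by (rule tD(4)[OF c' x(2) zc(2) z(2) zc(1) z(3)])
      have "wedge_higgs (\<eta> c' z) = pullback (g c' c z) ?L (wedge_higgs (P z))"
        unfolding \<eta>[OF c' z(1,2)] M(2)[OF c' z(2) zc(1) z(3), symmetric] by (rule wedge_higgs_pullback[OF L])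
      also have "wedge_higgs (P z) = (\<lambda>ws u. 1 * t c z ws u + (-1) * t c z ws (drop_t u))"
        using dP by (simp add: fun_eq_iff)
      finally have "wedge_higgs (\<eta> c' z) ws u = 1 * pullback (g c' c z) ?L (t c z) ws u
          + (-1) * pullback (g c' c z) ?L (\<lambda>ws u. t c z ws (drop_t u)) ws u"
        by (simp only: pullback_lincomb)
      then show ?thesis unfolding pullback_drop_t[OF L] tz[symmetric] by simp
    qed
    have "wedge_higgs (\<eta> c' y) ws u = t c' y ws u + (-1) * t c' y ws (drop_t u)"
    proof (rule hol_at_eq_on_divisor[where f="\<lambda>z. wedge_higgs (\<eta> c' z) ws u" and W="?V"])
      show "c' \<in> log_charts \<A> D" "y \<in> dom_of c'" using True C_charts by auto
      show "hol_at c' y (\<lambda>z. wedge_higgs (\<eta> c' z) ws u)"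
        using True y by (intro hol_wedge_higgs[OF \<eta>_sec V]) auto
      show "hol_at c' y (\<lambda>z. t c' z ws u + (-1) * t c' z ws (drop_t u))"
        using True y by (intro hol_at_add hol_at_mult hol_at_const tD(3)) auto
    qed (use V y off in auto)
    then show ?thesis by simp
  qed
  ultimately show ?thesis by blast
qed

lemma drop_t_sections:
  assumes U: "open U" and t: "t \<in> sections (Suc k) (Suc j) (l2_condition D (Suc k) (Suc j)) U"
    and closed: "\<And>c x. wedge_higgs (t c x) = (\<lambda>_ _. 0)"
  shows "(\<lambda>c x ws u. t c x ws (drop_t u)) \<in> sections (Suc k) (Suc j) (T_condition (Suc k) (Suc j)) U"
  unfolding sections_iff
proof (intro conjI ballI higgs_sectionsI[OF U])
  have h: "t \<in> higgs_sections D \<C> g (Suc k) (Suc j) U" using t by (simp add: sections_iff)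
  note tD = higgs_sectionsD[OF h U]
  have alt: "(\<lambda>ws u. f ws (drop_t u)) \<in> alt_forms i (wpoly \<omega> k m)" if "f \<in> alt_forms i (wpoly \<omega> k m)"
    for f :: "'n form" and i \<omega> k m
    by (rule alt_forms_map[OF that csubspace_wpoly wpoly_drop_t]) auto
  fix c x
  show "c \<notin> \<C> \<or> x \<notin> U \<or> x \<notin> dom_of c \<Longrightarrow> (\<lambda>ws u. t c x ws (drop_t u)) = (\<lambda>_ _. 0)"
    by (simp add: tD(1))
  show a: "(\<lambda>ws u. t c x ws (drop_t u)) \<in> alt_forms (Suc j) (hpoly (Suc k))"
    by (rule alt[OF tD(2)])
  show "c \<in> \<C> \<Longrightarrow> x \<in> U \<Longrightarrow> x \<in> dom_of c \<Longrightarrow> hol_at c x (\<lambda>x. t c x ws (drop_t u))" for ws u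
    by (rule tD(3))
  show "(\<lambda>ws u. t c x ws (drop_t u)) = pullback (g c c' x) (log_transition c c' x) (\<lambda>ws u. t c' x ws (drop_t u))"
    if A: "c \<in> \<C>" "c' \<in> \<C>" "x \<in> U" "x \<in> dom_of c" "x \<in> dom_of c'" "x \<notin> D" for c'
    using pullback_drop_t[OF clinear_log_transition[OF A(1,2,4-)], of "g c c' x" "t c' x"] tD(4)[OF A]
    by (simp add: fun_eq_iff)
  have "(\<lambda>ws u. t c x ws (drop_t u)) \<in> alt_forms (Suc j) (sym_summand (Suc k) (Suc k))"
  proof (rule alt_mono[OF a])
    fix ws
    have "(\<lambda>u. t c x ws (drop_t u)) \<in> hpoly (Suc k)" by (rule alt_val[OF a]) simp
    then show "(\<lambda>u. t c x ws (drop_t u)) \<in> sym_summand (Suc k) (Suc k)" by (simp add: sym_summand_top_iff)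
  qed
  moreover have "wedge_higgs (\<lambda>ws u. t c x ws (drop_t u)) = (\<lambda>_ _. 0)"
    by (rule closed_drop_t(2)[OF tD(2) closed])
  moreover have "(\<lambda>ws u. t c x ws (drop_t u)) \<in> l2_condition D (Suc k) (Suc j) x"
    using sections_Q[OF t subspaces_l2 U, of c x]
    by (auto simp: l2_condition_def l2_forms_iff intro: alt wpoly_drop_t simp del: l2_forms.simps)
  ultimately show "(\<lambda>ws u. t c x ws (drop_t u)) \<in> T_condition (Suc k) (Suc j) x"
    by (simp add: T_condition_def)
qed

section \<open>The quasi-isomorphism\<close>

lemma T_sections_l2:
  assumes "s \<in> sections k i (T_condition k i) U"
  shows "s \<in> sections k i (l2_condition D k i) U"
  using assms T_condition_l2 by (simp add: sections_iff)

lemma T_sections_closed: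
  assumes "s \<in> sections k i (T_condition k i) U" "open U"
  shows "wedge_higgs (s c x) = (\<lambda>_ _. 0)"
  using sections_Q[OF assms(1) subspaces_T assms(2)] T_condition_closed by blast

text \<open>A coboundary vanishes for \<open>t = 0\<close>, whereas sections of \<open>T\<^sup>i\<close> with \<open>i > 0\<close> do not depend on \<open>t\<close>.\<close>

lemma T_coboundary_zero:
  assumes V: "open V" and s: "s \<in> sections k (Suc i) (T_condition k (Suc i)) V"
    and t: "t \<in> sections k i Q V" and eq: "s = (\<lambda>c x. wedge_higgs (t c x))"
  shows "s = (\<lambda>_ _ _ _. 0)"
proof (intro ext)
  fix c x ws u
  have "s c x \<in> alt_forms (Suc i) (sym_summand k k)"
    using sections_Q[OF s subspaces_T V, of c x] by (simp add: T_condition_def)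
  then have "s c x ws \<in> sym_summand k k" by (rule alt_val) (intro csubspaceD csubspace_sym_summand)
  then have "s c x ws u = s c x ws (drop_t u)" by (simp add: sym_summand_top_iff)
  also have "\<dots> = wedge_higgs (t c x) ws (drop_t u)" by (simp add: eq)
  also have "\<dots> = 0" by (rule wedge_higgs_drop_t[OF sections_forms[OF t V]])
  finally show "s c x ws u = 0" .
qed

text \<open>The inclusion. It is injective on cohomology because sections of \<open>T\<^sup>i\<close> that are coboundaries
  vanish, and surjective because a closed section differs from its part free of \<open>t\<close> by the
  differential of a local primitive.\<close>

theorem T_quasi_isomorphism:
  assumes k: "k \<ge> 1"
  shows "quasi_isomorphism \<A> (T_complex D \<C> g k) (l2_higgs_complex D \<C> g k) (\<lambda>i U s. s)"
  unfolding quasi_isomorphism_def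
proof (intro allI conjI impI)
  let ?T = "T_complex D \<C> g k" and ?L = "l2_higgs_complex D \<C> g k"
  have obj: "Obj ?T i = section_sheaf D \<C> g k i (T_condition k i)" "Obj ?L i = section_sheaf D \<C> g k i (l2_condition D k i)" for i
    by (simp_all add: T_complex_def l2_higgs_complex_def T_sheaf_eq)
  have diff: "Diff ?T i U s = (\<lambda>_ _ _ _. 0)" "Diff ?L i U s = (\<lambda>c x. wedge_higgs (s c x))" for i U s
    by (simp_all add: T_complex_def l2_higgs_complex_def)
  show "omodule_hom \<A> (Obj ?T i) (Obj ?L i) (\<lambda>s. \<lambda>t. t)" for i
    unfolding omodule_hom_def obj section_sheaf_ops using T_sections_l2 by auto
  show "\<forall>s\<in>carrier (Sec (Obj ?T i) U). Diff ?T i U s = Diff ?L i U s" if "open U" for i U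
    unfolding obj diff using T_sections_closed[OF _ that] by simp
  fix i and U :: "'x set" and x assume U: "open U" "x \<in> U"
  have res: "Res (Obj ?T i) U V s = (\<lambda>c x ws u. if x \<in> V then s c x ws u else 0)"
    "Res (Obj ?L i) U V s = (\<lambda>c x ws u. if x \<in> V then s c x ws u else 0)" for V s
    unfolding obj section_sheaf_ops by simp_all
  show "\<forall>s\<in>cocycles ?T i U.
      (\<exists>V. open V \<and> x \<in> V \<and> V \<subseteq> U \<and> Res (Obj ?L i) U V s \<in> coboundaries ?L i V) \<longrightarrow>
      (\<exists>V. open V \<and> x \<in> V \<and> V \<subseteq> U \<and> Res (Obj ?T i) U V s \<in> coboundaries ?T i V)"
  proof (intro ballI impI, elim exE conjE)
    fix s V assume s: "s \<in> cocycles ?T i U" and V: "open V" "x \<in> V" "V \<subseteq> U"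
      and cob: "Res (Obj ?L i) U V s \<in> coboundaries ?L i V"
    have sec: "s \<in> sections k i (T_condition k i) U" using s by (simp add: cocycles_def obj)
    let ?s = "\<lambda>c x ws u. if x \<in> V then s c x ws u else 0"
    have sV: "?s \<in> sections k i (T_condition k i) V" by (rule sections_restrict[OF U(1) V(1,3) sec])
    have "?s \<in> coboundaries ?T i V"
    proof (cases i)
      case 0
      then show ?thesis using cob unfolding res by (simp add: obj section_sheaf_ops)
    next
      case (Suc j)
      obtain t where t: "t \<in> sections k j (l2_condition D k j) V" "?s = (\<lambda>c x. wedge_higgs (t c x))"
        using cob[unfolded res] unfolding Suc by (auto simp: obj diff)
      have "?s = (\<lambda>_ _ _ _. 0)"
        by (rule T_coboundary_zero[OF V(1) sV[unfolded Suc] t])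
      then show ?thesis
        using sections_zero[OF V(1) subspaces_T, of k j k j] unfolding Suc
        by (simp add: obj diff image_constant_conv) blast
    qed
    then show "\<exists>V. open V \<and> x \<in> V \<and> V \<subseteq> U \<and> Res (Obj ?T i) U V s \<in> coboundaries ?T i V"
      unfolding res using V by blast
  qed
  show "\<forall>t\<in>cocycles ?L i U. \<exists>V. open V \<and> x \<in> V \<and> V \<subseteq> U \<and>
      (\<exists>s\<in>cocycles ?T i V. \<exists>b\<in>coboundaries ?L i V. Res (Obj ?L i) U V t = s \<oplus>\<^bsub>Sec (Obj ?L i) V\<^esub> b)"
  proof
    fix t assume t: "t \<in> cocycles ?L i U"
    then have tsec: "t \<in> sections k i (l2_condition D k i) U"
      and "(\<lambda>c x. wedge_higgs (t c x)) = (\<lambda>c x ws u. 0)"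
      by (simp_all add: cocycles_def obj diff section_sheaf_ops)
    from fun_cong[OF fun_cong[OF this(2)]] have closed: "wedge_higgs (t c x) = (\<lambda>_ _. 0)" for c x .
    have T_cocycle: "s \<in> cocycles ?T i V" if "s \<in> sections k i (T_condition k i) V" for s V
      using that by (simp add: cocycles_def obj diff section_sheaf_ops)
    show "\<exists>V. open V \<and> x \<in> V \<and> V \<subseteq> U \<and>
      (\<exists>s\<in>cocycles ?T i V. \<exists>b\<in>coboundaries ?L i V. Res (Obj ?L i) U V t = s \<oplus>\<^bsub>Sec (Obj ?L i) V\<^esub> b)"
    proof (cases i)
      case 0
      have "t c x [] \<in> sym_summand k 0" for c x
      proof (rule closed_sym_summand_0)
        show "t c x [] \<in> hpoly k" by (rule alt_val[OF sections_forms[OF tsec U(1)]]) simp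
        show "higgs w (t c x []) = (\<lambda>_. 0)" for w
          using fun_cong[OF closed[of c x], of "[w]"] by (simp add: wedge_higgs_def[abs_def] drop_nth_def)
      qed
      then have val: "t c x ws \<in> sym_summand k 0" if "length ws = 0" for c x ws
        using that by simp
      have "t c x \<in> alt_forms 0 (sym_summand k 0)" for c x
        by (rule alt_mono[OF sections_forms[OF tsec U(1), unfolded 0] val])
      then have "t \<in> sections k i (T_condition k i) U"
        using tsec 0 by (simp add: sections_iff T_condition_def)
      moreover have "(\<lambda>_ _ _ _. 0) \<in> coboundaries ?L i U" by (simp add: 0 obj section_sheaf_ops)
      moreover have "Res (Obj ?L i) U U t = t \<oplus>\<^bsub>Sec (Obj ?L i) U\<^esub> (\<lambda>_ _ _ _. 0)"
        unfolding res obj section_sheaf_ops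
      proof (intro ext)
        fix c y ws u
        show "(if y \<in> U then t c y ws u else 0) = t c y ws u + 0"
        proof (cases "y \<in> U")
          case False
          then have "t c y = (\<lambda>_ _. 0)" by (intro sections_outside[OF tsec U(1)]) blast
          then show ?thesis using False by simp
        qed simp
      qed
      ultimately show ?thesis using T_cocycle U by blast
    next
      case (Suc j)
      obtain k' where k': "k = Suc k'" using k by (cases k) auto
      obtain c where c: "c \<in> \<C>" "x \<in> dom_of c"
        using line_bundle unfolding line_bundle_def by blast
      let ?V = "U \<inter> dom_of c"
      have V: "open ?V" using U chart_open[OF C_charts(3)[OF c(1)]] by blast
      note ts = tsec[unfolded Suc k']
      obtain \<eta> where \<eta>: "\<eta> \<in> sections k j (l2_condition D k j) ?V"
        "\<And>c' y ws u. y \<in> ?V \<Longrightarrow> wedge_higgs (\<eta> c' y) ws u = t c' y ws u - t c' y ws (drop_t u)"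
        using local_primitive[OF U(1,2) c ts closed] k' by blast
      define s where "s = (\<lambda>c y ws u. if y \<in> ?V then t c y ws (drop_t u) else 0)"
      have "s \<in> sections k i (T_condition k i) ?V"
        unfolding s_def Suc k' by (rule sections_restrict[OF U(1) V _ drop_t_sections[OF U(1) ts closed]]) simp
      then have "s \<in> cocycles ?T i ?V" by (rule T_cocycle)
      moreover have "(\<lambda>c y. wedge_higgs (\<eta> c y)) \<in> coboundaries ?L i ?V"
        using \<eta>(1) by (simp add: Suc obj diff)
      moreover have "Res (Obj ?L i) U ?V t = s \<oplus>\<^bsub>Sec (Obj ?L i) ?V\<^esub> (\<lambda>c y. wedge_higgs (\<eta> c y))"
        unfolding res obj section_sheaf_ops
      proof (intro ext)
        fix c' y ws u
        show "(if y \<in> ?V then t c' y ws u else 0) = s c' y ws u + wedge_higgs (\<eta> c' y) ws u"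
        proof (cases "y \<in> ?V")
          case True
          then show ?thesis using \<eta>(2)[OF True] by (simp add: s_def)
        next
          case False
          then have "\<eta> c' y = (\<lambda>_ _. 0)" using sections_outside[OF \<eta>(1) V] by blast
          then have "wedge_higgs (\<eta> c' y) ws u = 0" by simp
          moreover have "s c' y ws u = 0" unfolding s_def using False by (simp only: if_False)
          ultimately show ?thesis using False by (simp only: if_False add_0)
        qed
      qed
      ultimately show ?thesis using V U c by blast
    qed
  qed
qed

end

theorem theorem0p4:
  fixes \<Gamma> :: "(complex^('n::finite option)^('n option)) set"
    and \<A> \<C> :: "('x::t2_space, 'n) chart set"
    and \<pi> :: "complex^'n \<Rightarrow> 'x"
    and D :: "'x set"
    and g :: "('x, 'n) chart \<Rightarrow> ('x, 'n) chart \<Rightarrow> 'x \<Rightarrow> complex"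
    and k :: nat
  assumes "arithmetic_subgroup TYPE('m::finite) \<Gamma>"
    and "torsion_free \<Gamma>"
    and "toroidal_compactification \<Gamma> \<A> \<pi> D"
    and "\<not> compact (\<pi> ` ball 0 1)"
    and "unipotent_monodromy \<Gamma>"
    and "\<C> \<subseteq> log_charts \<A> D"
    and "line_bundle \<C> g"
    and "root_of_log_canonical D \<C> g"
    and "k \<ge> 1"
  shows "quasi_isomorphic \<A> (l2_higgs_complex D \<C> g k) (T_complex D \<C> g k)"
proof -
  interpret log_bundle \<A> \<C> D g
    using assms(3,6,7) by unfold_locales (auto simp: toroidal_compactification_def)
  show ?thesis
    unfolding quasi_isomorphic_def
  proof (intro conjI l2_higgs_ocomplex T_ocomplex)
    let ?R = "\<lambda>K K'. is_ocomplex \<A> K \<and> is_ocomplex \<A> K' \<and> (\<exists>\<phi>. quasi_isomorphism \<A> K K' \<phi>)"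
    have "?R (T_complex D \<C> g k) (l2_higgs_complex D \<C> g k)"
      using l2_higgs_ocomplex T_ocomplex T_quasi_isomorphism[OF assms(9)] by blast
    then have "equivclp ?R (T_complex D \<C> g k) (l2_higgs_complex D \<C> g k)"
      by (rule r_into_equivclp)
    then show "equivclp ?R (l2_higgs_complex D \<C> g k) (T_complex D \<C> g k)"
      by (rule equivclp_sym)
  qed
qed

end
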